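(* Let $\hbar>0$, let $V:\hbar\mathbb{Z}^n\to[0,\infty)$ satisfy $V(k)\to\infty$ as $|k|\to\infty$, and let $T>0$. Let $s\in\mathbb{R}$ and $f\in L^2([0,T];\mathrm{H}^s_{\mathcal{H}_{\hbar,V}})$. Assume that the real-valued function $a\in L^\infty_1([0,T])$ satisfies $\inf_{t\in[0,T]}a(t)=a_0>0$ and that the real-valued function $q$ belongs to $L^\infty([0,T])$. If $(u_0,u_1)\in \mathrm{H}^{1+s}_{\mathcal{H}_{\hbar,V}}\times \mathrm{H}^{s}_{\mathcal{H}_{\hbar,V}}$, then the Cauchy problem $$\begin{cases}\partial_t^2u(t,k)+a(t)\mathcal{H}_{\hbar,V}u(t,k)+q(t)u(t,k)=f(t,k),&(t,k)\in(0,T]\times\hbar\mathbb{Z}^n,\\ u(0,k)=u_0(k),\quad \partial_tu(0,k)=u_1(k),&k\in\hbar\mathbb{Z}^n,\end{cases}$$ has a unique solution $u\in C([0,T];\mathrm{H}^{1+s}_{\mathcal{H}_{\hbar,V}})\cap C^1([0,T];\mathrm{H}^{s}_{\mathcal{H}_{\hbar,V}})$, and it satisfies, for all $t\in[0,T]$, $$\|u(t,\cdot)\|^2_{\mathrm{H}^{1+s}_{\mathcal{H}_{\hbar,V}}}+\|\partial_tu(t,\cdot)\|^2_{\mathrm{H}^{s}_{\mathcal{H}_{\hbar,V}}}\le C_T\Big(\|u_0\|^2_{\mathrm{H}^{1+s}_{\mathcal{H}_{\hbar,V}}}+\|u_1\|^2_{\mathrm{H}^{s}_{\mathcal{H}_{\hbar,V}}}+\|f\|^2_{L^2([0,T];\mathrm{H}^{s}_{\mathcal{H}_{\hbar,V}})}\Big),$$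 where $$C_T=c_0^{-1}(1+\|a\|_{L^\infty})\,e^{c_0^{-1}\left(1+\|a'\|_{L^\infty}+\|q\|_{L^\infty}+2\|a\|_{L^\infty}\right)T},\qquad c_0=\min\{a_0,1\}.$$
   Context: $\hbar\mathbb{Z}^n=\{\hbar k:k\in\mathbb{Z}^n\}$; $v_j$ is the $j$-th standard basis vector of $\mathbb{Z}^n$; $\ell^2(\hbar\mathbb{Z}^n)$ carries the inner product $(f,g)=\sum_{k\in\hbar\mathbb{Z}^n}f(k)\overline{g(k)}$. The discrete Schrödinger operator is $\mathcal{H}_{\hbar,V}u(k)=-\hbar^{-2}\big[\sum_{j=1}^n(u(k+\hbar v_j)+u(k-\hbar v_j))-2n\,u(k)\big]+V(k)u(k)$, self-adjoint and non-negative in $\ell^2(\hbar\mathbb{Z}^n)$ with domain $\{u\in\ell^2:(I+\mathcal{H}_{\hbar,V})u\in\ell^2\}$. Under the assumption on $V$ it has purely discrete spectrum, with eigenvalues $\lambda_\xi\ge0$ ($\xi\in\mathcal{I}_\hbar$, a countable index set) and an orthonormal basis $(u_\xi)_{\xi\in\mathcal{I}_\hbar}$ of $\ell^2(\hbar\mathbb{Z}^n)$ of eigenvectors. $\mathrm{H}^{\infty}_{\mathcal{H}_{\hbar,V}}=\bigcap_{m\ge1}\mathrm{Dom}(\mathcal{H}_{\hbar,V}^m)$ with the Fréchet topology of the norms $\max_{j\le m}\|(I+\mathcal{H}_{\hbar,V})^ju\|_{\ell^2}$, and $\mathrm{H}^{-\infty}_{\mathcal{H}_{\hbar,V}}$ is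 the space of continuous linear functionals on it. For $s\in\mathbb{R}$, $\mathrm{H}^s_{\mathcal{H}_{\hbar,V}}=\{u\in\mathrm{H}^{-\infty}_{\mathcal{H}_{\hbar,V}}:(I+\mathcal{H}_{\hbar,V})^{s/2}u\in\ell^2(\hbar\mathbb{Z}^n)\}$ with norm $\|u\|_{\mathrm{H}^s_{\mathcal{H}_{\hbar,V}}}=\|(I+\mathcal{H}_{\hbar,V})^{s/2}u\|_{\ell^2}=\big(\sum_{\xi}(1+\lambda_\xi)^s|\widehat u(\xi)|^2\big)^{1/2}$, where $\widehat u(\xi)=(u,u_\xi)$. $a\in L^\infty_m([0,T])$ means that $a\in L^\infty([0,T])$ is $m$-times differentiable with $\partial_t^ja\in L^\infty([0,T])$ for $j=1,\dots,m$. *)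

theory Defs
  imports "HOL-Analysis.Analysis" "HOL-Probability.Essential_Supremum"
begin

text \<open>A function on the lattice is represented by a function on the ambient space that vanishes
  off the lattice.\<close>

type_synonym 'n gridfun = "real ^ 'n \<Rightarrow> complex"

definition lattice :: "real \<Rightarrow> (real ^ 'n) set" where
  "lattice h = {h *\<^sub>R k | k. \<forall>i. k $ i \<in> \<int>}"

definition ell2 :: "real \<Rightarrow> ('n::finite) gridfun set" where
  "ell2 h = {u. (\<forall>k. k \<notin> lattice h \<longrightarrow> u k = 0) \<and> (\<lambda>k. (cmod (u k))\<^sup>2) summable_on lattice h}"

definition ell2_inner :: "real \<Rightarrow> ('n::finite) gridfun \<Rightarrow> 'n gridfun \<Rightarrow> complex" where
  "ell2_inner h f g = (\<Sum>\<^sub>\<infinity>k\<in>lattice h. f k * cnj (g k))"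

definition ell2_norm :: "real \<Rightarrow> ('n::finite) gridfun \<Rightarrow> real" where
  "ell2_norm h u = sqrt (\<Sum>\<^sub>\<infinity>k\<in>lattice h. (cmod (u k))\<^sup>2)"

definition schroedinger :: "real \<Rightarrow> (real ^ 'n \<Rightarrow> real) \<Rightarrow> ('n::finite) gridfun \<Rightarrow> 'n gridfun" where
  "schroedinger h V u = (\<lambda>k. if k \<in> lattice h then
      - of_real (inverse (h\<^sup>2)) *
        ((\<Sum>j\<in>UNIV. u (k + h *\<^sub>R axis j 1) + u (k - h *\<^sub>R axis j 1)) - 2 * of_nat CARD('n) * u k)
      + of_real (V k) * u k
    else 0)"

definition one_plus_H :: "real \<Rightarrow> (real ^ 'n \<Rightarrow> real) \<Rightarrow> ('n::finite) gridfun \<Rightarrow> 'n gridfun" where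
  "one_plus_H h V u = (\<lambda>k. u k + schroedinger h V u k)"

definition dom_H :: "real \<Rightarrow> (real ^ 'n \<Rightarrow> real) \<Rightarrow> ('n::finite) gridfun set" where
  "dom_H h V = {u \<in> ell2 h. one_plus_H h V u \<in> ell2 h}"

primrec dom_H_pow :: "real \<Rightarrow> (real ^ 'n \<Rightarrow> real) \<Rightarrow> nat \<Rightarrow> ('n::finite) gridfun set" where
  "dom_H_pow h V 0 = ell2 h"
| "dom_H_pow h V (Suc m) = {u \<in> dom_H h V. schroedinger h V u \<in> dom_H_pow h V m}"

text \<open>The space of square summable functions on the lattice is separable and infinite-dimensional,
  so the countable index set of an orthonormal basis can be taken to be the natural numbers.\<close>

definition eigenbasis ::
  "real \<Rightarrow> (real ^ 'n \<Rightarrow> real) \<Rightarrow> (nat \<Rightarrow> real) \<Rightarrow> (nat \<Rightarrow> ('n::finite) gridfun) \<Rightarrow> bool" where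
  "eigenbasis h V lam e \<longleftrightarrow>
     (\<forall>\<xi>. e \<xi> \<in> dom_H h V \<and> 0 \<le> lam \<xi> \<and>
          schroedinger h V (e \<xi>) = (\<lambda>k. of_real (lam \<xi>) * e \<xi> k)) \<and>
     (\<forall>\<xi> \<eta>. ell2_inner h (e \<xi>) (e \<eta>) = (if \<xi> = \<eta> then 1 else 0)) \<and>
     (\<forall>g\<in>ell2 h. (\<lambda>N. ell2_norm h (\<lambda>k. g k - (\<Sum>\<xi><N. ell2_inner h g (e \<xi>) * e \<xi> k)))
                   \<longlonglongrightarrow> 0)"

text \<open>For \<open>V\<close> nonnegative and tending to infinity an eigenbasis exists, the spectrum being purely
  discrete. The eigenbasis is used only in \<open>H_power\<close>, whose value does not depend on the choice.\<close>

definition the_eigenbasis ::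
  "real \<Rightarrow> (real ^ 'n \<Rightarrow> real) \<Rightarrow> (nat \<Rightarrow> real) \<times> (nat \<Rightarrow> ('n::finite) gridfun)" where
  "the_eigenbasis h V = (SOME (lam, e). eigenbasis h V lam e)"

definition eigval :: "real \<Rightarrow> (real ^ 'n::finite \<Rightarrow> real) \<Rightarrow> nat \<Rightarrow> real" where
  "eigval h V = fst (the_eigenbasis h V)"

definition eigvec :: "real \<Rightarrow> (real ^ 'n \<Rightarrow> real) \<Rightarrow> nat \<Rightarrow> ('n::finite) gridfun" where
  "eigvec h V = snd (the_eigenbasis h V)"

text \<open>For \<open>\<phi>\<close> in \<open>H_inf h V\<close> (below) this is the value of \<open>(I + H)\<^sup>r\<close> at \<open>\<phi>\<close>; by Bessel's inequality the
  series converges absolutely at each lattice point.\<close>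

definition H_power :: "real \<Rightarrow> (real ^ 'n \<Rightarrow> real) \<Rightarrow> real \<Rightarrow> ('n::finite) gridfun \<Rightarrow> 'n gridfun" where
  "H_power h V r \<phi> = (\<lambda>k. \<Sum>\<^sub>\<infinity>\<xi>\<in>UNIV.
     of_real ((1 + eigval h V \<xi>) powr r) * ell2_inner h \<phi> (eigvec h V \<xi>) * eigvec h V \<xi> k)"

definition H_inf :: "real \<Rightarrow> (real ^ 'n \<Rightarrow> real) \<Rightarrow> ('n::finite) gridfun set" where
  "H_inf h V = (\<Inter>m\<in>{1..}. dom_H_pow h V m)"

definition H_inf_norm :: "real \<Rightarrow> (real ^ 'n \<Rightarrow> real) \<Rightarrow> nat \<Rightarrow> ('n::finite) gridfun \<Rightarrow> real" where
  "H_inf_norm h V m \<phi> = Max ((\<lambda>j. ell2_norm h ((one_plus_H h V ^^ j) \<phi>)) ` {..m})"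

type_synonym 'n distr = "'n gridfun \<Rightarrow> complex"

text \<open>Functionals are extended by zero off the smooth vectors, so that equality of distributions is
  equality of functions. The norms \<open>H_inf_norm h V m\<close> increase with \<open>m\<close>, so their balls form a
  neighbourhood basis.\<close>

definition H_minus_inf :: "real \<Rightarrow> (real ^ 'n \<Rightarrow> real) \<Rightarrow> ('n::finite) distr set" where
  "H_minus_inf h V = {w.
     (\<forall>\<phi>. \<phi> \<notin> H_inf h V \<longrightarrow> w \<phi> = 0) \<and>
     (\<forall>\<phi>\<in>H_inf h V. \<forall>\<psi>\<in>H_inf h V. w (\<lambda>k. \<phi> k + \<psi> k) = w \<phi> + w \<psi>) \<and>
     (\<forall>c. \<forall>\<phi>\<in>H_inf h V. w (\<lambda>k. c * \<phi> k) = c * w \<phi>) \<and>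
     (\<forall>\<phi>\<in>H_inf h V. \<forall>\<epsilon>>0. \<exists>m. \<exists>\<delta>>0. \<forall>\<psi>\<in>H_inf h V.
        H_inf_norm h V m (\<lambda>k. \<psi> k - \<phi> k) < \<delta> \<longrightarrow> cmod (w \<psi> - w \<phi>) < \<epsilon>)}"

text \<open>The embedding of square summable functions into distributions uses the bilinear pairing, so that
  it is complex linear; hence the Fourier coefficient \<open>(u, u\<^sub>\<xi>)\<close> of a distribution \<open>u\<close> is its value
  at the complex conjugate of \<open>u\<^sub>\<xi>\<close>.\<close>

definition emb :: "real \<Rightarrow> (real ^ 'n \<Rightarrow> real) \<Rightarrow> ('n::finite) gridfun \<Rightarrow> 'n distr" where
  "emb h V g = (\<lambda>\<phi>. if \<phi> \<in> H_inf h V then \<Sum>\<^sub>\<infinity>k\<in>lattice h. g k * \<phi> k else 0)"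

text \<open>Operators act on distributions by transposition; \<open>H\<close> and the powers of \<open>I + H\<close> commute with
  complex conjugation, so they are their own transposes for the bilinear pairing.\<close>

definition H_distr :: "real \<Rightarrow> (real ^ 'n \<Rightarrow> real) \<Rightarrow> ('n::finite) distr \<Rightarrow> 'n distr" where
  "H_distr h V w = (\<lambda>\<phi>. if \<phi> \<in> H_inf h V then w (schroedinger h V \<phi>) else 0)"

definition H_power_distr :: "real \<Rightarrow> (real ^ 'n \<Rightarrow> real) \<Rightarrow> real \<Rightarrow> ('n::finite) distr \<Rightarrow> 'n distr" where
  "H_power_distr h V r w = (\<lambda>\<phi>. if \<phi> \<in> H_inf h V then w (H_power h V r \<phi>) else 0)"

definition Hs :: "real \<Rightarrow> (real ^ 'n \<Rightarrow> real) \<Rightarrow> real \<Rightarrow> ('n::finite) distr set" where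
  "Hs h V s = {w \<in> H_minus_inf h V. H_power_distr h V (s / 2) w \<in> emb h V ` ell2 h}"

definition Hs_norm :: "real \<Rightarrow> (real ^ 'n \<Rightarrow> real) \<Rightarrow> real \<Rightarrow> ('n::finite) distr \<Rightarrow> real" where
  "Hs_norm h V s w = ell2_norm h (the_inv_into (ell2 h) (emb h V) (H_power_distr h V (s / 2) w))"

definition L_infty :: "real \<Rightarrow> (real \<Rightarrow> real) \<Rightarrow> bool" where
  "L_infty T g \<longleftrightarrow> g \<in> borel_measurable (lebesgue_on {0..T}) \<and>
     esssup (lebesgue_on {0..T}) (\<lambda>t. ereal \<bar>g t\<bar>) < \<infinity>"

definition L_infty_norm :: "real \<Rightarrow> (real \<Rightarrow> real) \<Rightarrow> real" where
  "L_infty_norm T g = real_of_ereal (esssup (lebesgue_on {0..T}) (\<lambda>t. ereal \<bar>g t\<bar>))"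

definition time_deriv :: "real \<Rightarrow> (real \<Rightarrow> real) \<Rightarrow> real \<Rightarrow> real" where
  "time_deriv T g t = vector_derivative g (at t within {0..T})"

definition L_infty_diff :: "nat \<Rightarrow> real \<Rightarrow> (real \<Rightarrow> real) \<Rightarrow> bool" where
  "L_infty_diff m T g \<longleftrightarrow>
     (\<forall>j<m. \<forall>t\<in>{0..T}. (time_deriv T ^^ j) g differentiable (at t within {0..T})) \<and>
     (\<forall>j\<le>m. L_infty T ((time_deriv T ^^ j) g))"

text \<open>\<open>L\<^sup>2([0,T]; H\<^sup>s)\<close> in the sense of Bochner: almost everywhere limits, in the norm of \<open>H\<^sup>s\<close>, of
  simple functions.\<close>

definition L2_Hs :: "real \<Rightarrow> (real ^ 'n \<Rightarrow> real) \<Rightarrow> real \<Rightarrow> real \<Rightarrow> (real \<Rightarrow> ('n::finite) distr) \<Rightarrow> bool" where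
  "L2_Hs h V T s f \<longleftrightarrow>
     (AE t in lebesgue_on {0..T}. f t \<in> Hs h V s) \<and>
     (\<exists>\<sigma>. (\<forall>i. simple_function (lebesgue_on {0..T}) (\<sigma> i) \<and> \<sigma> i ` {0..T} \<subseteq> Hs h V s) \<and>
          (AE t in lebesgue_on {0..T}. (\<lambda>i. Hs_norm h V s (\<lambda>\<phi>. \<sigma> i t \<phi> - f t \<phi>)) \<longlonglongrightarrow> 0)) \<and>
     integrable (lebesgue_on {0..T}) (\<lambda>t. (Hs_norm h V s (f t))\<^sup>2)"

definition L2_Hs_norm ::
  "real \<Rightarrow> (real ^ 'n \<Rightarrow> real) \<Rightarrow> real \<Rightarrow> real \<Rightarrow> (real \<Rightarrow> ('n::finite) distr) \<Rightarrow> real" where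
  "L2_Hs_norm h V T s f = sqrt (LINT t|lebesgue_on {0..T}. (Hs_norm h V s (f t))\<^sup>2)"

definition C0_Hs :: "real \<Rightarrow> (real ^ 'n \<Rightarrow> real) \<Rightarrow> real \<Rightarrow> real \<Rightarrow> (real \<Rightarrow> ('n::finite) distr) \<Rightarrow> bool" where
  "C0_Hs h V T s u \<longleftrightarrow> (\<forall>t\<in>{0..T}. u t \<in> Hs h V s \<and>
     ((\<lambda>\<tau>. Hs_norm h V s (\<lambda>\<phi>. u \<tau> \<phi> - u t \<phi>)) \<longlongrightarrow> 0) (at t within {0..T}))"

definition has_Hs_derivative ::
  "real \<Rightarrow> (real ^ 'n \<Rightarrow> real) \<Rightarrow> real \<Rightarrow> real \<Rightarrow> (real \<Rightarrow> ('n::finite) distr) \<Rightarrow> 'n distr \<Rightarrow> real \<Rightarrow> bool"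
  where
  "has_Hs_derivative h V T s u w t \<longleftrightarrow> w \<in> Hs h V s \<and>
     ((\<lambda>\<tau>. Hs_norm h V s (\<lambda>\<phi>. (u \<tau> \<phi> - u t \<phi>) / of_real (\<tau> - t) - w \<phi>)) \<longlongrightarrow> 0)
       (at t within {0..T})"

definition Hs_deriv ::
  "real \<Rightarrow> (real ^ 'n \<Rightarrow> real) \<Rightarrow> real \<Rightarrow> real \<Rightarrow> (real \<Rightarrow> ('n::finite) distr) \<Rightarrow> real \<Rightarrow> 'n distr" where
  "Hs_deriv h V T s u t = (THE w. has_Hs_derivative h V T s u w t)"

definition C1_Hs :: "real \<Rightarrow> (real ^ 'n \<Rightarrow> real) \<Rightarrow> real \<Rightarrow> real \<Rightarrow> (real \<Rightarrow> ('n::finite) distr) \<Rightarrow> bool" where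
  "C1_Hs h V T s u \<longleftrightarrow> C0_Hs h V T s u \<and>
     (\<forall>t\<in>{0..T}. \<exists>w. has_Hs_derivative h V T s u w t) \<and> C0_Hs h V T s (Hs_deriv h V T s u)"

definition test_function :: "real \<Rightarrow> (real \<Rightarrow> real) \<Rightarrow> bool" where
  "test_function T \<psi> \<longleftrightarrow>
     (\<forall>n x. (deriv ^^ n) \<psi> field_differentiable (at x)) \<and>
     (\<exists>c d. 0 < c \<and> d < T \<and> (\<forall>x. x \<notin> {c..d} \<longrightarrow> \<psi> x = 0))"

text \<open>Since \<open>q\<close> and \<open>f\<close> are only defined almost everywhere in time, the second time derivative of
  a solution is the distributional one: the equation holds in the sense of distributions on the
  open time interval with values in \<open>H_minus_inf h V\<close>. A pointwise reading on the lattice would not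
  do for negative \<open>s\<close>: finitely supported functions need not be dense in \<open>H_inf h V\<close>, so a
  distribution need not be determined by its values at lattice points.\<close>

definition wave_equation ::
  "real \<Rightarrow> (real ^ 'n \<Rightarrow> real) \<Rightarrow> real \<Rightarrow> (real \<Rightarrow> real) \<Rightarrow> (real \<Rightarrow> real) \<Rightarrow>
    (real \<Rightarrow> ('n::finite) distr) \<Rightarrow> (real \<Rightarrow> 'n distr) \<Rightarrow> bool" where
  "wave_equation h V T a q f u \<longleftrightarrow>
     (\<forall>\<phi>\<in>H_inf h V. \<forall>\<psi>. test_function T \<psi> \<longrightarrow>
        (LINT t|lebesgue_on {0..T}.
            of_real ((deriv ^^ 2) \<psi> t) * u t \<phi>
          + of_real (\<psi> t) * (of_real (a t) * H_distr h V (u t) \<phi> + of_real (q t) * u t \<phi>))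
      = (LINT t|lebesgue_on {0..T}. of_real (\<psi> t) * f t \<phi>))"

definition wave_solution ::
  "real \<Rightarrow> (real ^ 'n \<Rightarrow> real) \<Rightarrow> real \<Rightarrow> real \<Rightarrow> (real \<Rightarrow> real) \<Rightarrow> (real \<Rightarrow> real) \<Rightarrow>
    (real \<Rightarrow> ('n::finite) distr) \<Rightarrow> 'n distr \<Rightarrow> 'n distr \<Rightarrow> (real \<Rightarrow> 'n distr) \<Rightarrow> bool" where
  "wave_solution h V T s a q f u0 u1 u \<longleftrightarrow>
     C0_Hs h V T (1 + s) u \<and> C1_Hs h V T s u \<and> wave_equation h V T a q f u \<and>
     u 0 = u0 \<and> Hs_deriv h V T s u 0 = u1"

end

theory Submission
  imports Defs "HOL-Complex_Analysis.Great_Picard" "HOL-Computational_Algebra.Polynomial"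
begin

text \<open>Since \<open>V\<close> tends to infinity, the form domain of \<open>H\<close> embeds compactly into the square summable
  functions, so successive minimisation of the quadratic form yields an eigenbasis; testing the
  minimisers against the lattice delta functions gives the eigenvalue equation. The operator \<open>H\<close> has
  real coefficients, so the complex conjugates \<open>d\<^sub>\<xi>\<close> of the eigenvectors form an eigenbasis as well, and a
  distribution \<open>w\<close> lies in \<open>H\<^sup>s\<close> exactly if \<open>(1 + \<lambda>\<^sub>\<xi>)\<^sup>s |w(d\<^sub>\<xi>)|\<^sup>2\<close> is summable.

  In these coordinates the wave equation decouples into the ordinary differential equations
  \<open>v'' + (a \<lambda> + q) v = f\<^sub>\<xi>\<close> with bounded measurable coefficients. By the lemma of du Bois-Reymond the weak
  equation says that \<open>v'\<close> is an indefinite integral; the energy \<open>a (1 + \<lambda>) |v|\<^sup>2 + |v'|\<^sup>2\<close> then satisfies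
  a Gronwall inequality with constants independent of \<open>\<lambda>\<close>. Summing over the modes gives the estimate and
  uniqueness. Solutions of the single modes exist by contraction, and the energy bound provides the
  dominating series that makes their sum a solution.\<close>

subsection \<open>Square summable functions on the lattice\<close>

text \<open>In time the data are only measurable and essentially bounded or square integrable, and a
  solution has no classical second derivative. Calculus is therefore done on pairs (F, g) with F an
  indefinite integral of g (\<open>primitive\<close>): product rule, Gronwall inequality and modal
  equations are stated for such pairs. The coefficient \<open>a\<close> fits in, because a function
  differentiable at every point of the interval with integrable derivative is the integral of that
  derivative.

  The bilinear embedding forces two bases. Distributions are tested at the conjugate eigenvectors,
  while \<open>H_power\<close> is defined through the eigenvectors themselves; both diagonalise it
  because a spectral multiplier does not depend on the eigenbasis.

  Origin of the constant: with A, A', Q the norms of a, a', q, the modal energy E dominates c_0 ((1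
  + \<lambda>) |v|^2 + |v'|^2). Its growth rate is at most (1 + A' + Q + A) / c_0, and its initial
  value together with the forcing costs a factor of at most 1 + A. Dividing by c_0 and enlarging A
  to 2 A in the exponent gives C_T.\<close>

lemma ell2I:
  assumes "\<And>k. k \<notin> lattice h \<Longrightarrow> u k = 0"
    and "(\<lambda>k. (cmod (u k))\<^sup>2) summable_on lattice h"
  shows "u \<in> ell2 h"
  using assms by (auto simp: ell2_def)

lemma ell2_off: "u \<in> ell2 h \<Longrightarrow> k \<notin> lattice h \<Longrightarrow> u k = 0"
  by (simp add: ell2_def)

lemma ell2_summable: "u \<in> ell2 h \<Longrightarrow> (\<lambda>k. (cmod (u k))\<^sup>2) summable_on lattice h"
  by (simp add: ell2_def)

lemma ell2_bddI:
  assumes "\<And>k. k \<notin> lattice h \<Longrightarrow> u k = 0"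
    and "\<And>F. finite F \<Longrightarrow> F \<subseteq> lattice h \<Longrightarrow> (\<Sum>k\<in>F. (cmod (u k))\<^sup>2) \<le> B"
  shows "u \<in> ell2 h"
  by (rule ell2I[OF assms(1)], assumption, rule nonneg_bdd_above_summable_on)
     (auto intro!: bdd_aboveI2 assms(2))

lemma ell2_norm_nonneg [simp]: "0 \<le> ell2_norm h u"
  by (simp add: ell2_norm_def infsum_nonneg)

lemma ell2_norm_sq: "(ell2_norm h u)\<^sup>2 = (\<Sum>\<^sub>\<infinity>k\<in>lattice h. (cmod (u k))\<^sup>2)"
  by (simp add: ell2_norm_def infsum_nonneg)

lemma ell2_norm_le_bdd:
  assumes "u \<in> ell2 h"
    and "\<And>F. finite F \<Longrightarrow> F \<subseteq> lattice h \<Longrightarrow> (\<Sum>k\<in>F. (cmod (u k))\<^sup>2) \<le> B"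
  shows "(ell2_norm h u)\<^sup>2 \<le> B"
  unfolding ell2_norm_sq by (rule infsum_le_finite_sums[OF ell2_summable]) (use assms in auto)

lemma ell2_finite_sum_le:
  assumes "u \<in> ell2 h" "finite F" "F \<subseteq> lattice h"
  shows "(\<Sum>k\<in>F. (cmod (u k))\<^sup>2) \<le> (ell2_norm h u)\<^sup>2"
  unfolding ell2_norm_sq by (rule finite_sum_le_infsum[OF ell2_summable]) (use assms in auto)

lemma ell2_pointwise_le:
  assumes "u \<in> ell2 h"
  shows "cmod (u k) \<le> ell2_norm h u"
proof (cases "k \<in> lattice h")
  case True
  then have "(cmod (u k))\<^sup>2 \<le> (ell2_norm h u)\<^sup>2"
    using ell2_finite_sum_le[OF assms, of "{k}"] by simp
  then show ?thesis
    by (rule power2_le_imp_le) simp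
qed (simp add: ell2_off[OF assms])

lemma ell2_zero [simp]: "(\<lambda>k. 0) \<in> ell2 h"
  by (simp add: ell2_def)

lemma cmod_add_sq_le: "(cmod (a + b))\<^sup>2 \<le> 2 * (cmod a)\<^sup>2 + 2 * (cmod b)\<^sup>2"
proof -
  have "(cmod (a + b))\<^sup>2 \<le> (cmod a + cmod b)\<^sup>2"
    by (simp add: norm_triangle_ineq power_mono)
  also have "\<dots> \<le> 2 * (cmod a)\<^sup>2 + 2 * (cmod b)\<^sup>2"
    using sum_squares_bound[of "cmod a" "cmod b"] by (simp add: power2_sum)
  finally show ?thesis .
qed

lemma cmod_mult_cnj_le: "cmod (a * cnj b) \<le> (cmod a)\<^sup>2 + (cmod b)\<^sup>2"
proof -
  have "2 * (cmod a * cmod b) \<le> (cmod a)\<^sup>2 + (cmod b)\<^sup>2"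
    using sum_squares_bound[of "cmod a" "cmod b"] by (simp add: mult.assoc)
  moreover have "0 \<le> cmod a * cmod b" by simp
  ultimately show ?thesis by (simp only: norm_mult complex_mod_cnj)
qed

lemma cmod_diff_sq_le: "(cmod (a - b))\<^sup>2 \<le> 2 * (cmod a)\<^sup>2 + 2 * (cmod b)\<^sup>2"
  using cmod_add_sq_le[of a "- b"] by simp

lemma ell2_add:
  assumes "u \<in> ell2 h" "v \<in> ell2 h"
  shows "(\<lambda>k. u k + v k) \<in> ell2 h"
proof (rule ell2I)
  show "(\<lambda>k. (cmod (u k + v k))\<^sup>2) summable_on lattice h"
    by (rule summable_on_comparison_test[where f="\<lambda>k. 2 * (cmod (u k))\<^sup>2 + 2 * (cmod (v k))\<^sup>2"])
       (auto intro!: summable_on_add summable_on_cmult_right ell2_summable assms cmod_add_sq_le)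
qed (use assms in \<open>auto simp: ell2_off\<close>)

lemma ell2_scale:
  assumes "u \<in> ell2 h"
  shows "(\<lambda>k. c * u k) \<in> ell2 h"
proof (rule ell2I)
  show "(\<lambda>k. (cmod (c * u k))\<^sup>2) summable_on lattice h"
    by (simp add: norm_mult power_mult_distrib summable_on_cmult_right ell2_summable assms)
qed (use assms in \<open>auto simp: ell2_off\<close>)

lemma ell2_diff:
  assumes "u \<in> ell2 h" "v \<in> ell2 h"
  shows "(\<lambda>k. u k - v k) \<in> ell2 h"
  using ell2_add[OF assms(1) ell2_scale[OF assms(2), of "-1"]] by simp

lemma ell2_sum:
  assumes "\<And>i. i \<in> I \<Longrightarrow> u i \<in> ell2 h"
  shows "(\<lambda>k. \<Sum>i\<in>I. u i k) \<in> ell2 h"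
  using assms by (induction I rule: infinite_finite_induct) (auto intro: ell2_add)

lemma ell2_cnj:
  assumes "u \<in> ell2 h"
  shows "(\<lambda>k. cnj (u k)) \<in> ell2 h"
  using assms by (auto simp: ell2_def)

lemma ell2_norm_cnj: "ell2_norm h (\<lambda>k. cnj (u k)) = ell2_norm h u"
  by (simp add: ell2_norm_def)

lemma ell2_norm_scale: "ell2_norm h (\<lambda>k. c * u k) = cmod c * ell2_norm h u"
  by (simp add: ell2_norm_def norm_mult power_mult_distrib infsum_cmult_right' real_sqrt_mult)

section \<open>The inner product of square summable functions\<close>

lemma ell2_prod_abs_summable:
  assumes "f \<in> ell2 h" "g \<in> ell2 h"
  shows "(\<lambda>k. cmod (f k * cnj (g k))) summable_on lattice h"
proof (rule summable_on_comparison_test)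
  show "(\<lambda>k. (cmod (f k))\<^sup>2 + (cmod (g k))\<^sup>2) summable_on lattice h"
    by (intro summable_on_add ell2_summable assms)
qed (use cmod_mult_cnj_le in auto)

lemma ell2_prod_summable:
  assumes "f \<in> ell2 h" "g \<in> ell2 h"
  shows "(\<lambda>k. f k * cnj (g k)) summable_on lattice h"
  using abs_summable_summable[OF ell2_prod_abs_summable[OF assms]] .

lemma ell2_inner_add_left:
  assumes "f \<in> ell2 h" "f' \<in> ell2 h" "g \<in> ell2 h"
  shows "ell2_inner h (\<lambda>k. f k + f' k) g = ell2_inner h f g + ell2_inner h f' g"
  unfolding ell2_inner_def using assms
  by (simp add: distrib_right infsum_add ell2_prod_summable)

lemma ell2_inner_scale_left: "ell2_inner h (\<lambda>k. c * f k) g = c * ell2_inner h f g"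
  unfolding ell2_inner_def by (simp add: mult.assoc infsum_cmult_right')

lemma ell2_inner_diff_left:
  assumes "f \<in> ell2 h" "f' \<in> ell2 h" "g \<in> ell2 h"
  shows "ell2_inner h (\<lambda>k. f k - f' k) g = ell2_inner h f g - ell2_inner h f' g"
  using ell2_inner_add_left[OF assms(1) ell2_scale[OF assms(2), of "-1"] assms(3)]
    ell2_inner_scale_left[of h "-1" f' g] by simp

lemma ell2_inner_zero [simp]: "ell2_inner h (\<lambda>k. 0) g = 0"
  by (simp add: ell2_inner_def)

lemma ell2_inner_commute: "ell2_inner h g f = cnj (ell2_inner h f g)"
  unfolding ell2_inner_def by (subst infsum_cnj[symmetric]) (simp add: mult.commute)

lemma ell2_inner_cnj: "ell2_inner h (\<lambda>k. cnj (f k)) (\<lambda>k. cnj (g k)) = cnj (ell2_inner h f g)"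
  unfolding ell2_inner_def by (subst infsum_cnj[symmetric]) simp

lemma ell2_inner_sum_left:
  assumes "\<And>i. i \<in> I \<Longrightarrow> f i \<in> ell2 h" "g \<in> ell2 h"
  shows "ell2_inner h (\<lambda>k. \<Sum>i\<in>I. f i k) g = (\<Sum>i\<in>I. ell2_inner h (f i) g)"
  using assms
  by (induction I rule: infinite_finite_induct) (auto simp: ell2_inner_add_left ell2_sum)

lemma ell2_inner_add_right:
  assumes "f \<in> ell2 h" "f' \<in> ell2 h" "g \<in> ell2 h"
  shows "ell2_inner h g (\<lambda>k. f k + f' k) = ell2_inner h g f + ell2_inner h g f'"
  by (metis (mono_tags, lifting) assms complex_cnj_add ell2_inner_add_left ell2_inner_commute)

lemma ell2_inner_diff_right:
  assumes "f \<in> ell2 h" "f' \<in> ell2 h" "g \<in> ell2 h"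
  shows "ell2_inner h g (\<lambda>k. f k - f' k) = ell2_inner h g f - ell2_inner h g f'"
  by (metis (mono_tags, lifting) assms complex_cnj_diff ell2_inner_diff_left ell2_inner_commute)

lemma ell2_inner_scale_right: "ell2_inner h g (\<lambda>k. c * f k) = cnj c * ell2_inner h g f"
  by (metis complex_cnj_mult ell2_inner_commute ell2_inner_scale_left)

lemma ell2_inner_sum_right:
  assumes "\<And>i. i \<in> I \<Longrightarrow> f i \<in> ell2 h" "g \<in> ell2 h"
  shows "ell2_inner h g (\<lambda>k. \<Sum>i\<in>I. f i k) = (\<Sum>i\<in>I. ell2_inner h g (f i))"
  using assms
  by (induction I rule: infinite_finite_induct)
     (auto simp: ell2_inner_add_right ell2_sum ell2_inner_commute[of h g "\<lambda>k. 0"])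

lemma ell2_inner_self:
  assumes "u \<in> ell2 h"
  shows "ell2_inner h u u = of_real ((ell2_norm h u)\<^sup>2)"
proof -
  have "ell2_inner h u u = (\<Sum>\<^sub>\<infinity>k\<in>lattice h. of_real ((cmod (u k))\<^sup>2))"
    unfolding ell2_inner_def by (simp add: complex_norm_square del: of_real_power)
  then show ?thesis
    unfolding ell2_norm_sq
    using infsumI[OF has_sum_of_real[where 'a=complex, OF has_sum_infsum[OF ell2_summable[OF assms]]]]
    by simp
qed

lemma ell2_norm_unit:
  assumes "u \<in> ell2 h" "ell2_inner h u u = 1"
  shows "ell2_norm h u = 1"
proof -
  have "(ell2_norm h u)\<^sup>2 = 1\<^sup>2"
    using assms(2) unfolding ell2_inner_self[OF assms(1)] of_real_eq_1_iff by simp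
  then show ?thesis
    by (rule power2_eq_imp_eq) simp_all
qed

lemma ell2_norm_sq_diff:
  assumes "f \<in> ell2 h" "g \<in> ell2 h"
  shows "(ell2_norm h (\<lambda>k. f k - g k))\<^sup>2
    = (ell2_norm h f)\<^sup>2 - 2 * Re (ell2_inner h f g) + (ell2_norm h g)\<^sup>2"
proof -
  have d: "(\<lambda>k. f k - g k) \<in> ell2 h" by (rule ell2_diff[OF assms])
  have "complex_of_real ((ell2_norm h (\<lambda>k. f k - g k))\<^sup>2)
    = of_real ((ell2_norm h f)\<^sup>2) - (ell2_inner h f g + cnj (ell2_inner h f g)) + of_real ((ell2_norm h g)\<^sup>2)"
    unfolding ell2_inner_self[OF d, symmetric] ell2_inner_self[OF assms(1), symmetric]
      ell2_inner_self[OF assms(2), symmetric]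
    by (simp add: ell2_inner_diff_left ell2_inner_diff_right assms d ell2_inner_commute[of h f g])
  then have "Re (complex_of_real ((ell2_norm h (\<lambda>k. f k - g k))\<^sup>2))
    = Re (of_real ((ell2_norm h f)\<^sup>2) - (ell2_inner h f g + cnj (ell2_inner h f g)) + of_real ((ell2_norm h g)\<^sup>2))"
    by simp
  then show ?thesis by simp
qed

section \<open>Finite orthonormal systems and Bessel's inequality\<close>

definition orthonormal_on :: "real \<Rightarrow> nat set \<Rightarrow> (nat \<Rightarrow> ('n::finite) gridfun) \<Rightarrow> bool" where
  "orthonormal_on h I e \<longleftrightarrow> (\<forall>i\<in>I. e i \<in> ell2 h) \<and>
     (\<forall>i\<in>I. \<forall>j\<in>I. ell2_inner h (e i) (e j) = (if i = j then 1 else 0))"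

lemma orthonormal_on_subset: "orthonormal_on h I e \<Longrightarrow> J \<subseteq> I \<Longrightarrow> orthonormal_on h J e"
  unfolding orthonormal_on_def by blast

lemma orthonormal_sum_inner:
  assumes "orthonormal_on h I e" "finite I" "j \<in> I"
  shows "ell2_inner h (\<lambda>k. \<Sum>i\<in>I. c i * e i k) (e j) = c j"
proof -
  have "ell2_inner h (\<lambda>k. \<Sum>i\<in>I. c i * e i k) (e j) = (\<Sum>i\<in>I. c i * ell2_inner h (e i) (e j))"
    using assms by (subst ell2_inner_sum_left)
      (auto simp: orthonormal_on_def ell2_inner_scale_left intro: ell2_scale)
  also have "\<dots> = (\<Sum>i\<in>I. if i = j then c i else 0)"
    using assms by (intro sum.cong) (auto simp: orthonormal_on_def)
  finally show ?thesis using assms by simp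
qed

lemma orthonormal_comb_ell2: "orthonormal_on h I e \<Longrightarrow> (\<lambda>k. \<Sum>i\<in>I. c i * e i k) \<in> ell2 h"
  by (intro ell2_sum ell2_scale) (auto simp: orthonormal_on_def)

lemma orthonormal_comb_norm:
  assumes "orthonormal_on h I e" "finite I"
  shows "(ell2_norm h (\<lambda>k. \<Sum>i\<in>I. c i * e i k))\<^sup>2 = (\<Sum>i\<in>I. (cmod (c i))\<^sup>2)"
proof -
  let ?u = "\<lambda>k. \<Sum>i\<in>I. c i * e i k"
  have "ell2_inner h ?u ?u = (\<Sum>i\<in>I. cnj (c i) * ell2_inner h ?u (e i))"
    using assms orthonormal_comb_ell2[OF assms(1), of c]
    by (subst ell2_inner_sum_right)
      (auto simp: orthonormal_on_def ell2_inner_scale_right intro: ell2_scale)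
  also have "\<dots> = (\<Sum>i\<in>I. cnj (c i) * c i)"
    using assms by (intro sum.cong) (auto simp: orthonormal_sum_inner)
  also have "\<dots> = of_real (\<Sum>i\<in>I. (cmod (c i))\<^sup>2)"
    by (simp add: complex_norm_square mult.commute del: of_real_power)
  finally show ?thesis
    unfolding ell2_inner_self[OF orthonormal_comb_ell2[OF assms(1)]] of_real_eq_iff .
qed

text \<open>Pythagoras for the projection onto the span of the system. Bessel's inequality uses that
  the left side is nonnegative, Parseval's identity that it tends to 0, and the dimension count in
  \<open>form_dom_nontrivial\<close> explores what happens if it vanishes.\<close>

lemma orthonormal_residual_norm:
  assumes "orthonormal_on h I e" "finite I" "g \<in> ell2 h"
  shows "(ell2_norm h (\<lambda>k. g k - (\<Sum>i\<in>I. ell2_inner h g (e i) * e i k)))\<^sup>2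
    = (ell2_norm h g)\<^sup>2 - (\<Sum>i\<in>I. (cmod (ell2_inner h g (e i)))\<^sup>2)"
proof -
  let ?u = "\<lambda>k. \<Sum>i\<in>I. ell2_inner h g (e i) * e i k"
  have "ell2_inner h g ?u = (\<Sum>i\<in>I. cnj (ell2_inner h g (e i)) * ell2_inner h g (e i))"
    using assms by (subst ell2_inner_sum_right)
      (auto simp: orthonormal_on_def ell2_inner_scale_right intro: ell2_scale)
  also have "\<dots> = of_real (\<Sum>i\<in>I. (cmod (ell2_inner h g (e i)))\<^sup>2)"
    by (simp add: complex_norm_square mult.commute del: of_real_power)
  finally have "Re (ell2_inner h g ?u) = (\<Sum>i\<in>I. (cmod (ell2_inner h g (e i)))\<^sup>2)" by simp
  then show ?thesis
    by (simp add: ell2_norm_sq_diff[OF assms(3) orthonormal_comb_ell2[OF assms(1)]]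
        orthonormal_comb_norm[OF assms(1,2)])
qed

lemma bessel:
  assumes "orthonormal_on h I e" "finite I" "g \<in> ell2 h"
  shows "(\<Sum>i\<in>I. (cmod (ell2_inner h g (e i)))\<^sup>2) \<le> (ell2_norm h g)\<^sup>2"
  using orthonormal_residual_norm[OF assms] by (smt (verit) zero_le_power2)

text \<open>Bessel's inequality for the one-element orthonormal system that consists of
  \<open>g\<close> normalised.\<close>

lemma ell2_cauchy_schwarz:
  assumes "f \<in> ell2 h" "g \<in> ell2 h"
  shows "cmod (ell2_inner h f g) \<le> ell2_norm h f * ell2_norm h g"
proof (cases "ell2_norm h g = 0")
  case True
  then have "g k = 0" for k
    using ell2_pointwise_le[OF assms(2), of k] by simp
  then show ?thesis by (simp add: ell2_inner_def)
next
  case False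
  define e where "e = (\<lambda>(i::nat) k. of_real (inverse (ell2_norm h g)) * g k)"
  have "orthonormal_on h {0} e"
    unfolding orthonormal_on_def e_def using assms(2) False
    by (auto intro!: ell2_scale
        simp: ell2_inner_scale_left ell2_inner_scale_right ell2_inner_self power2_eq_square)
      (simp add: field_simps)
  from bessel[OF this _ assms(1)] have "(cmod (ell2_inner h f (e 0)))\<^sup>2 \<le> (ell2_norm h f)\<^sup>2"
    by simp
  then have "cmod (ell2_inner h f (e 0)) \<le> ell2_norm h f"
    by (rule power2_le_imp_le) simp
  moreover have "cmod (ell2_inner h f (e 0)) = inverse (ell2_norm h g) * cmod (ell2_inner h f g)"
    by (simp add: e_def ell2_inner_scale_right norm_mult norm_inverse)
  moreover have "0 < ell2_norm h g"
    using False ell2_norm_nonneg[of h g] by linarith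
  ultimately show ?thesis
    by (simp add: field_simps)
qed

lemma ell2_norm_triangle:
  assumes "f \<in> ell2 h" "g \<in> ell2 h"
  shows "ell2_norm h (\<lambda>k. f k + g k) \<le> ell2_norm h f + ell2_norm h g"
proof (rule power2_le_imp_le)
  have g: "(\<lambda>k. - 1 * g k) \<in> ell2 h" by (rule ell2_scale[OF assms(2)])
  have "(ell2_norm h (\<lambda>k. f k + g k))\<^sup>2
      = (ell2_norm h f)\<^sup>2 + 2 * Re (ell2_inner h f g) + (ell2_norm h g)\<^sup>2"
    using ell2_norm_sq_diff[OF assms(1) g] ell2_inner_scale_right[of h f "- 1" g]
      ell2_norm_scale[of h "- 1" g] by simp
  also have "Re (ell2_inner h f g) \<le> ell2_norm h f * ell2_norm h g"
    using complex_Re_le_cmod ell2_cauchy_schwarz[OF assms] order_trans by blast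
  finally show "(ell2_norm h (\<lambda>k. f k + g k))\<^sup>2 \<le> (ell2_norm h f + ell2_norm h g)\<^sup>2"
    by (simp add: power2_sum)
qed simp

section \<open>Lattice delta functions\<close>

definition lattice_delta :: "real ^ 'n \<Rightarrow> ('n::finite) gridfun" where
  "lattice_delta k = (\<lambda>l. if l = k then 1 else 0)"

lemma lattice_delta_sum:
  assumes "k \<in> lattice h"
  shows "((\<lambda>l. f l * lattice_delta k l) has_sum f k) (lattice h)"
  by (rule has_sum_finite_neutralI[of "{k}"]) (use assms in \<open>auto simp: lattice_delta_def\<close>)

lemma lattice_delta_ell2: "k \<in> lattice h \<Longrightarrow> lattice_delta k \<in> ell2 h"
  by (rule ell2_bddI[where B=1]) (auto simp: lattice_delta_def if_distrib[of cmod] power2_eq_square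
      sum.If_cases if_distrib[of "\<lambda>x. x * _"] cong: if_cong)

lemma ell2_inner_delta: 
  assumes "k \<in> lattice h"
  shows "ell2_inner h u (lattice_delta k) = u k"
proof -
  have "ell2_inner h u (lattice_delta k) = (\<Sum>\<^sub>\<infinity>l\<in>lattice h. u l * lattice_delta k l)"
    unfolding ell2_inner_def by (rule infsum_cong) (simp add: lattice_delta_def)
  then show ?thesis using lattice_delta_sum[OF assms] by (simp add: infsumI)
qed

lemma ell2_norm_delta:
  assumes "k \<in> lattice h"
  shows "ell2_norm h (lattice_delta k) = 1"
proof -
  have "ell2_inner h (lattice_delta k) (lattice_delta k) = 1"
    by (subst ell2_inner_delta[OF assms]) (simp add: lattice_delta_def)
  then show ?thesis by (rule ell2_norm_unit[OF lattice_delta_ell2[OF assms]])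
qed

subsection \<open>Orthonormal bases\<close>

text \<open>Kept abstract because it is instantiated twice, with the eigenvectors and with their
  complex conjugates.\<close>

locale ell2_basis =
  fixes h :: real and b :: "nat \<Rightarrow> ('n::finite) gridfun"
  assumes orthonormal: "orthonormal_on h UNIV b"
    and complete: "g \<in> ell2 h \<Longrightarrow>
      (\<lambda>N. ell2_norm h (\<lambda>k. g k - (\<Sum>\<xi><N. ell2_inner h g (b \<xi>) * b \<xi> k))) \<longlonglongrightarrow> 0"
begin

lemma b_ell2 [simp]: "b \<xi> \<in> ell2 h"
  using orthonormal by (simp add: orthonormal_on_def)

lemma b_inner: "ell2_inner h (b \<xi>) (b \<eta>) = (if \<xi> = \<eta> then 1 else 0)"
  using orthonormal by (simp add: orthonormal_on_def)

lemma orthonormal_sub: "orthonormal_on h I b"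
  using orthonormal orthonormal_on_subset by blast

definition coef :: "'n gridfun \<Rightarrow> nat \<Rightarrow> complex" where
  "coef g \<xi> = ell2_inner h g (b \<xi>)"

text \<open>The series is summed at each point; for square summable coefficients it converges there
  absolutely, thanks to \<open>basis_pointwise_summable\<close>.\<close>

definition synth :: "(nat \<Rightarrow> complex) \<Rightarrow> 'n gridfun" where
  "synth c = (\<lambda>k. \<Sum>\<xi>. c \<xi> * b \<xi> k)"

lemma coef_add: "f \<in> ell2 h \<Longrightarrow> g \<in> ell2 h \<Longrightarrow> coef (\<lambda>k. f k + g k) \<xi> = coef f \<xi> + coef g \<xi>"
  by (simp add: coef_def ell2_inner_add_left)

lemma coef_diff: "f \<in> ell2 h \<Longrightarrow> g \<in> ell2 h \<Longrightarrow> coef (\<lambda>k. f k - g k) \<xi> = coef f \<xi> - coef g \<xi>"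
  by (simp add: coef_def ell2_inner_diff_left)

lemma coef_scale: "coef (\<lambda>k. c * f k) \<xi> = c * coef f \<xi>"
  by (simp add: coef_def ell2_inner_scale_left)

lemma coef_b: "coef (b \<xi>) \<eta> = (if \<xi> = \<eta> then 1 else 0)"
  by (simp add: coef_def b_inner)

lemma parseval:
  assumes "g \<in> ell2 h"
  shows "(\<lambda>\<xi>. (cmod (coef g \<xi>))\<^sup>2) sums (ell2_norm h g)\<^sup>2"
proof -
  have "(\<lambda>N. (ell2_norm h g)\<^sup>2 - (\<Sum>i<N. (cmod (coef g i))\<^sup>2)) \<longlonglongrightarrow> 0\<^sup>2"
    using tendsto_power[OF complete[OF assms], of 2]
    by (simp only: orthonormal_residual_norm[OF orthonormal_sub _ assms] finite_lessThan coef_def)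
  from tendsto_diff[OF tendsto_const[of "(ell2_norm h g)\<^sup>2"] this]
  show ?thesis by (simp add: sums_def)
qed

lemma coef_summable: "g \<in> ell2 h \<Longrightarrow> summable (\<lambda>\<xi>. (cmod (coef g \<xi>))\<^sup>2)"
  using parseval sums_summable by blast

text \<open>The N-th partial sum misses the inner product by that of the residual of
  \<open>f\<close> with \<open>g\<close>, which the Cauchy-Schwarz inequality sends to 0.\<close>

lemma basis_expansion_inner:
  assumes "f \<in> ell2 h" "g \<in> ell2 h"
  shows "(\<lambda>\<xi>. coef f \<xi> * cnj (coef g \<xi>)) sums ell2_inner h f g"
proof -
  let ?r = "\<lambda>N k. f k - (\<Sum>\<xi><N. coef f \<xi> * b \<xi> k)"
  have r: "?r N \<in> ell2 h" for N
    by (intro ell2_diff assms orthonormal_comb_ell2 orthonormal_sub)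
  have eq: "(\<Sum>\<xi><N. coef f \<xi> * cnj (coef g \<xi>)) - ell2_inner h f g = - ell2_inner h (?r N) g" for N
  proof -
    have "ell2_inner h (\<lambda>k. \<Sum>\<xi><N. coef f \<xi> * b \<xi> k) g = (\<Sum>\<xi><N. coef f \<xi> * cnj (coef g \<xi>))"
      using assms(2) by (subst ell2_inner_sum_left)
        (auto intro: ell2_scale simp: ell2_inner_scale_left coef_def ell2_inner_commute[of h g])
    then show ?thesis
      using ell2_inner_diff_left[OF assms(1) orthonormal_comb_ell2[OF orthonormal_sub, of "coef f" "{..<N}"] assms(2)]
      by simp
  qed
  have "(\<lambda>N. (\<Sum>\<xi><N. coef f \<xi> * cnj (coef g \<xi>)) - ell2_inner h f g) \<longlonglongrightarrow> 0"
  proof (rule Lim_null_comparison)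
    show "\<forall>\<^sub>F N in sequentially. norm ((\<Sum>\<xi><N. coef f \<xi> * cnj (coef g \<xi>)) - ell2_inner h f g)
        \<le> ell2_norm h (?r N) * ell2_norm h g"
      unfolding eq norm_minus_cancel by (rule always_eventually) (use ell2_cauchy_schwarz[OF r assms(2)] in auto)
    show "(\<lambda>N. ell2_norm h (?r N) * ell2_norm h g) \<longlonglongrightarrow> 0"
      using tendsto_mult_left_zero[OF complete[OF assms(1)]] by (simp add: coef_def)
  qed
  then show ?thesis
    unfolding sums_def using LIM_zero_iff by blast
qed

text \<open>Pairing with a lattice delta function turns the expansion of inner products into a
  pointwise one; off the lattice all terms vanish.\<close>

lemma basis_expansion:
  assumes "g \<in> ell2 h"
  shows "(\<lambda>\<xi>. coef g \<xi> * b \<xi> k) sums g k"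
proof (cases "k \<in> lattice h")
  case True
  then have "coef (lattice_delta k) \<xi> = cnj (b \<xi> k)" for \<xi>
    by (simp add: coef_def ell2_inner_commute[of h _ "b \<xi>"] ell2_inner_delta)
  then show ?thesis
    using basis_expansion_inner[OF assms lattice_delta_ell2[OF True]]
    by (simp add: ell2_inner_delta[OF True])
qed (use ell2_off[OF assms] ell2_off[OF b_ell2] in simp)

lemma synth_coef: "g \<in> ell2 h \<Longrightarrow> synth (coef g) = g"
  using basis_expansion by (auto simp: synth_def sums_iff)

lemma coef_inject:
  assumes "f \<in> ell2 h" "g \<in> ell2 h" "\<And>\<xi>. coef f \<xi> = coef g \<xi>"
  shows "f = g"
proof -
  have "coef f = coef g" using assms(3) by blast
  then show ?thesis using synth_coef assms by metis
qed

text \<open>The coefficients of the delta function at \<open>k\<close> are the conjugates of the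
  values \<open>b \<xi> k\<close>, so this is Parseval's identity for the delta function.\<close>

lemma basis_pointwise_summable: "summable (\<lambda>\<xi>. (cmod (b \<xi> k))\<^sup>2)"
proof (cases "k \<in> lattice h")
  case True
  then have "coef (lattice_delta k) \<xi> = cnj (b \<xi> k)" for \<xi>
    by (simp add: coef_def ell2_inner_commute[of h _ "b \<xi>"] ell2_inner_delta)
  then show ?thesis
    using coef_summable[OF lattice_delta_ell2[OF True]] by simp
qed (use ell2_off[OF b_ell2] in simp)

lemma synth_abs_summable:
  assumes "summable (\<lambda>\<xi>. (cmod (c \<xi>))\<^sup>2)"
  shows "summable (\<lambda>\<xi>. cmod (c \<xi> * b \<xi> k))"
proof (rule summable_comparison_test')
  show "summable (\<lambda>\<xi>. (cmod (c \<xi>))\<^sup>2 + (cmod (b \<xi> k))\<^sup>2)"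
    by (intro summable_add assms basis_pointwise_summable)
  show "norm (cmod (c \<xi> * b \<xi> k)) \<le> (cmod (c \<xi>))\<^sup>2 + (cmod (b \<xi> k))\<^sup>2" for \<xi>
    using cmod_mult_cnj_le[of "c \<xi>" "cnj (b \<xi> k)"] by simp
qed

lemma synth_sums:
  assumes "summable (\<lambda>\<xi>. (cmod (c \<xi>))\<^sup>2)"
  shows "(\<lambda>\<xi>. c \<xi> * b \<xi> k) sums synth c k"
  unfolding synth_def using summable_norm_cancel[OF synth_abs_summable[OF assms]] by (rule summable_sums)

text \<open>For finite combinations the bound comes from orthonormality, and on a finite set of
  lattice points the limit of the partial sums may be taken inside.\<close>

lemma synth_finite_sum_le:
  assumes "summable (\<lambda>\<xi>. (cmod (c \<xi>))\<^sup>2)" "finite F" "F \<subseteq> lattice h"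
  shows "(\<Sum>k\<in>F. (cmod (synth c k))\<^sup>2) \<le> (\<Sum>\<xi>. (cmod (c \<xi>))\<^sup>2)"
proof (rule LIMSEQ_le_const2)
  show "(\<lambda>N. \<Sum>k\<in>F. (cmod (\<Sum>\<xi><N. c \<xi> * b \<xi> k))\<^sup>2) \<longlonglongrightarrow> (\<Sum>k\<in>F. (cmod (synth c k))\<^sup>2)"
    using synth_sums[OF assms(1)] unfolding sums_def by (intro tendsto_intros) auto
  have "(\<Sum>k\<in>F. (cmod (\<Sum>\<xi><N. c \<xi> * b \<xi> k))\<^sup>2) \<le> (\<Sum>\<xi>. (cmod (c \<xi>))\<^sup>2)" for N
  proof -
    have "(\<Sum>k\<in>F. (cmod (\<Sum>\<xi><N. c \<xi> * b \<xi> k))\<^sup>2) \<le> (\<Sum>\<xi><N. (cmod (c \<xi>))\<^sup>2)"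
      using ell2_finite_sum_le[OF orthonormal_comb_ell2[OF orthonormal_sub] assms(2,3),
          of c "{..<N}"] by (simp add: orthonormal_comb_norm[OF orthonormal_sub])
    also have "\<dots> \<le> (\<Sum>\<xi>. (cmod (c \<xi>))\<^sup>2)"
      by (rule sum_le_suminf[OF assms(1)]) auto
    finally show ?thesis .
  qed
  then show "\<exists>N. \<forall>n\<ge>N. (\<Sum>k\<in>F. (cmod (\<Sum>\<xi><n. c \<xi> * b \<xi> k))\<^sup>2) \<le> (\<Sum>\<xi>. (cmod (c \<xi>))\<^sup>2)"
    by blast
qed

lemma synth_ell2:
  assumes "summable (\<lambda>\<xi>. (cmod (c \<xi>))\<^sup>2)"
  shows "synth c \<in> ell2 h"
proof (rule ell2_bddI)
  show "synth c k = 0" if "k \<notin> lattice h" for k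
    using ell2_off[OF b_ell2 that] by (simp add: synth_def)
qed (rule synth_finite_sum_le[OF assms])

lemma synth_norm_le:
  assumes "summable (\<lambda>\<xi>. (cmod (c \<xi>))\<^sup>2)"
  shows "(ell2_norm h (synth c))\<^sup>2 \<le> (\<Sum>\<xi>. (cmod (c \<xi>))\<^sup>2)"
  by (rule ell2_norm_le_bdd[OF synth_ell2[OF assms]]) (rule synth_finite_sum_le[OF assms])

text \<open>The Riesz-Fischer theorem. Pointwise convergence alone does not commute with the inner
  product, so the series is cut at some N > \<eta>: the head contributes exactly
  \<open>c \<eta>\<close>, and the tail is again a synthesised function, whose norm is bounded by a
  remainder that tends to 0.\<close>

lemma coef_synth:
  assumes "summable (\<lambda>\<xi>. (cmod (c \<xi>))\<^sup>2)"
  shows "coef (synth c) \<eta> = c \<eta>"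
proof -
  define t where "t = (\<lambda>N \<xi>. if \<xi> < N then 0 else c \<xi>)"
  have ts: "summable (\<lambda>\<xi>. (cmod (t N \<xi>))\<^sup>2)" for N
    by (rule summable_comparison_test'[OF assms, of 0]) (auto simp: t_def)
  have split: "synth c k = (\<Sum>\<xi><N. c \<xi> * b \<xi> k) + synth (t N) k" for N k
  proof -
    have "(\<lambda>\<xi>. (if \<xi> < N then c \<xi> * b \<xi> k else 0)) sums (\<Sum>\<xi><N. c \<xi> * b \<xi> k)"
      using sums_If_finite_set[of "{..<N}" "\<lambda>\<xi>. c \<xi> * b \<xi> k"] by simp
    from sums_add[OF this synth_sums[OF ts, of N k]]
    have "(\<lambda>\<xi>. c \<xi> * b \<xi> k) sums ((\<Sum>\<xi><N. c \<xi> * b \<xi> k) + synth (t N) k)"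
      by (rule sums_cong[THEN iffD1, rotated]) (simp add: t_def)
    then show ?thesis using synth_sums[OF assms, of k] sums_unique2 by blast
  qed
  have tail: "(\<Sum>\<xi>. (cmod (t N \<xi>))\<^sup>2) = (\<Sum>\<xi>. (cmod (c \<xi>))\<^sup>2) - (\<Sum>\<xi><N. (cmod (c \<xi>))\<^sup>2)" for N
  proof -
    have "(\<lambda>\<xi>. (if \<xi> < N then (cmod (c \<xi>))\<^sup>2 else 0)) sums (\<Sum>\<xi><N. (cmod (c \<xi>))\<^sup>2)"
      using sums_If_finite_set[of "{..<N}" "\<lambda>\<xi>. (cmod (c \<xi>))\<^sup>2"] by simp
    from sums_add[OF this summable_sums[OF ts, of N]]
    have "(\<lambda>\<xi>. (cmod (c \<xi>))\<^sup>2) sums ((\<Sum>\<xi><N. (cmod (c \<xi>))\<^sup>2) + (\<Sum>\<xi>. (cmod (t N \<xi>))\<^sup>2))"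
      by (rule sums_cong[THEN iffD1, rotated]) (simp add: t_def)
    then show ?thesis by (simp add: sums_iff)
  qed
  have bound: "(cmod (coef (synth c) \<eta> - c \<eta>))\<^sup>2 \<le> (\<Sum>\<xi>. (cmod (t N \<xi>))\<^sup>2)" if "\<eta> < N" for N
  proof -
    have "coef (synth c) \<eta> = coef (\<lambda>k. \<Sum>\<xi><N. c \<xi> * b \<xi> k) \<eta> + coef (synth (t N)) \<eta>"
      unfolding split[of _ N, abs_def]
      using coef_add[OF orthonormal_comb_ell2[OF orthonormal_sub] synth_ell2[OF ts]] by simp
    also have "coef (\<lambda>k. \<Sum>\<xi><N. c \<xi> * b \<xi> k) \<eta> = c \<eta>"
      unfolding coef_def using that by (intro orthonormal_sum_inner orthonormal_sub) auto
    finally have "cmod (coef (synth c) \<eta> - c \<eta>) = cmod (coef (synth (t N)) \<eta>)" by simp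
    also have "\<dots> \<le> ell2_norm h (synth (t N)) * ell2_norm h (b \<eta>)"
      unfolding coef_def by (intro ell2_cauchy_schwarz synth_ell2 ts b_ell2)
    also have "ell2_norm h (b \<eta>) = 1"
      by (rule ell2_norm_unit[OF b_ell2]) (simp add: b_inner)
    finally have "(cmod (coef (synth c) \<eta> - c \<eta>))\<^sup>2 \<le> (ell2_norm h (synth (t N)))\<^sup>2"
      by (simp add: power_mono)
    then show ?thesis using synth_norm_le[OF ts, of N] by linarith
  qed
  have "(\<lambda>N. \<Sum>\<xi>. (cmod (t N \<xi>))\<^sup>2) \<longlonglongrightarrow> (\<Sum>\<xi>. (cmod (c \<xi>))\<^sup>2) - (\<Sum>\<xi>. (cmod (c \<xi>))\<^sup>2)"
    unfolding tail by (intro tendsto_diff tendsto_const summable_LIMSEQ assms)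
  then have "(\<lambda>N. \<Sum>\<xi>. (cmod (t N \<xi>))\<^sup>2) \<longlonglongrightarrow> 0" by simp
  then have "(cmod (coef (synth c) \<eta> - c \<eta>))\<^sup>2 \<le> 0"
    by (intro LIMSEQ_le_const[where X="\<lambda>N. \<Sum>\<xi>. (cmod (t N \<xi>))\<^sup>2"]) (use bound in \<open>auto intro!: exI[of _ "Suc \<eta>"]\<close>)
  then show ?thesis by simp
qed

end

subsection \<open>The discrete Schroedinger operator\<close>

lemma lattice_add: "k \<in> lattice h \<Longrightarrow> l \<in> lattice h \<Longrightarrow> k + l \<in> lattice h"
  unfolding lattice_def by (force simp: scaleR_add_right[symmetric] intro!: Ints_add)

lemma lattice_uminus: "k \<in> lattice h \<Longrightarrow> - k \<in> lattice h"
  unfolding lattice_def by (force simp: scaleR_minus_right[symmetric] simp del: scaleR_minus_right)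

lemma lattice_axis: "h *\<^sub>R axis j 1 \<in> lattice h"
  unfolding lattice_def by (auto simp: axis_def)

lemma lattice_add_cancel:
  assumes "w \<in> lattice h"
  shows "k + w \<in> lattice h \<longleftrightarrow> k \<in> lattice h"
proof
  assume "k + w \<in> lattice h"
  from lattice_add[OF this lattice_uminus[OF assms]] show "k \<in> lattice h" by simp
qed (intro lattice_add assms)

lemma lattice_param:
  "lattice h = range (\<lambda>p :: 'n::finite \<Rightarrow> int. h *\<^sub>R (\<chi> i. real_of_int (p i)))"
proof safe
  fix k :: "real ^ 'n"
  assume "k \<in> lattice h"
  then obtain l where l: "k = h *\<^sub>R l" "\<forall>i. l $ i \<in> \<int>" by (auto simp: lattice_def)
  then have "l = (\<chi> i. real_of_int \<lfloor>l $ i\<rfloor>)"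
    by (auto simp: vec_eq_iff elim!: Ints_cases)
  then show "k \<in> range (\<lambda>p :: 'n \<Rightarrow> int. h *\<^sub>R (\<chi> i. real_of_int (p i)))"
    using l(1) by (intro range_eqI[of _ _ "\<lambda>i. \<lfloor>l $ i\<rfloor>"]) simp
qed (auto simp: lattice_def)

lemma countable_lattice: "countable (lattice h :: (real ^ 'n::finite) set)"
  unfolding lattice_param by simp

lemma finite_lattice_bounded:
  assumes "h > 0"
  shows "finite {k \<in> lattice h :: (real ^ 'n::finite) set. norm k \<le> r}"
proof -
  define m where "m = \<lceil>r / h\<rceil>"
  have "{k \<in> lattice h :: (real ^ 'n::finite) set. norm k \<le> r}
      \<subseteq> (\<lambda>p. h *\<^sub>R (\<chi> i. real_of_int (p i))) ` (PiE UNIV (\<lambda>_. {-m..m}))"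
  proof safe
    fix k :: "real ^ 'n"
    assume k: "k \<in> lattice h" "norm k \<le> r"
    then obtain p :: "'n \<Rightarrow> int" where p: "k = h *\<^sub>R (\<chi> i. real_of_int (p i))"
      unfolding lattice_param by auto
    have "\<bar>p i\<bar> \<le> m" for i
    proof -
      have "h * \<bar>real_of_int (p i)\<bar> \<le> r"
        using order_trans[OF component_le_norm_cart[of k i] k(2)] assms by (simp add: p abs_mult)
      then have "\<bar>real_of_int (p i)\<bar> \<le> r / h"
        using assms by (simp add: field_simps)
      then show ?thesis unfolding m_def by linarith
    qed
    then show "k \<in> (\<lambda>p. h *\<^sub>R (\<chi> i. real_of_int (p i))) ` (PiE UNIV (\<lambda>_. {-m..m}))"
      unfolding p by (intro imageI) (auto simp: abs_le_iff PiE_def minus_le_iff)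
  qed
  then show ?thesis
    by (rule finite_subset) (intro finite_imageI finite_PiE; simp)
qed

lemma infinite_lattice:
  assumes "h > 0"
  shows "infinite (lattice h :: (real ^ 'n::finite) set)"
proof
  assume fin: "finite (lattice h :: (real ^ 'n::finite) set)"
  obtain i :: 'n where True by blast
  have "range (\<lambda>m::nat. h *\<^sub>R axis i (real m)) \<subseteq> (lattice h :: (real ^ 'n) set)"
    unfolding lattice_def by (auto simp: axis_def)
  then have "finite (range (\<lambda>m::nat. h *\<^sub>R axis i (real m) :: real ^ 'n))"
    using fin finite_subset by blast
  moreover have "inj (\<lambda>m::nat. h *\<^sub>R axis i (real m) :: real ^ 'n)"
    using assms by (auto intro!: injI simp: axis_eq_axis)
  ultimately show False
    using finite_imageD by blast
qed

lemma lattice_shift_bij: "w \<in> lattice h \<Longrightarrow> bij_betw (\<lambda>k. k + w) (lattice h) (lattice h)"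
  by (rule bij_betwI[where g="\<lambda>k. k - w"])
     (auto simp: lattice_add_cancel lattice_add lattice_uminus diff_conv_add_uminus simp del: add_uminus_conv_diff)

lemma ell2_shift:
  assumes "u \<in> ell2 h" "w \<in> lattice h"
  shows "(\<lambda>k. u (k + w)) \<in> ell2 h"
proof (rule ell2I)
  show "(\<lambda>k. (cmod (u (k + w)))\<^sup>2) summable_on lattice h"
    using summable_on_reindex_bij_betw[OF lattice_shift_bij[OF assms(2)], of "\<lambda>k. (cmod (u k))\<^sup>2"]
      ell2_summable[OF assms(1)] by simp
qed (use assms in \<open>auto simp: ell2_off lattice_add_cancel\<close>)

lemma ell2_norm_shift:
  assumes "w \<in> lattice h"
  shows "ell2_norm h (\<lambda>k. u (k + w)) = ell2_norm h u"
  unfolding ell2_norm_def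
  using infsum_reindex_bij_betw[OF lattice_shift_bij[OF assms], of "\<lambda>k. (cmod (u k))\<^sup>2"] by simp

lemma ell2_inner_shift:
  assumes "w \<in> lattice h"
  shows "ell2_inner h (\<lambda>k. u (k + w)) v = ell2_inner h u (\<lambda>k. v (k - w))"
  unfolding ell2_inner_def
  using infsum_reindex_bij_betw[OF lattice_shift_bij[OF assms], of "\<lambda>k. u k * cnj (v (k - w))"]
  by simp

text \<open>Minus the discrete Laplacian, hence nonnegative. There is no case distinction: lattice
  shifts preserve the complement of the lattice, so on \<open>ell2 h\<close> the formula vanishes
  there anyway. The backward shift is written as the addition of a negative so that the shift lemmas
  cover both directions.\<close>

definition lap :: "real \<Rightarrow> ('n::finite) gridfun \<Rightarrow> 'n gridfun" where
  "lap h u = (\<lambda>k. of_real (inverse (h\<^sup>2)) *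
     (\<Sum>j\<in>UNIV. 2 * u k - u (k + h *\<^sub>R axis j 1) - u (k + - (h *\<^sub>R axis j 1))))"

lemma schroedinger_eq:
  assumes "u \<in> ell2 h"
  shows "schroedinger h V u = (\<lambda>k. lap h u k + of_real (V k) * u k)"
proof
  fix k
  show "schroedinger h V u k = lap h u k + of_real (V k) * u k"
  proof (cases "k \<in> lattice h")
    case True
    then show ?thesis
      by (simp add: schroedinger_def lap_def sum_subtractf sum.distrib algebra_simps)
  next
    case False
    then have "u (k + h *\<^sub>R axis j 1) = 0" "u (k + - (h *\<^sub>R axis j 1)) = 0" "u k = 0" for j
      using assms by (auto intro!: ell2_off[OF assms]
          simp: lattice_add_cancel lattice_axis lattice_uminus simp del: add_uminus_conv_diff)
    then show ?thesis using False by (simp add: schroedinger_def lap_def)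
  qed
qed

lemma lap_term_ell2:
  assumes "u \<in> ell2 h"
  shows "(\<lambda>k. 2 * u k - u (k + h *\<^sub>R axis j 1) - u (k + - (h *\<^sub>R axis j 1))) \<in> ell2 h"
  by (intro ell2_diff ell2_scale ell2_shift assms lattice_axis lattice_uminus)

lemma lap_ell2: "u \<in> ell2 h \<Longrightarrow> lap h u \<in> ell2 h"
  unfolding lap_def by (intro ell2_scale ell2_sum lap_term_ell2)

lemma lap_inner:
  assumes "u \<in> ell2 h" "v \<in> ell2 h"
  shows "ell2_inner h (lap h u) v = of_real (inverse (h\<^sup>2)) *
    (\<Sum>j\<in>UNIV. 2 * ell2_inner h u v - ell2_inner h (\<lambda>k. u (k + h *\<^sub>R axis j 1)) v
       - ell2_inner h (\<lambda>k. u (k + - (h *\<^sub>R axis j 1))) v)"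
  unfolding lap_def using assms
  by (simp add: ell2_inner_scale_left ell2_inner_sum_left lap_term_ell2 ell2_inner_diff_left
      ell2_diff ell2_scale ell2_shift lattice_axis lattice_uminus del: add_uminus_conv_diff)

text \<open>The adjoint of a shift is the opposite shift, and both directions occur in the
  sum.\<close>

lemma lap_sym:
  assumes "u \<in> ell2 h" "v \<in> ell2 h"
  shows "ell2_inner h (lap h u) v = ell2_inner h u (lap h v)"
proof -
  have s: "ell2_inner h (\<lambda>k. u (k + w)) v = cnj (ell2_inner h (\<lambda>k. v (k + - w)) u)"
    if "w \<in> lattice h" for w
    using ell2_inner_shift[OF that, of u v] ell2_inner_commute[of h u "\<lambda>k. v (k - w)"] by simp
  have "ell2_inner h (lap h u) v = cnj (ell2_inner h (lap h v) u)"
    unfolding lap_inner[OF assms] lap_inner[OF assms(2,1)]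
    using s[OF lattice_axis] s[OF lattice_uminus[OF lattice_axis]]
    by (simp add: ell2_inner_commute[of h u v] cnj_sum algebra_simps del: add_uminus_conv_diff)
  then show ?thesis by (simp add: ell2_inner_commute[of h u])
qed

lemma complex_Re_mult_of_real: "Re (of_real c * z) = c * Re z"
  by simp

text \<open>Shifts are isometries, so by the Cauchy-Schwarz inequality the contribution of each axis
  is nonnegative.\<close>

lemma lap_nonneg:
  fixes u :: "('n::finite) gridfun"
  assumes "u \<in> ell2 h"
  shows "0 \<le> Re (ell2_inner h (lap h u) u)"
proof -
  have s: "Re (ell2_inner h (\<lambda>k. u (k + w)) u) \<le> (ell2_norm h u)\<^sup>2" if "w \<in> lattice h" for w
  proof -
    have "Re (ell2_inner h (\<lambda>k. u (k + w)) u) \<le> cmod (ell2_inner h (\<lambda>k. u (k + w)) u)"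
      by (rule complex_Re_le_cmod)
    also have "\<dots> \<le> ell2_norm h (\<lambda>k. u (k + w)) * ell2_norm h u"
      by (intro ell2_cauchy_schwarz ell2_shift assms that)
    finally show ?thesis by (simp add: ell2_norm_shift[OF that] power2_eq_square)
  qed
  show ?thesis
    unfolding lap_inner[OF assms assms] ell2_inner_self[OF assms] complex_Re_mult_of_real Re_sum
  proof (intro mult_nonneg_nonneg sum_nonneg)
    fix j :: 'n
    show "0 \<le> Re (2 * of_real ((ell2_norm h u)\<^sup>2) - ell2_inner h (\<lambda>k. u (k + h *\<^sub>R axis j 1)) u
       - ell2_inner h (\<lambda>k. u (k + - (h *\<^sub>R axis j 1))) u)"
      using s[OF lattice_axis, of j] s[OF lattice_uminus[OF lattice_axis], of j]
      by (simp del: add_uminus_conv_diff of_real_power)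
  qed simp
qed

lemma lap_inner_bound:
  assumes "u \<in> ell2 h" "v \<in> ell2 h"
  shows "cmod (ell2_inner h (lap h u) (v :: ('n::finite) gridfun))
    \<le> inverse (h\<^sup>2) * (4 * CARD('n)) * (ell2_norm h u * ell2_norm h v)"
proof -
  have s: "cmod (ell2_inner h (\<lambda>k. u (k + w)) v) \<le> ell2_norm h u * ell2_norm h v"
    if "w \<in> lattice h" for w
    using ell2_cauchy_schwarz[OF ell2_shift[OF assms(1) that] assms(2)]
    by (simp add: ell2_norm_shift[OF that])
  have t: "cmod (2 * ell2_inner h u v - ell2_inner h (\<lambda>k. u (k + h *\<^sub>R axis j 1)) v
       - ell2_inner h (\<lambda>k. u (k + - (h *\<^sub>R axis j 1))) v) \<le> 4 * (ell2_norm h u * ell2_norm h v)"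
    (is "cmod (2 * ?a - ?b - ?c) \<le> _") for j
  proof -
    have "cmod (2 * ?a - ?b - ?c) \<le> cmod (2 * ?a) + cmod ?b + cmod ?c"
      by (meson add_mono norm_triangle_ineq4 order_refl order_trans)
    then show ?thesis
      using ell2_cauchy_schwarz[OF assms] s[OF lattice_axis, of j]
        s[OF lattice_uminus[OF lattice_axis], of j]
      by (simp add: norm_mult del: add_uminus_conv_diff)
  qed
  have "cmod (ell2_inner h (lap h u) v)
      \<le> inverse (h\<^sup>2) * (\<Sum>j\<in>(UNIV::'n set). 4 * (ell2_norm h u * ell2_norm h v))"
    unfolding lap_inner[OF assms] norm_mult norm_of_real
    by (intro mult_mono sum_norm_le t) auto
  then show ?thesis by simp
qed

lemma lap_add: "lap h (\<lambda>k. u k + v k) = (\<lambda>k. lap h u k + lap h v k)"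
  by (rule ext) (simp add: lap_def sum.distrib sum_subtractf algebra_simps)

lemma lap_scale: "lap h (\<lambda>k. c * u k) = (\<lambda>k. c * lap h u k)"
  by (rule ext) (simp add: lap_def sum_distrib_left algebra_simps)

lemma lap_diff: "lap h (\<lambda>k. u k - v k) = (\<lambda>k. lap h u k - lap h v k)"
  using lap_add[of h u "\<lambda>k. - 1 * v k"] lap_scale[of h "- 1" v] by simp

lemma lap_cnj: "lap h (\<lambda>k. cnj (u k)) = (\<lambda>k. cnj (lap h u k))"
  by (auto simp: lap_def)

text \<open>The kinetic form is bounded on \<open>ell2 h\<close>, so norm convergence suffices for
  it; in the minimisation below, only the potential part calls for lower semicontinuity.\<close>

lemma lap_inner_tendsto:
  assumes "\<And>n. u n \<in> ell2 h" "w \<in> ell2 h" "\<And>n. ell2_norm h (u n) \<le> C"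
    and "(\<lambda>n. ell2_norm h (\<lambda>k. u n k - w k)) \<longlonglongrightarrow> 0"
  shows "(\<lambda>n. ell2_inner h (lap h (u n)) (u n)) \<longlonglongrightarrow> ell2_inner h (lap h w) (w :: ('n::finite) gridfun)"
proof -
  let ?d = "\<lambda>n k. u n k - w k"
  let ?K = "inverse (h\<^sup>2) * (4 * CARD('n))"
  have d: "?d n \<in> ell2 h" for n by (intro ell2_diff assms)
  have "ell2_inner h (lap h (u n)) (u n) - ell2_inner h (lap h w) w
    = ell2_inner h (lap h (?d n)) (u n) + ell2_inner h (lap h w) (?d n)" for n
    by (simp add: lap_diff ell2_inner_diff_left ell2_inner_diff_right lap_ell2 assms)
  then have "cmod (ell2_inner h (lap h (u n)) (u n) - ell2_inner h (lap h w) w)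
    \<le> ?K * (ell2_norm h (?d n) * ell2_norm h (u n)) + ?K * (ell2_norm h w * ell2_norm h (?d n))" for n
    using lap_inner_bound[OF d assms(1), of n n] lap_inner_bound[OF assms(2) d, of n]
    by (metis (no_types, lifting) add_mono norm_triangle_le)
  moreover have "?K * (ell2_norm h (?d n) * ell2_norm h (u n)) \<le> ?K * (ell2_norm h (?d n) * C)" for n
    by (intro mult_left_mono assms) auto
  ultimately have b: "cmod (ell2_inner h (lap h (u n)) (u n) - ell2_inner h (lap h w) w)
    \<le> ?K * (ell2_norm h (?d n) * C) + ?K * (ell2_norm h w * ell2_norm h (?d n))" for n
    by (meson add_mono_thms_linordered_semiring(3) order_trans)
  have "(\<lambda>n. ?K * (ell2_norm h (?d n) * C) + ?K * (ell2_norm h w * ell2_norm h (?d n)))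
    \<longlonglongrightarrow> ?K * (0 * C) + ?K * (ell2_norm h w * 0)"
    by (intro tendsto_intros assms)
  then have "(\<lambda>n. ell2_inner h (lap h (u n)) (u n) - ell2_inner h (lap h w) w) \<longlonglongrightarrow> 0"
    by (intro Lim_null_comparison[OF always_eventually[OF allI[OF b]]]) simp
  then show ?thesis using LIM_zero_iff by blast
qed

section \<open>Domain and quadratic form of the operator\<close>

locale schroedinger_operator =
  fixes h :: real and V :: "real ^ 'n::finite \<Rightarrow> real"
  assumes h_pos: "h > 0" and V_nonneg: "k \<in> lattice h \<Longrightarrow> 0 \<le> V k"
begin

text \<open>The Laplacian is bounded, so membership of the domain is a condition on the potential
  term alone.\<close>

lemma dom_H_iff: "u \<in> dom_H h V \<longleftrightarrow> u \<in> ell2 h \<and> (\<lambda>k. of_real (V k) * u k) \<in> ell2 h"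
proof -
  have "(one_plus_H h V u \<in> ell2 h) = ((\<lambda>k. of_real (V k) * u k) \<in> ell2 h)" if u: "u \<in> ell2 h"
  proof
    assume "one_plus_H h V u \<in> ell2 h"
    from ell2_diff[OF ell2_diff[OF this u] lap_ell2[OF u]]
    show "(\<lambda>k. of_real (V k) * u k) \<in> ell2 h"
      by (simp add: one_plus_H_def schroedinger_eq[OF u])
  next
    assume "(\<lambda>k. of_real (V k) * u k) \<in> ell2 h"
    from ell2_add[OF u ell2_add[OF lap_ell2[OF u] this]]
    show "one_plus_H h V u \<in> ell2 h"
      by (simp add: one_plus_H_def schroedinger_eq[OF u])
  qed
  then show ?thesis by (auto simp: dom_H_def)
qed

lemma dom_H_ell2: "u \<in> dom_H h V \<Longrightarrow> u \<in> ell2 h"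
  by (simp add: dom_H_iff)

lemma schroedinger_ell2: "u \<in> dom_H h V \<Longrightarrow> schroedinger h V u \<in> ell2 h"
  by (simp add: schroedinger_eq dom_H_iff ell2_add lap_ell2)

lemma schroedinger_sym:
  assumes "u \<in> dom_H h V" "v \<in> dom_H h V"
  shows "ell2_inner h (schroedinger h V u) v = ell2_inner h u (schroedinger h V v)"
proof -
  have "ell2_inner h (\<lambda>k. of_real (V k) * u k) v = ell2_inner h u (\<lambda>k. of_real (V k) * v k)"
    by (simp add: ell2_inner_def mult_ac)
  then show ?thesis
    using assms
    by (simp add: schroedinger_eq dom_H_iff ell2_inner_add_left ell2_inner_add_right lap_ell2 lap_sym)
qed

definition sqV :: "'n gridfun \<Rightarrow> 'n gridfun" where
  "sqV u = (\<lambda>k. of_real (sqrt (V k)) * u k)"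

definition form_dom :: "'n gridfun set" where
  "form_dom = {u \<in> ell2 h. sqV u \<in> ell2 h}"

text \<open>Splitting V into two square roots, one for each argument, makes sense where
  \<open>V u\<close> itself need not be square summable. The limit of a minimising sequence is at
  first only known to lie in this larger space \<open>form_dom\<close>.\<close>

definition form :: "'n gridfun \<Rightarrow> 'n gridfun \<Rightarrow> complex" where
  "form u v = ell2_inner h (lap h u) v + ell2_inner h (sqV u) (sqV v)"

definition qform :: "'n gridfun \<Rightarrow> real" where
  "qform u = Re (form u u)"

lemma form_dom_ell2: "u \<in> form_dom \<Longrightarrow> u \<in> ell2 h" and form_dom_sqV: "u \<in> form_dom \<Longrightarrow> sqV u \<in> ell2 h"
  by (simp_all add: form_dom_def)

lemma sqV_add: "sqV (\<lambda>k. u k + v k) = (\<lambda>k. sqV u k + sqV v k)"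
  by (simp add: sqV_def distrib_left)

lemma sqV_scale: "sqV (\<lambda>k. c * u k) = (\<lambda>k. c * sqV u k)"
  by (simp add: sqV_def mult_ac)

lemma form_dom_add: "u \<in> form_dom \<Longrightarrow> v \<in> form_dom \<Longrightarrow> (\<lambda>k. u k + v k) \<in> form_dom"
  by (simp add: form_dom_def sqV_add ell2_add)

lemma form_dom_scale: "u \<in> form_dom \<Longrightarrow> (\<lambda>k. c * u k) \<in> form_dom"
  by (simp add: form_dom_def sqV_scale ell2_scale)

lemma form_dom_diff: "u \<in> form_dom \<Longrightarrow> v \<in> form_dom \<Longrightarrow> (\<lambda>k. u k - v k) \<in> form_dom"
  using form_dom_add[OF _ form_dom_scale[of v "- 1"]] by simp

lemma form_dom_sum: "(\<And>i. i \<in> I \<Longrightarrow> u i \<in> form_dom) \<Longrightarrow> (\<lambda>k. \<Sum>i\<in>I. u i k) \<in> form_dom"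
  by (induction I rule: infinite_finite_induct) (auto simp: form_dom_add, auto simp: form_dom_def sqV_def)

lemma form_dom_comb: "(\<And>i. i \<in> I \<Longrightarrow> u i \<in> form_dom) \<Longrightarrow> (\<lambda>k. \<Sum>i\<in>I. c i * u i k) \<in> form_dom"
  by (intro form_dom_sum form_dom_scale)

lemma form_dom_delta: "k \<in> lattice h \<Longrightarrow> lattice_delta k \<in> form_dom"
proof -
  assume k: "k \<in> lattice h"
  have "sqV (lattice_delta k) = (\<lambda>l. of_real (sqrt (V k)) * lattice_delta k l)"
    by (auto simp: sqV_def lattice_delta_def)
  then show ?thesis by (simp add: form_dom_def lattice_delta_ell2[OF k] ell2_scale)
qed

lemma form_add_left:
  "u \<in> form_dom \<Longrightarrow> u' \<in> form_dom \<Longrightarrow> v \<in> form_dom \<Longrightarrow>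
    form (\<lambda>k. u k + u' k) v = form u v + form u' v"
  by (simp add: form_def form_dom_def lap_add sqV_add ell2_inner_add_left lap_ell2)

lemma form_scale_left: "form (\<lambda>k. c * u k) v = c * form u v"
  by (simp add: form_def lap_scale sqV_scale ell2_inner_scale_left distrib_left)

lemma form_herm: "u \<in> form_dom \<Longrightarrow> v \<in> form_dom \<Longrightarrow> form v u = cnj (form u v)"
  unfolding form_def form_dom_def
  by (simp add: lap_sym ell2_inner_commute[of h "lap h v"] ell2_inner_commute[of h "sqV v"]
      ell2_inner_commute[of h v])

lemma form_add_right:
  "u \<in> form_dom \<Longrightarrow> u' \<in> form_dom \<Longrightarrow> v \<in> form_dom \<Longrightarrow>
    form v (\<lambda>k. u k + u' k) = form v u + form v u'"
  by (metis (mono_tags, lifting) complex_cnj_add form_add_left form_dom_add form_herm)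

lemma form_scale_right:
  "u \<in> form_dom \<Longrightarrow> v \<in> form_dom \<Longrightarrow> form v (\<lambda>k. c * u k) = cnj c * form v u"
  by (metis (mono_tags, lifting) complex_cnj_mult form_scale_left form_dom_scale form_herm)

lemma qform_eq:
  "u \<in> form_dom \<Longrightarrow> qform u = Re (ell2_inner h (lap h u) u) + (ell2_norm h (sqV u))\<^sup>2"
  by (simp add: qform_def form_def form_dom_def ell2_inner_self)

lemma qform_nonneg: "u \<in> form_dom \<Longrightarrow> 0 \<le> qform u"
  by (simp add: qform_eq lap_nonneg form_dom_ell2)

lemma qform_scale: "u \<in> form_dom \<Longrightarrow> qform (\<lambda>k. c * u k) = (cmod c)\<^sup>2 * qform u"
  unfolding qform_def
  by (simp add: form_scale_left form_scale_right form_dom_scale mult.assoc[symmetric]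
      complex_norm_square[symmetric] del: of_real_power)

text \<open>On the lattice V \<le> V^2 + 1, so \<open>sqV u\<close> is controlled by
  \<open>V u\<close> and \<open>u\<close>.\<close>

lemma dom_H_form_dom:
  assumes "u \<in> dom_H h V"
  shows "u \<in> form_dom"
proof -
  have "sqV u \<in> ell2 h"
  proof (rule ell2I)
    show "sqV u k = 0" if "k \<notin> lattice h" for k
      using ell2_off[OF dom_H_ell2[OF assms] that] by (simp add: sqV_def)
    show "(\<lambda>k. (cmod (sqV u k))\<^sup>2) summable_on lattice h"
    proof (rule summable_on_comparison_test)
      show "(\<lambda>k. (cmod (of_real (V k) * u k))\<^sup>2 + (cmod (u k))\<^sup>2) summable_on lattice h"
        using assms by (intro summable_on_add ell2_summable) (auto simp: dom_H_iff)
      fix k :: "real ^ 'n" assume "k \<in> lattice h"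
      then have "0 \<le> V k" by (rule V_nonneg)
      moreover have "V k \<le> (V k)\<^sup>2 + 1"
        using sum_squares_bound[of "V k" 1] zero_le_power2[of "V k"]
        by (smt (verit) \<open>0 \<le> V k\<close> mult_1_right one_power2)
      ultimately show "(cmod (sqV u k))\<^sup>2 \<le> (cmod (of_real (V k) * u k))\<^sup>2 + (cmod (u k))\<^sup>2"
        using mult_right_mono[of "V k" "(V k)\<^sup>2 + 1" "(cmod (u k))\<^sup>2"]
        by (simp add: sqV_def norm_mult power_mult_distrib distrib_right)
    qed simp
  qed
  then show ?thesis using dom_H_ell2[OF assms] by (simp add: form_dom_def)
qed

lemma form_eq_inner_H:
  assumes "u \<in> dom_H h V" "v \<in> form_dom"
  shows "form u v = ell2_inner h (schroedinger h V u) v"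
proof -
  have "ell2_inner h (sqV u) (sqV v) = ell2_inner h (\<lambda>k. of_real (V k) * u k) v"
    unfolding ell2_inner_def
  proof (rule infsum_cong)
    fix k :: "real ^ 'n" assume "k \<in> lattice h"
    then have "complex_of_real (sqrt (V k)) * complex_of_real (sqrt (V k)) = of_real (V k)"
      using V_nonneg by (simp flip: of_real_mult)
    then show "sqV u k * cnj (sqV v k) = of_real (V k) * u k * cnj (v k)"
      by (simp add: sqV_def mult_ac)
  qed
  then show ?thesis
    using assms
    by (simp add: form_def schroedinger_eq dom_H_iff form_dom_def ell2_inner_add_left lap_ell2)
qed

end

subsection \<open>Existence of an eigenbasis\<close>

lemma tendsto_norm_imp_pointwise:
  assumes "\<And>n. u n \<in> ell2 h" "w \<in> ell2 h"
    and "(\<lambda>n. ell2_norm h (\<lambda>k. u n k - w k)) \<longlonglongrightarrow> 0"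
  shows "(\<lambda>n. u n k) \<longlonglongrightarrow> w k"
proof -
  have "(\<lambda>n. u n k - w k) \<longlonglongrightarrow> 0"
    by (rule Lim_null_comparison[OF always_eventually assms(3)])
       (use ell2_pointwise_le[OF ell2_diff[OF assms(1,2)]] in auto)
  then show ?thesis using LIM_zero_iff by blast
qed

lemma tendsto_norm_imp_norm:
  assumes "\<And>n. u n \<in> ell2 h" "w \<in> ell2 h"
    and "(\<lambda>n. ell2_norm h (\<lambda>k. u n k - w k)) \<longlonglongrightarrow> 0"
  shows "(\<lambda>n. ell2_norm h (u n)) \<longlonglongrightarrow> ell2_norm h w"
proof -
  have "norm (ell2_norm h (u n) - ell2_norm h w) \<le> ell2_norm h (\<lambda>k. u n k - w k)" for n
  proof -
    have "ell2_norm h (u n) \<le> ell2_norm h (\<lambda>k. u n k - w k) + ell2_norm h w"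
      using ell2_norm_triangle[OF ell2_diff[OF assms(1)[of n] assms(2)] assms(2)] by simp
    moreover have "ell2_norm h w \<le> ell2_norm h (\<lambda>k. w k - u n k) + ell2_norm h (u n)"
      using ell2_norm_triangle[OF ell2_diff[OF assms(2) assms(1)[of n]] assms(1)[of n]] by simp
    moreover have "ell2_norm h (\<lambda>k. w k - u n k) = ell2_norm h (\<lambda>k. u n k - w k)"
      by (simp add: ell2_norm_def norm_minus_commute)
    ultimately show ?thesis by simp
  qed
  then have "(\<lambda>n. ell2_norm h (u n) - ell2_norm h w) \<longlonglongrightarrow> 0"
    by (intro Lim_null_comparison[OF always_eventually assms(3)]) auto
  then show ?thesis using LIM_zero_iff by blast
qed

lemma tendsto_norm_imp_inner:
  assumes "\<And>n. u n \<in> ell2 h" "w \<in> ell2 h" "g \<in> ell2 h"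
    and "(\<lambda>n. ell2_norm h (\<lambda>k. u n k - w k)) \<longlonglongrightarrow> 0"
  shows "(\<lambda>n. ell2_inner h (u n) g) \<longlonglongrightarrow> ell2_inner h w g"
proof -
  have "cmod (ell2_inner h (u n) g - ell2_inner h w g) \<le> ell2_norm h (\<lambda>k. u n k - w k) * ell2_norm h g" for n
    using ell2_cauchy_schwarz[OF ell2_diff[OF assms(1)[of n] assms(2)] assms(3)] assms
    by (simp add: ell2_inner_diff_left)
  then have "(\<lambda>n. ell2_inner h (u n) g - ell2_inner h w g) \<longlonglongrightarrow> 0"
    by (intro Lim_null_comparison[OF always_eventually tendsto_mult_left_zero[OF assms(4)]]) auto
  then show ?thesis using LIM_zero_iff by blast
qed

lemma ell2_approx_finite:
  fixes g :: "('n::finite) gridfun"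
  assumes "g \<in> ell2 h" "\<epsilon> > 0"
  obtains K where "finite K" "K \<subseteq> lattice h"
    "(ell2_norm h (\<lambda>k. g k - (\<Sum>l\<in>K. g l * lattice_delta l k)))\<^sup>2 \<le> \<epsilon>"
proof -
  obtain K where K: "finite K" "K \<subseteq> lattice h"
    and d: "dist (\<Sum>k\<in>K. (cmod (g k))\<^sup>2) (\<Sum>\<^sub>\<infinity>k\<in>lattice h. (cmod (g k))\<^sup>2) \<le> \<epsilon>"
    using infsum_finite_approximation[OF ell2_summable[OF assms(1)] assms(2)] by metis
  have c: "(\<Sum>l\<in>K. g l * lattice_delta l k) = (if k \<in> K then g k else 0)" for k
    using K(1) by (simp add: lattice_delta_def sum.If_cases if_distrib[of "\<lambda>x. _ * x"] cong: if_cong)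
  have e: "(\<lambda>k. \<Sum>l\<in>K. g l * lattice_delta l k) \<in> ell2 h"
    using K(2) by (intro ell2_sum ell2_scale lattice_delta_ell2) auto
  have "(ell2_norm h (\<lambda>k. g k - (\<Sum>l\<in>K. g l * lattice_delta l k)))\<^sup>2 \<le> \<epsilon>"
  proof (rule ell2_norm_le_bdd[OF ell2_diff[OF assms(1) e]])
    fix F :: "(real ^ 'n) set" assume F: "finite F" "F \<subseteq> lattice h"
    have "(\<Sum>k\<in>F. (cmod (g k - (\<Sum>l\<in>K. g l * lattice_delta l k)))\<^sup>2) = (\<Sum>k\<in>F - K. (cmod (g k))\<^sup>2)"
      unfolding c using F(1) by (intro sum.mono_neutral_cong_right) auto
    also have "\<dots> = (\<Sum>k\<in>F \<union> K. (cmod (g k))\<^sup>2) - (\<Sum>k\<in>K. (cmod (g k))\<^sup>2)"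
    proof -
      have "F - K = F \<union> K - K" by blast
      then show ?thesis using F(1) K(1) by (simp add: sum_diff)
    qed
    also have "\<dots> \<le> (ell2_norm h g)\<^sup>2 - (\<Sum>k\<in>K. (cmod (g k))\<^sup>2)"
      using F K ell2_finite_sum_le[OF assms(1), of "F \<union> K"] by simp
    also have "\<dots> \<le> \<epsilon>" using d by (simp add: ell2_norm_sq dist_real_def abs_le_iff)
    finally show "(\<Sum>k\<in>F. (cmod (g k - (\<Sum>l\<in>K. g l * lattice_delta l k)))\<^sup>2) \<le> \<epsilon>" .
  qed
  then show ?thesis using that K by blast
qed

lemma orthonormal_residual_inner:
  assumes "orthonormal_on h I e" "finite I" "g \<in> ell2 h" "j \<in> I"
  shows "ell2_inner h (\<lambda>k. g k - (\<Sum>i\<in>I. ell2_inner h g (e i) * e i k)) (e j) = 0"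
proof -
  have "e j \<in> ell2 h" using assms by (auto simp: orthonormal_on_def)
  then show ?thesis
    using orthonormal_sum_inner[OF assms(1,2,4), of "\<lambda>i. ell2_inner h g (e i)"]
    by (simp add: ell2_inner_diff_left[OF assms(3) orthonormal_comb_ell2[OF assms(1)]])
qed

text \<open>The first-order condition at a minimum, in purely algebraic form: for small t the linear
  term would dominate with either sign.\<close>

lemma linear_term_zero:
  fixes a b :: real
  assumes "\<And>t. 0 \<le> 2 * t * a + t\<^sup>2 * b"
  shows "a = 0"
proof (rule ccontr)
  assume a: "a \<noteq> 0"
  \<comment> \<open>This is the minimiser of 2 t a + t^2 (|b| + 1); replacing b by |b| + 1 makes the
    leading coefficient positive whatever b is.\<close>
  define t where "t = - a / (\<bar>b\<bar> + 1)"
  have "0 \<le> 2 * t * a + t\<^sup>2 * b" by (rule assms)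
  also have "t\<^sup>2 * b \<le> t\<^sup>2 * (\<bar>b\<bar> + 1)" by (rule mult_left_mono) auto
  then have "2 * t * a + t\<^sup>2 * b \<le> 2 * t * a + t\<^sup>2 * (\<bar>b\<bar> + 1)" by simp
  also have "\<dots> = - (a\<^sup>2 / (\<bar>b\<bar> + 1))"
  proof -
    have "t * (\<bar>b\<bar> + 1) = - a" unfolding t_def by (simp add: field_simps add_eq_0_iff)
    moreover have "t\<^sup>2 * (\<bar>b\<bar> + 1) = t * (t * (\<bar>b\<bar> + 1))" by (simp add: power2_eq_square)
    ultimately have "t\<^sup>2 * (\<bar>b\<bar> + 1) = t * (- a)" by simp
    then have "2 * t * a + t\<^sup>2 * (\<bar>b\<bar> + 1) = a * t" by simp
    then show ?thesis by (simp add: t_def power2_eq_square)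
  qed
  also have "\<dots> < 0" using a by (simp add: add_pos_nonneg)
  finally show False by simp
qed

section \<open>Compactness of the form domain and successive minimisation\<close>

locale confining_operator = schroedinger_operator h V
  for h :: real and V :: "real ^ 'n::finite \<Rightarrow> real" +
  assumes V_lim: "filterlim V at_top (inf at_infinity (principal (lattice h)))"
begin

lemma finite_sublevel: "finite {k \<in> lattice h. V k < C}"
proof -
  have "\<forall>\<^sub>F k in inf at_infinity (principal (lattice h)). C \<le> V k"
    using V_lim by (simp add: filterlim_at_top)
  then obtain b where b: "\<And>k. b \<le> norm k \<Longrightarrow> k \<in> lattice h \<Longrightarrow> C \<le> V k"
    unfolding eventually_inf_principal eventually_at_infinity by auto
  have "{k \<in> lattice h. V k < C} \<subseteq> {k \<in> lattice h. norm k \<le> b}"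
    using b by force
  then show ?thesis
    using finite_lattice_bounded[OF h_pos] finite_subset by blast
qed

lemma sqV_finite_sum:
  assumes "F \<subseteq> lattice h"
  shows "(\<Sum>k\<in>F. (cmod (sqV u k))\<^sup>2) = (\<Sum>k\<in>F. V k * (cmod (u k))\<^sup>2)"
  by (rule sum.cong) (use assms V_nonneg in \<open>auto simp: sqV_def norm_mult power_mult_distrib\<close>)

text \<open>The lattice is countable, so a diagonal subsequence converges pointwise. Where V \<ge> M
  the energy bound leaves at most mass C / M, uniformly in n, and the remaining set V < M is finite,
  so pointwise convergence there upgrades to norm convergence.\<close>

lemma compact_embedding:
  assumes u: "\<And>n. u n \<in> form_dom" and n1: "\<And>n. ell2_norm h (u n) \<le> 1"
    and n2: "\<And>n. (ell2_norm h (sqV (u n)))\<^sup>2 \<le> C"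
  obtains r w where "strict_mono (r :: nat \<Rightarrow> nat)" "w \<in> ell2 h"
    "(\<lambda>n. ell2_norm h (\<lambda>k. u (r n) k - w k)) \<longlonglongrightarrow> 0"
proof -
  have u2: "u n \<in> ell2 h" for n using u form_dom_ell2 by blast
  have C0: "0 \<le> C" using order_trans[OF zero_le_power2 n2[of 0]] .
  have "norm (u n k) \<le> 1" for n k
    using ell2_pointwise_le[OF u2] n1 order_trans by blast
  then obtain r where r: "strict_mono (r::nat\<Rightarrow>nat)"
    and "\<And>k. k \<in> lattice h \<Longrightarrow> \<exists>l. (\<lambda>n. u (r n) k) \<longlonglongrightarrow> l"
    using function_convergent_subsequence[OF countable_lattice, of h u 1] by metis
  then obtain w0 where w0: "\<And>k. k \<in> lattice h \<Longrightarrow> (\<lambda>n. u (r n) k) \<longlonglongrightarrow> w0 k" by metis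
  define w where "w = (\<lambda>k. if k \<in> lattice h then w0 k else 0)"
  have w: "(\<lambda>n. u (r n) k) \<longlonglongrightarrow> w k" for k
    using w0 ell2_off[OF u2] by (cases "k \<in> lattice h") (auto simp: w_def)
  have w_ell2: "w \<in> ell2 h"
  proof (rule ell2_bddI)
    fix F :: "(real ^ 'n) set" assume F: "finite F" "F \<subseteq> lattice h"
    show "(\<Sum>k\<in>F. (cmod (w k))\<^sup>2) \<le> 1"
    proof (rule LIMSEQ_le_const2)
      show "(\<lambda>n. \<Sum>k\<in>F. (cmod (u (r n) k))\<^sup>2) \<longlonglongrightarrow> (\<Sum>k\<in>F. (cmod (w k))\<^sup>2)"
        by (intro tendsto_intros w)
      have "(\<Sum>k\<in>F. (cmod (u n k))\<^sup>2) \<le> 1" for n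
        using ell2_finite_sum_le[OF u2 F, of n] power_mono[OF n1 ell2_norm_nonneg, of n 2] by simp
      then show "\<exists>N. \<forall>n\<ge>N. (\<Sum>k\<in>F. (cmod (u (r n) k))\<^sup>2) \<le> 1" by blast
    qed
  qed (simp add: w_def)
  have uV: "(\<Sum>k\<in>F. V k * (cmod (u n k))\<^sup>2) \<le> C" if "finite F" "F \<subseteq> lattice h" for F n
    using ell2_finite_sum_le[OF form_dom_sqV[OF u] that, of n] n2[of n]
    unfolding sqV_finite_sum[OF that(2)] by linarith
  have wV: "(\<Sum>k\<in>F. V k * (cmod (w k))\<^sup>2) \<le> C" if F: "finite F" "F \<subseteq> lattice h" for F :: "(real ^ 'n) set"
  proof (rule LIMSEQ_le_const2)
    show "(\<lambda>n. \<Sum>k\<in>F. V k * (cmod (u (r n) k))\<^sup>2) \<longlonglongrightarrow> (\<Sum>k\<in>F. V k * (cmod (w k))\<^sup>2)"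
      by (intro tendsto_intros w)
  qed (use uV[OF F] in blast)
  have "(\<lambda>n. (ell2_norm h (\<lambda>k. u (r n) k - w k))\<^sup>2) \<longlonglongrightarrow> 0"
  proof (rule LIMSEQ_I)
    fix \<epsilon> :: real assume e: "0 < \<epsilon>"
    \<comment> \<open>The two tails together cost 4 C / M, and this choice brings that below
      \<epsilon> / 2; the summand 1 keeps M positive when C = 0.\<close>
    define M where "M = 8 * C / \<epsilon> + 1"
    have M: "M > 0" "4 * C / M < \<epsilon> / 2" using e C0 by (auto simp: M_def field_simps add_pos_nonneg)
    define K where "K = {k \<in> lattice h. V k < M}"
    have K: "finite K" "K \<subseteq> lattice h" unfolding K_def using finite_sublevel by auto
    have tail: "(\<Sum>k\<in>F - K. (cmod (v k))\<^sup>2) \<le> C / M"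
      if F: "finite F" "F \<subseteq> lattice h" and v: "\<And>F. finite F \<Longrightarrow> F \<subseteq> lattice h \<Longrightarrow> (\<Sum>k\<in>F. V k * (cmod (v k))\<^sup>2) \<le> C"
      for F and v :: "'n gridfun"
    proof -
      have "(\<Sum>k\<in>F - K. M * (cmod (v k))\<^sup>2) \<le> (\<Sum>k\<in>F - K. V k * (cmod (v k))\<^sup>2)"
        using F by (intro sum_mono mult_right_mono) (auto simp: K_def)
      also have "\<dots> \<le> C" using F by (intro v) auto
      finally show ?thesis using M(1) by (simp add: sum_distrib_left[symmetric] field_simps)
    qed
    have bound: "(ell2_norm h (\<lambda>k. u (r n) k - w k))\<^sup>2 \<le> (\<Sum>k\<in>K. (cmod (u (r n) k - w k))\<^sup>2) + 4 * C / M" for n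
    proof (rule ell2_norm_le_bdd[OF ell2_diff[OF u2 w_ell2]])
      fix F :: "(real ^ 'n) set" assume F: "finite F" "F \<subseteq> lattice h"
      have "(\<Sum>k\<in>F. (cmod (u (r n) k - w k))\<^sup>2)
          = (\<Sum>k\<in>F \<inter> K. (cmod (u (r n) k - w k))\<^sup>2) + (\<Sum>k\<in>F - K. (cmod (u (r n) k - w k))\<^sup>2)"
        using F(1) by (subst sum.Int_Diff[of F _ K]) auto
      also have "(\<Sum>k\<in>F \<inter> K. (cmod (u (r n) k - w k))\<^sup>2) \<le> (\<Sum>k\<in>K. (cmod (u (r n) k - w k))\<^sup>2)"
        using K(1) by (intro sum_mono2) auto
      also have "(\<Sum>k\<in>F - K. (cmod (u (r n) k - w k))\<^sup>2)
          \<le> (\<Sum>k\<in>F - K. 2 * (cmod (u (r n) k))\<^sup>2 + 2 * (cmod (w k))\<^sup>2)"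
        by (intro sum_mono cmod_diff_sq_le)
      also have "\<dots> = 2 * (\<Sum>k\<in>F - K. (cmod (u (r n) k))\<^sup>2) + 2 * (\<Sum>k\<in>F - K. (cmod (w k))\<^sup>2)"
        by (simp add: sum.distrib sum_distrib_left)
      also have "\<dots> \<le> 2 * (C / M) + 2 * (C / M)"
        by (intro add_mono mult_left_mono tail F uV wV) auto
      finally show "(\<Sum>k\<in>F. (cmod (u (r n) k - w k))\<^sup>2) \<le> (\<Sum>k\<in>K. (cmod (u (r n) k - w k))\<^sup>2) + 4 * C / M"
        by simp
    qed
    have "(\<lambda>n. \<Sum>k\<in>K. (cmod (u (r n) k - w k))\<^sup>2) \<longlonglongrightarrow> (\<Sum>k\<in>K. (cmod (w k - w k))\<^sup>2)"
      by (intro tendsto_intros w)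
    then have "(\<lambda>n. \<Sum>k\<in>K. (cmod (u (r n) k - w k))\<^sup>2) \<longlonglongrightarrow> 0" by simp
    from LIMSEQ_D[OF this, of "\<epsilon> / 2"] e obtain N
      where "\<And>n. n \<ge> N \<Longrightarrow> (\<Sum>k\<in>K. (cmod (u (r n) k - w k))\<^sup>2) < \<epsilon> / 2"
      by (auto simp: sum_nonneg)
    then have "(ell2_norm h (\<lambda>k. u (r n) k - w k))\<^sup>2 < \<epsilon>" if "n \<ge> N" for n
      using bound[of n] M(2) that by fastforce
    then show "\<exists>N. \<forall>n\<ge>N. norm ((ell2_norm h (\<lambda>k. u (r n) k - w k))\<^sup>2 - 0) < \<epsilon>" by auto
  qed
  from tendsto_real_sqrt[OF this] have "(\<lambda>n. ell2_norm h (\<lambda>k. u (r n) k - w k)) \<longlonglongrightarrow> 0" by simp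
  with r w_ell2 show ?thesis using that by blast
qed

text \<open>A dimension count. If all lattice delta functions lay in the span of N orthonormal
  vectors, the sum of |e_i(k)|^2 over i < N would equal 1 at every lattice point k. Summed over N +
  1 points this gives N + 1, while each e_i has total mass 1, so the sum is at most N. The vector
  wanted is a normalised residual of a delta function.\<close>

lemma form_dom_nontrivial:
  assumes e: "orthonormal_on h {..<N} e" "\<And>i. i < N \<Longrightarrow> e i \<in> form_dom"
  obtains v where "v \<in> form_dom" "ell2_norm h v = 1" "\<And>i. i < N \<Longrightarrow> ell2_inner h v (e i) = 0"
proof -
  let ?p = "\<lambda>k l. lattice_delta k l - (\<Sum>i<N. ell2_inner h (lattice_delta k) (e i) * e i l)"
  have "\<exists>k\<in>lattice h. ell2_norm h (?p k) \<noteq> 0"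
  proof (rule ccontr)
    assume neg: "\<not> ?thesis"
    have eq: "(\<Sum>i<N. (cmod (e i k))\<^sup>2) = 1" if "k \<in> lattice h" for k
    proof -
      have "ell2_norm h (?p k) = 0" using neg that by blast
      then have "(\<Sum>i<N. (cmod (ell2_inner h (lattice_delta k) (e i)))\<^sup>2) = 1"
        using orthonormal_residual_norm[OF e(1) _ lattice_delta_ell2[OF that]]
        by (simp add: ell2_norm_delta[OF that])
      then show ?thesis
        by (simp add: ell2_inner_commute[of h "lattice_delta k"] ell2_inner_delta[OF that])
    qed
    obtain F :: "(real ^ 'n) set" where F: "finite F" "card F = Suc N" "F \<subseteq> lattice h"
      using infinite_arbitrarily_large[OF infinite_lattice[OF h_pos]] by metis
    have "real (Suc N) = (\<Sum>k\<in>F. \<Sum>i<N. (cmod (e i k))\<^sup>2)"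
      using F eq by (subst sum.cong[OF refl, of _ _ "\<lambda>_. 1"]) auto
    also have "\<dots> = (\<Sum>i<N. \<Sum>k\<in>F. (cmod (e i k))\<^sup>2)" by (rule sum.swap)
    also have "\<dots> \<le> (\<Sum>i<N. 1)"
    proof (rule sum_mono)
      fix i assume "i \<in> {..<N}"
      then have "e i \<in> ell2 h" "ell2_norm h (e i) = 1"
        using e(1) by (auto simp: orthonormal_on_def intro!: ell2_norm_unit)
      then show "(\<Sum>k\<in>F. (cmod (e i k))\<^sup>2) \<le> 1"
        using ell2_finite_sum_le[of "e i" h F] F by simp
    qed
    finally show False by simp
  qed
  then obtain k where k: "k \<in> lattice h" "ell2_norm h (?p k) \<noteq> 0" by blast
  let ?c = "complex_of_real (inverse (ell2_norm h (?p k)))"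
  have p: "?p k \<in> form_dom"
    by (intro form_dom_diff form_dom_delta k form_dom_comb) (use e in auto)
  show ?thesis
  proof (rule that[of "\<lambda>l. ?c * ?p k l"])
    show "(\<lambda>l. ?c * ?p k l) \<in> form_dom" by (rule form_dom_scale[OF p])
    show "ell2_norm h (\<lambda>l. ?c * ?p k l) = 1"
      unfolding ell2_norm_scale using k(2) by (simp add: norm_inverse)
    fix i assume i: "i < N"
    have "ell2_inner h (?p k) (e i) = 0"
      using i by (intro orthonormal_residual_inner[OF e(1)] lattice_delta_ell2 k) auto
    then show "ell2_inner h (\<lambda>l. ?c * ?p k l) (e i) = 0"
      unfolding ell2_inner_scale_left by simp
  qed
qed

text \<open>The Rayleigh quotient is multiplied out, so that v = 0 needs no exception. Only the
  values of \<open>e\<close> below N enter, which is what allows the vectors to be chosen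
  recursively.\<close>

definition ground_state :: "nat \<Rightarrow> (nat \<Rightarrow> 'n gridfun) \<Rightarrow> 'n gridfun \<Rightarrow> bool" where
  "ground_state N e u \<longleftrightarrow> u \<in> form_dom \<and> ell2_norm h u = 1 \<and> (\<forall>i<N. ell2_inner h u (e i) = 0) \<and>
     (\<forall>v\<in>form_dom. (\<forall>i<N. ell2_inner h v (e i) = 0) \<longrightarrow> qform u * (ell2_norm h v)\<^sup>2 \<le> qform v)"

text \<open>The direct method: a minimising sequence has bounded potential energy, hence a norm
  convergent subsequence, and its limit stays admissible without exceeding the infimum.\<close>

lemma ground_state_exists:
  assumes e: "orthonormal_on h {..<N} e" "\<And>i. i < N \<Longrightarrow> e i \<in> form_dom"
  shows "\<exists>u. ground_state N e u"
proof -
  define Adm where "Adm = {v \<in> form_dom. ell2_norm h v = 1 \<and> (\<forall>i<N. ell2_inner h v (e i) = 0)}"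
  have ne: "Adm \<noteq> {}" using form_dom_nontrivial[OF e] unfolding Adm_def by blast
  have bdd: "bdd_below (qform ` Adm)"
    by (rule bdd_belowI2[of _ 0]) (auto simp: Adm_def qform_nonneg)
  define \<mu> where "\<mu> = Inf (qform ` Adm)"
  have mu_le: "\<mu> \<le> qform v" if "v \<in> Adm" for v
    unfolding \<mu>_def using bdd that by (intro cInf_lower) auto
  have "\<exists>v\<in>Adm. qform v < \<mu> + inverse (real (Suc n))" for n
  proof -
    have "\<mu> < \<mu> + inverse (real (Suc n))" by simp
    then show ?thesis unfolding \<mu>_def using cInf_lessD[of "qform ` Adm"] ne by auto
  qed
  then obtain u where u: "\<And>n. u n \<in> Adm" and lt: "\<And>n. qform (u n) < \<mu> + inverse (real (Suc n))"
    by metis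
  have uF: "u n \<in> form_dom" and u1: "ell2_norm h (u n) = 1"
    and uo: "i < N \<Longrightarrow> ell2_inner h (u n) (e i) = 0" for n i
    using u[of n] by (auto simp: Adm_def)
  have u2: "u n \<in> ell2 h" for n using uF form_dom_ell2 by blast
  have bnd: "(ell2_norm h (sqV (u n)))\<^sup>2 \<le> \<mu> + 1" for n
  proof -
    have "inverse (real (Suc n)) \<le> 1" by (simp add: inverse_le_1_iff)
    then show ?thesis
      using lt[of n] qform_eq[OF uF, of n] lap_nonneg[OF u2, of n] by linarith
  qed
  obtain r w where r: "strict_mono (r::nat\<Rightarrow>nat)" and w: "w \<in> ell2 h"
    and lim: "(\<lambda>n. ell2_norm h (\<lambda>k. u (r n) k - w k)) \<longlonglongrightarrow> 0"
    by (rule compact_embedding[OF uF _ bnd]) (auto simp: u1 intro: that)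
  have w1: "ell2_norm h w = 1"
    using tendsto_norm_imp_norm[OF u2 w lim] u1 LIMSEQ_unique[OF tendsto_const] by fastforce
  have wo: "ell2_inner h w (e i) = 0" if "i < N" for i
    using tendsto_norm_imp_inner[OF u2 w _ lim, of "e i"] uo[OF that] e(1) that
      LIMSEQ_unique[OF tendsto_const] by (fastforce simp: orthonormal_on_def)
  have lapl: "(\<lambda>n. Re (ell2_inner h (lap h (u (r n))) (u (r n)))) \<longlonglongrightarrow> Re (ell2_inner h (lap h w) w)"
    by (intro tendsto_Re lap_inner_tendsto[OF u2 w _ lim, of 1]) (simp add: u1)
  have rinv: "(\<lambda>n. inverse (real (Suc (r n)))) \<longlonglongrightarrow> 0"
    using LIMSEQ_subseq_LIMSEQ[OF LIMSEQ_inverse_real_of_nat r] by (simp add: o_def)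
  \<comment> \<open>Lower semicontinuity of the potential part: over a finite set of points it
    converges, and along the sequence it is at most the total energy minus the kinetic part, whose
    limit is known.\<close>
  have fin: "(\<Sum>k\<in>F. (cmod (sqV w k))\<^sup>2) \<le> \<mu> - Re (ell2_inner h (lap h w) w)"
    if F: "finite F" "F \<subseteq> lattice h" for F :: "(real ^ 'n) set"
  proof (rule LIMSEQ_le)
    show "(\<lambda>n. \<Sum>k\<in>F. (cmod (sqV (u (r n)) k))\<^sup>2) \<longlonglongrightarrow> (\<Sum>k\<in>F. (cmod (sqV w k))\<^sup>2)"
      unfolding sqV_def by (intro tendsto_intros tendsto_norm_imp_pointwise[OF u2 w lim])
    show "(\<lambda>n. \<mu> + inverse (real (Suc (r n))) - Re (ell2_inner h (lap h (u (r n))) (u (r n))))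
        \<longlonglongrightarrow> \<mu> - Re (ell2_inner h (lap h w) w)"
      using tendsto_diff[OF tendsto_add[OF tendsto_const rinv] lapl] by simp
    show "\<exists>N. \<forall>n\<ge>N. (\<Sum>k\<in>F. (cmod (sqV (u (r n)) k))\<^sup>2)
        \<le> \<mu> + inverse (real (Suc (r n))) - Re (ell2_inner h (lap h (u (r n))) (u (r n)))"
    proof (intro exI allI impI)
      fix n
      show "(\<Sum>k\<in>F. (cmod (sqV (u (r n)) k))\<^sup>2)
        \<le> \<mu> + inverse (real (Suc (r n))) - Re (ell2_inner h (lap h (u (r n))) (u (r n)))"
        using ell2_finite_sum_le[OF form_dom_sqV[OF uF] F, of "r n"] lt[of "r n"]
          qform_eq[OF uF, of "r n"] by linarith
    qed
  qed
  have Sw: "sqV w \<in> ell2 h"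
    by (rule ell2_bddI[OF _ fin]) (simp add: sqV_def ell2_off[OF w])
  then have wF: "w \<in> form_dom" using w by (simp add: form_dom_def)
  have "qform w \<le> \<mu>"
    using ell2_norm_le_bdd[OF Sw fin] qform_eq[OF wF] by linarith
  have "qform w * (ell2_norm h v)\<^sup>2 \<le> qform v"
    if v: "v \<in> form_dom" and vo: "\<forall>i<N. ell2_inner h v (e i) = 0" for v
  proof (cases "ell2_norm h v = 0")
    case False
    let ?c = "complex_of_real (inverse (ell2_norm h v))"
    have "(\<lambda>k. ?c * v k) \<in> Adm"
      unfolding Adm_def using False v vo
      by (simp add: form_dom_scale ell2_norm_scale ell2_inner_scale_left norm_inverse)
    from mu_le[OF this] have "\<mu> \<le> (inverse (ell2_norm h v))\<^sup>2 * qform v"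
      by (simp add: qform_scale[OF v] norm_inverse)
    with \<open>qform w \<le> \<mu>\<close> have "qform w \<le> (inverse (ell2_norm h v))\<^sup>2 * qform v" by linarith
    then have "qform w * (ell2_norm h v)\<^sup>2 \<le> (inverse (ell2_norm h v))\<^sup>2 * qform v * (ell2_norm h v)\<^sup>2"
      by (intro mult_right_mono) auto
    also have "\<dots> = qform v" using False by (simp add: field_simps)
    finally show ?thesis .
  qed (simp add: qform_nonneg[OF v])
  then show ?thesis unfolding ground_state_def using wF w1 wo by blast
qed

text \<open>Minimality along \<open>u + t v\<close> for real t is a quadratic inequality without
  constant term, because \<open>u\<close> has norm 1; its linear coefficient gives the real part of
  the identity. The imaginary part is the real part in the direction \<open>\<i> v\<close>.\<close>

lemma ground_state_variation:
  assumes g: "ground_state N e u" and e: "\<And>i. i < N \<Longrightarrow> e i \<in> ell2 h"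
    and v: "v \<in> form_dom" "\<And>i. i < N \<Longrightarrow> ell2_inner h v (e i) = 0"
  shows "form u v = of_real (qform u) * ell2_inner h u v"
proof -
  have u: "u \<in> form_dom" "ell2_norm h u = 1" "\<And>i. i < N \<Longrightarrow> ell2_inner h u (e i) = 0"
    and min: "\<And>v. v \<in> form_dom \<Longrightarrow> (\<And>i. i < N \<Longrightarrow> ell2_inner h v (e i) = 0) \<Longrightarrow>
       qform u * (ell2_norm h v)\<^sup>2 \<le> qform v"
    using g by (auto simp: ground_state_def)
  have re: "Re (form u v) = qform u * Re (ell2_inner h u v)"
    if v: "v \<in> form_dom" "\<And>i. i < N \<Longrightarrow> ell2_inner h v (e i) = 0" for v
  proof -
    have "0 \<le> 2 * t * (Re (form u v) - qform u * Re (ell2_inner h u v))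
        + t\<^sup>2 * (qform v - qform u * (ell2_norm h v)\<^sup>2)" for t
    proof -
      let ?x = "\<lambda>k. u k + of_real t * v k"
      have tv: "(\<lambda>k. of_real t * v k) \<in> form_dom" by (rule form_dom_scale[OF v(1)])
      have x: "?x \<in> form_dom" by (intro form_dom_add u tv)
      have "qform u * (ell2_norm h ?x)\<^sup>2 \<le> qform ?x"
        using u v e form_dom_ell2
        by (intro min x) (auto simp: ell2_inner_add_left ell2_inner_scale_left ell2_scale)
      moreover have "qform ?x = qform u + 2 * t * Re (form u v) + t\<^sup>2 * qform v"
        unfolding qform_def using u(1) v(1) tv x
        by (simp add: form_add_left form_add_right form_scale_left form_scale_right
            form_herm[of u v] power2_eq_square algebra_simps)
      moreover have "(ell2_norm h ?x)\<^sup>2 = 1 + 2 * t * Re (ell2_inner h u v) + t\<^sup>2 * (ell2_norm h v)\<^sup>2"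
        using ell2_norm_sq_diff[OF form_dom_ell2[OF u(1)] form_dom_ell2[OF form_dom_scale[OF v(1), of "- of_real t"]]]
          ell2_norm_scale[of h "- of_real t" v] ell2_inner_scale_right[of h u "- of_real t" v] u(2)
        by (simp add: power_mult_distrib)
      ultimately show ?thesis by (simp add: algebra_simps)
    qed
    from linear_term_zero[OF this] show ?thesis by simp
  qed
  have im: "Im (form u v) = qform u * Im (ell2_inner h u v)"
    using re[of "\<lambda>k. \<i> * v k"] v u(1)
    by (simp add: form_dom_scale ell2_inner_scale_left form_scale_right ell2_inner_scale_right)
  show ?thesis using re[OF v] im by (simp add: complex_eq_iff)
qed

text \<open>Variations are allowed only orthogonally to the earlier vectors, so each lattice delta
  function is first projected. The projection changes nothing: \<open>u\<close> is orthogonal to the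
  earlier vectors, and also form-orthogonal to them because they are eigenvectors. This yields the
  eigenvalue equation point by point, and membership of the domain then follows from the equation
  itself.\<close>

lemma ground_state_eigenvector:
  assumes g: "ground_state N e u" and orth: "orthonormal_on h {..<N} e"
    and dom: "\<And>i. i < N \<Longrightarrow> e i \<in> dom_H h V"
    and eig: "\<And>i. i < N \<Longrightarrow> schroedinger h V (e i) = (\<lambda>k. of_real (l i) * e i k)"
  shows "u \<in> dom_H h V" "schroedinger h V u = (\<lambda>k. of_real (qform u) * u k)"
proof -
  have u: "u \<in> form_dom" "u \<in> ell2 h" "\<And>i. i < N \<Longrightarrow> ell2_inner h u (e i) = 0"
    using g form_dom_ell2 by (auto simp: ground_state_def)
  have e: "e i \<in> ell2 h" "e i \<in> form_dom" if "i < N" for i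
    using dom[OF that] dom_H_ell2 dom_H_form_dom by auto
  have ue: "form u (e i) = 0" if "i < N" for i
  proof -
    have "form (e i) u = of_real (l i) * ell2_inner h (e i) u"
      using that by (simp add: form_eq_inner_H[OF dom u(1)] eig ell2_inner_scale_left)
    then show ?thesis
      using u(3)[OF that] ell2_inner_commute[of h u "e i"] form_herm[OF u(1) e(2)[OF that]]
      by simp
  qed
  have eq: "schroedinger h V u k = of_real (qform u) * u k" if k: "k \<in> lattice h" for k
  proof -
    let ?d = "lattice_delta k"
    let ?c = "\<lambda>i. ell2_inner h ?d (e i)"
    let ?p = "\<lambda>l. \<Sum>i<N. ?c i * e i l"
    let ?v = "\<lambda>l. ?d l - ?p l"
    have p: "?p \<in> form_dom" by (rule form_dom_comb) (use e in auto)
    have v: "?v \<in> form_dom" by (intro form_dom_diff form_dom_delta k p)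
    have vo: "ell2_inner h ?v (e i) = 0" if "i < N" for i
      using that by (intro orthonormal_residual_inner[OF orth] lattice_delta_ell2 k) auto
    have comb: "form u (\<lambda>l. \<Sum>i\<in>I. c i * e i l) = 0" if "finite I" "I \<subseteq> {..<N}" for I c
      using that
    proof (induction I rule: finite_induct)
      case empty
      then show ?case by (simp add: form_def sqV_def lap_def ell2_inner_commute[of h _ "\<lambda>k. 0"])
    next
      case (insert i I)
      then show ?case
        using e u(1)
        by (simp add: form_add_right form_dom_scale form_dom_comb form_scale_right ue subset_iff)
    qed
    have "form u ?v = of_real (qform u) * ell2_inner h u ?v"
      by (rule ground_state_variation[OF g]) (use e v vo in auto)
    moreover have "form u ?v = form u ?d"
      using form_add_right[OF v p u(1)] comb[of "{..<N}" ?c] by simp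
    moreover have "ell2_inner h u ?p = 0"
      using e u by (subst ell2_inner_sum_right) (auto simp: ell2_inner_scale_right intro: ell2_scale)
    moreover have "ell2_inner h u ?v = ell2_inner h u ?d - ell2_inner h u ?p"
      by (intro ell2_inner_diff_right u form_dom_ell2[OF p] lattice_delta_ell2 k)
    ultimately have "form u ?d = of_real (qform u) * u k"
      by (simp add: ell2_inner_delta[OF k])
    moreover have "form u ?d = schroedinger h V u k"
    proof -
      have "ell2_inner h (sqV u) (sqV ?d) = of_real (V k) * u k"
      proof -
        have "sqV ?d = (\<lambda>l. of_real (sqrt (V k)) * ?d l)" by (auto simp: sqV_def lattice_delta_def)
        then show ?thesis
          using V_nonneg[OF k]
          by (simp add: ell2_inner_scale_right ell2_inner_delta[OF k] sqV_def mult.assoc[symmetric]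
              flip: of_real_mult)
      qed
      then show ?thesis by (simp add: form_def schroedinger_eq[OF u(2)] ell2_inner_delta[OF k])
    qed
    ultimately show ?thesis by simp
  qed
  show H: "schroedinger h V u = (\<lambda>k. of_real (qform u) * u k)"
  proof
    fix k show "schroedinger h V u k = of_real (qform u) * u k"
      using eq ell2_off[OF u(2)] by (cases "k \<in> lattice h") (auto simp: schroedinger_def)
  qed
  show "u \<in> dom_H h V"
  proof -
    have "one_plus_H h V u = (\<lambda>k. u k + of_real (qform u) * u k)"
      by (simp add: one_plus_H_def H)
    then show ?thesis using u(2) by (simp add: dom_H_def ell2_add ell2_scale)
  qed
qed

text \<open>The energy of a function bounds lam N times the squared norm of its N-th residual.
  Completeness therefore reduces to the unboundedness of the eigenvalues, and that is forced by
  compactness.\<close>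

lemma eigenbasis_exists: "\<exists>lam e. eigenbasis h V lam e"
proof -
  \<comment> \<open>Recursion along the well-founded order on indices: the N-th vector is chosen
    after the earlier ones, on which alone \<open>ground_state N\<close> depends.\<close>
  have "\<exists>e. \<forall>N. ground_state N e (e N)"
  proof (rule dependent_wf_choice[OF wf_less])
    fix f g :: "nat \<Rightarrow> 'n gridfun" and N r
    assume "\<And>i. (i, N) \<in> {(x, y). x < y} \<Longrightarrow> f i = g i"
    then show "ground_state N f r = ground_state N g r" by (simp add: ground_state_def)
  next
    fix N and f :: "nat \<Rightarrow> 'n gridfun"
    assume *: "\<And>i. (i, N) \<in> {(x, y). x < y} \<Longrightarrow> ground_state i f (f i)"
    then have gs: "ground_state i f (f i)" if "i < N" for i using that by simp
    have o: "ell2_inner h (f i) (f j) = 0" if "j < i" "i < N" for i j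
      using gs[OF that(2)] that(1) by (auto simp: ground_state_def)
    have "ell2_inner h (f i) (f j) = 0" if "i \<noteq> j" "i < N" "j < N" for i j
      using o[of j i] o[of i j] that ell2_inner_commute[of h "f i" "f j"]
      by (cases "i < j") auto
    moreover have n: "f i \<in> form_dom" "ell2_inner h (f i) (f i) = 1" if "i < N" for i
      using gs[OF that] form_dom_ell2 by (auto simp: ground_state_def ell2_inner_self)
    ultimately have "orthonormal_on h {..<N} f"
      unfolding orthonormal_on_def using form_dom_ell2 by auto
    then show "\<exists>r. ground_state N f r" using ground_state_exists n by blast
  qed
  then obtain e where gs: "\<And>N. ground_state N e (e N)" by blast
  define lam where "lam N = qform (e N)" for N
  have F: "e N \<in> form_dom" and E: "e N \<in> ell2 h" and N1: "ell2_norm h (e N) = 1" for N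
    using gs[of N] form_dom_ell2 by (auto simp: ground_state_def)
  have o: "ell2_inner h (e i) (e j) = 0" if "j < i" for i j
    using gs[of i] that by (auto simp: ground_state_def)
  have inn: "ell2_inner h (e i) (e j) = (if i = j then 1 else 0)" for i j
    using o[of i j] o[of j i] ell2_inner_commute[of h "e i" "e j"] ell2_inner_self[OF E, of i] N1[of i]
    by (cases "i < j"; cases "i = j") auto
  have orth: "orthonormal_on h I e" for I
    unfolding orthonormal_on_def using inn E by auto
  have eig: "e N \<in> dom_H h V \<and> schroedinger h V (e N) = (\<lambda>k. of_real (lam N) * e N k)" for N
  proof (induction N rule: less_induct)
    case (less N)
    then show ?case
      using ground_state_eigenvector[OF gs orth, of N lam] by (simp add: lam_def)
  qed
  have lam0: "0 \<le> lam N" for N unfolding lam_def by (rule qform_nonneg[OF F])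
  have min: "lam N * (ell2_norm h v)\<^sup>2 \<le> qform v"
    if "v \<in> form_dom" "\<And>i. i < N \<Longrightarrow> ell2_inner h v (e i) = 0" for N v
    using gs[of N] that by (auto simp: ground_state_def lam_def)
  have mono: "lam M \<le> lam N" if "M \<le> N" for M N
    using min[OF F, of M N] that by (simp add: inn lam_def N1)
  \<comment> \<open>If the eigenvalues were bounded, a subsequence of the vectors would converge in
    norm. The limit has norm 1, yet it is orthogonal to every eigenvector and hence to
    itself.\<close>
  have unbdd: "\<exists>N. C < lam N" for C
  proof (rule ccontr)
    assume "\<not> ?thesis"
    then have "lam N \<le> C" for N by (meson not_less)
    moreover have "(ell2_norm h (sqV (e N)))\<^sup>2 \<le> lam N" for N
      using qform_eq[OF F, of N] lap_nonneg[OF E, of N] by (simp add: lam_def)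
    ultimately have bnd: "(ell2_norm h (sqV (e N)))\<^sup>2 \<le> C" for N by (meson order_trans)
    obtain r w where r: "strict_mono (r::nat\<Rightarrow>nat)" and w: "w \<in> ell2 h"
      and lim: "(\<lambda>n. ell2_norm h (\<lambda>k. e (r n) k - w k)) \<longlonglongrightarrow> 0"
      by (rule compact_embedding[OF F _ bnd]) (auto simp: N1 intro: that)
    have wn: "ell2_norm h w = 1"
      using tendsto_norm_imp_norm[OF E w lim] N1 LIMSEQ_unique[OF tendsto_const] by fastforce
    have "ell2_inner h w (e j) = 0" for j
    proof -
      have "(\<lambda>n. ell2_inner h (e (r n)) (e j)) \<longlonglongrightarrow> ell2_inner h w (e j)"
        by (rule tendsto_norm_imp_inner[OF E w E lim])
      moreover have "\<forall>\<^sub>F n in sequentially. ell2_inner h (e (r n)) (e j) = 0"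
      proof (rule eventually_sequentiallyI[of "Suc j"])
        fix n assume "Suc j \<le> n"
        then have "j < r n" using seq_suble[OF r, of n] by linarith
        then show "ell2_inner h (e (r n)) (e j) = 0" by (rule o)
      qed
      ultimately show ?thesis
        by (metis LIMSEQ_unique tendsto_eventually)
    qed
    then have "(\<lambda>n. ell2_inner h (e (r n)) w) \<longlonglongrightarrow> 0"
      using ell2_inner_commute[of h _ w] by simp
    moreover have "(\<lambda>n. ell2_inner h (e (r n)) w) \<longlonglongrightarrow> ell2_inner h w w"
      by (rule tendsto_norm_imp_inner[OF E w w lim])
    ultimately have "ell2_inner h w w = 0" using LIMSEQ_unique by blast
    then show False by (simp add: ell2_inner_self[OF w] wn)
  qed
  let ?r = "\<lambda>g N k. g k - (\<Sum>i<N. ell2_inner h g (e i) * e i k)"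
  have r_ell2: "?r g N \<in> ell2 h" if "g \<in> ell2 h" for g N
    by (intro ell2_diff that orthonormal_comb_ell2 orth)
  \<comment> \<open>Projection and residual are orthogonal for the form as well, so the residual has
    no more energy than \<open>g\<close>; as it is orthogonal to the first N vectors, it competes in
    the N-th minimisation.\<close>
  have res: "lam N * (ell2_norm h (?r g N))\<^sup>2 \<le> qform g" if g: "g \<in> form_dom" for g N
  proof -
    let ?p = "\<lambda>k. \<Sum>i<N. ell2_inner h g (e i) * e i k"
    have p: "?p \<in> form_dom" by (rule form_dom_comb) (rule F)
    have r: "?r g N \<in> form_dom" by (rule form_dom_diff[OF g p])
    have ro: "ell2_inner h (?r g N) (e i) = 0" if "i < N" for i
      using that by (intro orthonormal_residual_inner[OF orth] form_dom_ell2[OF g]) auto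
    have "form (\<lambda>k. \<Sum>i\<in>I. c i * e i k) (?r g N) = 0" if "finite I" "I \<subseteq> {..<N}" for I c
      using that
    proof (induction I rule: finite_induct)
      case empty
      then show ?case by (simp add: form_def sqV_def lap_def)
    next
      case (insert i I)
      have "form (e i) (?r g N) = 0"
        using eig[of i] ro[of i] insert.prems ell2_inner_commute[of h "e i" "?r g N"]
        by (simp add: form_eq_inner_H[OF _ r] ell2_inner_scale_left)
      then show ?case
        using insert F r
        by (simp add: form_add_left form_dom_scale form_dom_comb form_scale_left)
    qed
    from this[of "{..<N}" "\<lambda>i. ell2_inner h g (e i)"]
    have pr: "form ?p (?r g N) = 0" by simp
    have "qform g = qform (\<lambda>k. ?p k + ?r g N k)" by simp
    also have "\<dots> = qform ?p + qform (?r g N)"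
      unfolding qform_def using p r form_herm[OF p r] pr
      by (simp only: form_add_left form_add_right form_dom_add) simp
    finally have "qform (?r g N) \<le> qform g" using qform_nonneg[OF p] by simp
    then show ?thesis using min[OF r, of N] ro by fastforce
  qed
  have nm: "ell2_norm h (?r g N) \<le> ell2_norm h g" if "g \<in> ell2 h" for g N
  proof (rule power2_le_imp_le)
    show "(ell2_norm h (?r g N))\<^sup>2 \<le> (ell2_norm h g)\<^sup>2"
      unfolding orthonormal_residual_norm[OF orth finite_lessThan that] by (simp add: sum_nonneg)
  qed simp
  \<comment> \<open>The residual map is linear and does not increase norms, so \<open>g\<close> may
    be replaced, up to \<epsilon> / 2, by a finitely supported function. That function has finite
    energy, and \<open>res\<close> applies to it.\<close>
  have compl: "(\<lambda>N. ell2_norm h (?r g N)) \<longlonglongrightarrow> 0" if g: "g \<in> ell2 h" for g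
  proof (rule LIMSEQ_I)
    fix \<epsilon> :: real assume eps: "0 < \<epsilon>"
    obtain K where K: "finite K" "K \<subseteq> lattice h"
      and Ke: "(ell2_norm h (\<lambda>k. g k - (\<Sum>l\<in>K. g l * lattice_delta l k)))\<^sup>2 \<le> (\<epsilon> / 2)\<^sup>2"
      using ell2_approx_finite[OF g, of "(\<epsilon> / 2)\<^sup>2"] eps by (auto simp: power2_eq_square)
    define f where "f = (\<lambda>k. \<Sum>l\<in>K. g l * lattice_delta l k)"
    have fF: "f \<in> form_dom" unfolding f_def using K(2) by (intro form_dom_comb) (auto intro: form_dom_delta)
    note f2 = form_dom_ell2[OF fF]
    have close: "ell2_norm h (\<lambda>k. g k - f k) \<le> \<epsilon> / 2"
      using power2_le_imp_le[OF Ke] eps unfolding f_def by simp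
    obtain N0 where N0: "4 * qform f / \<epsilon>\<^sup>2 < lam N0" using unbdd by blast
    have "norm (ell2_norm h (?r g N) - 0) < \<epsilon>" if "N \<ge> N0" for N
    proof -
      have "4 * qform f / \<epsilon>\<^sup>2 < lam N" using N0 mono[OF that] by linarith
      moreover have "0 \<le> 4 * qform f / \<epsilon>\<^sup>2" using qform_nonneg[OF fF] by simp
      ultimately have lp: "0 < lam N" and "qform f < lam N * (\<epsilon> / 2)\<^sup>2"
        using eps by (linarith, simp add: field_simps power2_eq_square)
      with res[OF fF, of N] have "lam N * (ell2_norm h (?r f N))\<^sup>2 < lam N * (\<epsilon> / 2)\<^sup>2" by linarith
      then have "(ell2_norm h (?r f N))\<^sup>2 < (\<epsilon> / 2)\<^sup>2" using lp by simp
      then have a: "ell2_norm h (?r f N) < \<epsilon> / 2" using power2_less_imp_less[of _ "\<epsilon> / 2"] eps by simp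
      have "?r g N = (\<lambda>k. ?r (\<lambda>k. g k - f k) N k + ?r f N k)"
        by (simp add: ell2_inner_diff_left g f2 E sum_subtractf left_diff_distrib)
      then have "ell2_norm h (?r g N) \<le> ell2_norm h (?r (\<lambda>k. g k - f k) N) + ell2_norm h (?r f N)"
        using ell2_norm_triangle[OF r_ell2[OF ell2_diff[OF g f2]] r_ell2[OF f2], of N N] by simp
      then show ?thesis using a nm[OF ell2_diff[OF g f2], of N] close by simp
    qed
    then show "\<exists>N0. \<forall>N\<ge>N0. norm (ell2_norm h (?r g N) - 0) < \<epsilon>" by blast
  qed
  have "eigenbasis h V lam e"
    unfolding eigenbasis_def using eig lam0 inn compl by blast
  then show ?thesis by blast
qed

end

subsection \<open>Indefinite Lebesgue integrals\<close>

lemma absolutely_integrable_iff_lebesgue_on: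
  fixes f :: "real \<Rightarrow> 'a::euclidean_space"
  shows "f absolutely_integrable_on {a..b} \<longleftrightarrow> integrable (lebesgue_on {a..b}) f"
  by (simp add: set_integrable_def integrable_restrict_space)

text \<open>Absolute continuity of F with almost everywhere derivative g, expressed without
  differentiating. Reading \<open>primitive T g v'\<close> as "v'' = g" is how second order
  equations are stated for single modes.\<close>

definition primitive :: "real \<Rightarrow> (real \<Rightarrow> 'a::euclidean_space) \<Rightarrow> (real \<Rightarrow> 'a) \<Rightarrow> bool" where
  "primitive T g F \<longleftrightarrow> g absolutely_integrable_on {0..T} \<and>
     (\<forall>t\<in>{0..T}. F t = F 0 + integral {0..t} g)"

lemma primitiveD:
  assumes "primitive T g F"
  shows "g absolutely_integrable_on {0..T}" "t \<in> {0..T} \<Longrightarrow> F t = F 0 + integral {0..t} g"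
  using assms unfolding primitive_def by blast+

lemma primitive_integrable_sub:
  assumes "primitive T g F" "0 \<le> s" "t \<le> T"
  shows "g absolutely_integrable_on {s..t}"
  by (rule absolutely_integrable_on_subinterval[OF primitiveD(1)[OF assms(1)]]) (use assms in auto)

lemma integral_0_diff:
  fixes g :: "real \<Rightarrow> 'a::euclidean_space"
  assumes "g absolutely_integrable_on {0..T}" "0 \<le> s" "s \<le> t" "t \<le> T"
  shows "integral {0..t} g - integral {0..s} g = integral {s..t} g"
proof -
  have "g absolutely_integrable_on {0..t}"
    by (rule absolutely_integrable_on_subinterval[OF assms(1)]) (use assms in auto)
  then have "g integrable_on {0..t}" using set_lebesgue_integral_eq_integral(1) by blast
  from Henstock_Kurzweil_Integration.integral_combine[OF assms(2,3) this]
  show ?thesis by (simp add: algebra_simps)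
qed

lemma primitive_diff:
  assumes "primitive T g F" "0 \<le> s" "s \<le> t" "t \<le> T"
  shows "F t - F s = integral {s..t} g"
  using primitiveD(2)[OF assms(1), of t] primitiveD(2)[OF assms(1), of s] assms
    integral_0_diff[OF primitiveD(1)[OF assms(1)] assms(2-4)] by simp

lemma primitive_integral:
  assumes "g absolutely_integrable_on {0..T}"
  shows "primitive T g (\<lambda>t. c + integral {0..t} g)"
  using assms by (simp add: primitive_def)

lemma primitive_cong:
  assumes "primitive T g F" "\<And>t. t \<in> {0..T} \<Longrightarrow> F t = G t" "0 \<le> T"
  shows "primitive T g G"
  unfolding primitive_def
proof (intro conjI ballI primitiveD(1)[OF assms(1)])
  show "G t = G 0 + integral {0..t} g" if "t \<in> {0..T}" for t
    using primitiveD(2)[OF assms(1) that] assms(2)[OF that] assms(2)[of 0] assms(3) by simp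
qed

lemma primitive_cong_integrand:
  assumes "primitive T g F" "\<And>t. t \<in> {0..T} \<Longrightarrow> g t = g' t"
  shows "primitive T g' F"
proof -
  have "integral {0..t} g = integral {0..t} g'" if "t \<in> {0..T}" for t
    by (rule Henstock_Kurzweil_Integration.integral_cong) (use that assms(2) in auto)
  moreover have "g' absolutely_integrable_on {0..T}"
    using primitiveD(1)[OF assms(1)] assms(2) unfolding absolutely_integrable_iff_lebesgue_on
    by (subst Bochner_Integration.integrable_cong[OF refl, of _ g' g]) auto
  ultimately show ?thesis using primitiveD(2)[OF assms(1)] unfolding primitive_def by metis
qed

lemma primitive_continuous:
  assumes "primitive T g F"
  shows "continuous_on {0..T} F"
proof -
  have "g integrable_on {0..T}"
    using primitiveD(1)[OF assms] set_lebesgue_integral_eq_integral(1) by blast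
  then have "continuous_on {0..T} (\<lambda>t. F 0 + integral {0..t} g)"
    by (intro continuous_intros indefinite_integral_continuous_1)
  then show ?thesis
    by (rule continuous_on_eq) (simp add: primitiveD(2)[OF assms, symmetric])
qed

lemma primitive_add:
  assumes "primitive T f F" "primitive T g G"
  shows "primitive T (\<lambda>t. f t + g t) (\<lambda>t. F t + G t)"
  unfolding primitive_def
proof (intro conjI ballI)
  show "(\<lambda>t. f t + g t) absolutely_integrable_on {0..T}"
    by (intro set_integral_add primitiveD(1)[OF assms(1)] primitiveD(1)[OF assms(2)])
  fix t assume t: "t \<in> {0..T}"
  then have "f integrable_on {0..t}" "g integrable_on {0..t}"
    using primitive_integrable_sub[OF assms(1), of 0 t] primitive_integrable_sub[OF assms(2), of 0 t]
      set_lebesgue_integral_eq_integral(1) by auto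
  then show "F t + G t = F 0 + G 0 + integral {0..t} (\<lambda>t. f t + g t)"
    using primitiveD(2)[OF assms(1) t] primitiveD(2)[OF assms(2) t]
    by (simp add: Henstock_Kurzweil_Integration.integral_add)
qed

lemma primitive_linear:
  assumes "primitive T f F" "bounded_linear L"
  shows "primitive T (\<lambda>t. L (f t)) (\<lambda>t. L (F t))"
  unfolding primitive_def
proof (intro conjI ballI)
  show "(\<lambda>t. L (f t)) absolutely_integrable_on {0..T}"
    using absolutely_integrable_linear[OF primitiveD(1)[OF assms(1)] assms(2)] by (simp add: o_def)
  fix t assume t: "t \<in> {0..T}"
  then have "f integrable_on {0..t}"
    using primitive_integrable_sub[OF assms(1), of 0 t] set_lebesgue_integral_eq_integral(1) by auto
  then have "integral {0..t} (\<lambda>t. L (f t)) = L (integral {0..t} f)"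
    using integral_linear[OF _ assms(2), of f] by (simp add: o_def)
  then show "L (F t) = L (F 0) + integral {0..t} (\<lambda>t. L (f t))"
    using primitiveD(2)[OF assms(1) t] assms(2) by (simp add: linear_simps)
qed

lemma primitive_cmult:
  assumes "primitive T f (F :: real \<Rightarrow> real)"
  shows "primitive T (\<lambda>t. c * f t) (\<lambda>t. c * F t)"
  by (rule primitive_linear[OF assms bounded_linear_mult_right])

lemma primitive_diff_fun:
  assumes "primitive T f F" "primitive T g G"
  shows "primitive T (\<lambda>t. f t - g t) (\<lambda>t. F t - G t)"
  using primitive_add[OF assms(1) primitive_linear[OF assms(2) bounded_linear_minus[OF bounded_linear_ident]]]
  by simp

text \<open>With differentiability at every point of the interval, the fundamental theorem for the
  gauge integral asks for no continuity of \<open>f\<close>. This covers the coefficient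
  \<open>a\<close>, whose derivative is merely bounded and measurable.\<close>

lemma primitive_deriv:
  assumes "\<And>t. t \<in> {0..T} \<Longrightarrow> (F has_vector_derivative f t) (at t within {0..T})"
    and "f absolutely_integrable_on {0..T}"
  shows "primitive T f F"
  unfolding primitive_def
proof (intro conjI ballI assms(2))
  fix t assume t: "t \<in> {0..T}"
  have "(f has_integral (F t - F 0)) {0..t}"
    by (rule fundamental_theorem_of_calculus)
       (use t in \<open>auto intro: has_vector_derivative_within_subset[OF assms(1)]\<close>)
  then show "F t = F 0 + integral {0..t} f" by (simp add: integral_unique)
qed

lemma continuous_absolutely_integrable:
  fixes f :: "real \<Rightarrow> 'a::euclidean_space"
  shows "continuous_on {a..b} f \<Longrightarrow> f absolutely_integrable_on {a..b}"
  using absolutely_integrable_continuous[of a b f] by simp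

text \<open>Telescoping over a partition of mesh below \<delta> gives |D t - D 0| \<le> \<epsilon>
  (m t - m 0) with \<open>m\<close> fixed and \<epsilon> arbitrary.\<close>

lemma small_increments_constant:
  fixes D :: "real \<Rightarrow> 'a::real_normed_vector"
  assumes small: "\<And>\<epsilon>. 0 < \<epsilon> \<Longrightarrow> \<exists>\<delta>>0. \<forall>s t. 0 \<le> s \<and> s \<le> t \<and> t \<le> T \<and> t - s < \<delta> \<longrightarrow>
      norm (D t - D s) \<le> \<epsilon> * (m t - m s)"
    and t: "t \<in> {0..T}"
  shows "D t = D 0"
proof -
  have le: "norm (D t - D 0) \<le> \<epsilon> * (m t - m 0)" if eps: "0 < \<epsilon>" for \<epsilon>
  proof -
    obtain \<delta> where \<delta>: "0 < \<delta>" and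
      d: "\<And>s t. 0 \<le> s \<Longrightarrow> s \<le> t \<Longrightarrow> t \<le> T \<Longrightarrow> t - s < \<delta> \<Longrightarrow> norm (D t - D s) \<le> \<epsilon> * (m t - m s)"
      using small[OF eps] by blast
    \<comment> \<open>With n equal pieces the mesh is t / n < \<delta>.\<close>
    obtain n :: nat where n: "t / \<delta> < real n" using reals_Archimedean2 by blast
    have n0: "0 < real n"
      using n t \<delta> by (metis atLeastAtMost_iff divide_nonneg_pos le_less_trans)
    let ?p = "\<lambda>i. t * real i / real n"
    have mono: "?p i \<le> ?p j" if "i \<le> j" for i j
      using that t n0 by (intro divide_right_mono mult_left_mono) auto
    have step: "norm (D (?p (Suc i)) - D (?p i)) \<le> \<epsilon> * (m (?p (Suc i)) - m (?p i))" if "i < n" for i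
    proof (rule d)
      show "0 \<le> ?p i" using t by auto
      show "?p i \<le> ?p (Suc i)" by (rule mono) simp
      show "?p (Suc i) \<le> T" using mono[of "Suc i" n] that t n0 by auto
      have "?p (Suc i) - ?p i = t / real n" by (simp add: distrib_left add_divide_distrib)
      then show "?p (Suc i) - ?p i < \<delta>" using n n0 \<delta> by (simp add: field_simps)
    qed
    have "norm (D (?p k) - D (?p 0)) \<le> \<epsilon> * (m (?p k) - m (?p 0))" if "k \<le> n" for k
      using that
    proof (induction k)
      case (Suc k)
      have "norm (D (?p (Suc k)) - D (?p 0)) \<le> norm (D (?p (Suc k)) - D (?p k)) + norm (D (?p k) - D (?p 0))"
        by (rule norm_diff_triangle_le) auto
      also have "\<dots> \<le> \<epsilon> * (m (?p (Suc k)) - m (?p k)) + \<epsilon> * (m (?p k) - m (?p 0))"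
        using Suc step[of k] by (intro add_mono) auto
      finally show ?case by (simp add: algebra_simps)
    qed simp
    from this[of n] show ?thesis using n0 by simp
  qed
  have "norm (D t - D 0) \<le> e" if e: "0 < e" for e
  proof -
    have "norm (D t - D 0) \<le> e / (\<bar>m t - m 0\<bar> + 1) * (m t - m 0)"
      by (rule le) (use e in \<open>simp add: add_nonneg_pos\<close>)
    also have "\<dots> \<le> e / (\<bar>m t - m 0\<bar> + 1) * (\<bar>m t - m 0\<bar> + 1)"
      using e by (intro mult_left_mono) auto
    also have "\<dots> = e" by simp
    finally show ?thesis .
  qed
  then have "norm (D t - D 0) \<le> 0" by (meson dense_ge)
  then show ?thesis by simp
qed

lemma absolutely_integrable_bilinear_continuous:
  fixes prod :: "'a::euclidean_space \<Rightarrow> 'b::euclidean_space \<Rightarrow> 'c::euclidean_space"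
  assumes "bounded_bilinear prod" "continuous_on {a..b} P" "q absolutely_integrable_on {a..b}"
  shows "(\<lambda>t. prod (P t) (q t)) absolutely_integrable_on {a..b::real}"
proof (rule absolutely_integrable_bounded_measurable_product[where h=prod and f=P and g=q])
  show "bilinear prod" using assms(1) bilinear_conv_bounded_bilinear by blast
  show "P \<in> borel_measurable (lebesgue_on {a..b})"
    by (rule continuous_imp_measurable_on_sets_lebesgue[OF assms(2)]) simp
  show "bounded (P ` {a..b})"
    using assms(2) compact_continuous_image compact_imp_bounded by blast
qed (use assms in auto)

text \<open>A Riemann sum argument avoids both differentiability almost everywhere and Fubini.\<close>

lemma primitive_bilinear:
  fixes prod :: "'a::euclidean_space \<Rightarrow> 'b::euclidean_space \<Rightarrow> 'c::euclidean_space"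
  assumes prod: "bounded_bilinear prod" and P: "primitive T p P" and Q: "primitive T q Q" and T: "0 \<le> T"
  shows "primitive T (\<lambda>t. prod (p t) (Q t) + prod (P t) (q t)) (\<lambda>t. prod (P t) (Q t))"
proof -
  interpret bounded_bilinear prod by (rule prod)
  have flip: "bounded_bilinear (\<lambda>x y. prod y x)" by (rule bounded_bilinear.flip[OF prod])
  note cP = primitive_continuous[OF P] and cQ = primitive_continuous[OF Q]
  let ?g = "\<lambda>t. prod (p t) (Q t) + prod (P t) (q t)"
  have g: "?g absolutely_integrable_on {0..T}"
    by (intro set_integral_add absolutely_integrable_bilinear_continuous[OF prod]
        absolutely_integrable_bilinear_continuous[OF flip] cP cQ primitiveD(1)[OF P] primitiveD(1)[OF Q])
  define D where "D t = prod (P t) (Q t) - integral {0..t} ?g" for t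
  have np: "(\<lambda>t. norm (p t) + norm (q t)) absolutely_integrable_on {0..T}"
    by (intro set_integral_add absolutely_integrable_norm[unfolded o_def] primitiveD(1)[OF P] primitiveD(1)[OF Q])
  obtain K where K: "0 < K" "\<And>a b. norm (prod a b) \<le> norm a * norm b * K"
    using pos_bounded by blast
  define m where "m t = K * integral {0..t} (\<lambda>t. norm (p t) + norm (q t))" for t
  have "D t = D 0" if "t \<in> {0..T}" for t
  proof (rule small_increments_constant[where m=m])
    fix \<epsilon> :: real assume eps: "0 < \<epsilon>"
    obtain d1 where d1: "0 < d1" "\<And>x y. x \<in> {0..T} \<Longrightarrow> y \<in> {0..T} \<Longrightarrow> dist y x < d1 \<Longrightarrow> dist (P y) (P x) < \<epsilon>"
      using compact_uniformly_continuous[OF cP] eps unfolding uniformly_continuous_on_def by force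
    obtain d2 where d2: "0 < d2" "\<And>x y. x \<in> {0..T} \<Longrightarrow> y \<in> {0..T} \<Longrightarrow> dist y x < d2 \<Longrightarrow> dist (Q y) (Q x) < \<epsilon>"
      using compact_uniformly_continuous[OF cQ] eps unfolding uniformly_continuous_on_def by force
    have "norm (D t - D s) \<le> \<epsilon> * (m t - m s)"
      if st: "0 \<le> s" "s \<le> t" "t \<le> T" "t - s < min d1 d2" for s t
    proof -
      have sub: "f absolutely_integrable_on {s..t}" if "f absolutely_integrable_on {0..T}" for f :: "real \<Rightarrow> 'd::euclidean_space"
        by (rule absolutely_integrable_on_subinterval[OF that]) (use st in auto)
      note int = set_lebesgue_integral_eq_integral(1)
      have pi: "p integrable_on {s..t}" and qi: "q integrable_on {s..t}" and gi: "?g integrable_on {s..t}"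
        and npi: "(\<lambda>t. norm (p t) + norm (q t)) integrable_on {s..t}"
        using int[OF sub[OF primitiveD(1)[OF P]]] int[OF sub[OF primitiveD(1)[OF Q]]]
          int[OF sub[OF g]] int[OF sub[OF np]] by auto
      have 1: "((\<lambda>r. prod (p r) (Q t)) has_integral prod (P t - P s) (Q t)) {s..t}"
        using has_integral_linear[OF integrable_integral[OF pi] bounded_linear_left[of "Q t"]]
        by (simp add: o_def primitive_diff[OF P st(1-3)])
      have 2: "((\<lambda>r. prod (P s) (q r)) has_integral prod (P s) (Q t - Q s)) {s..t}"
        using has_integral_linear[OF integrable_integral[OF qi] bounded_linear_right[of "P s"]]
        by (simp add: o_def primitive_diff[OF Q st(1-3)])
      have 3: "(?g has_integral (integral {0..t} ?g - integral {0..s} ?g)) {s..t}"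
        using integrable_integral[OF gi] integral_0_diff[OF g st(1-3)] by simp
      \<comment> \<open>The increment of the product is written with Q frozen at the right end and P
        at the left end. Compared with the integral of \<open>?g\<close>, the defect has integrand
        \<open>prod (p r) (Q t - Q r) + prod (P s - P r) (q r)\<close>, which uniform continuity
        makes small.\<close>
      have eq: "D t - D s = prod (P t - P s) (Q t) + prod (P s) (Q t - Q s) - (integral {0..t} ?g - integral {0..s} ?g)"
        unfolding D_def by (simp add: diff_left diff_right)
      have hi: "((\<lambda>r. prod (p r) (Q t) + prod (P s) (q r) - ?g r) has_integral (D t - D s)) {s..t}"
        unfolding eq by (intro has_integral_diff has_integral_add 1 2 3)
      have ni: "((\<lambda>r. \<epsilon> * K * (norm (p r) + norm (q r))) has_integral \<epsilon> * (m t - m s)) {s..t}"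
      proof -
        have "m t - m s = K * integral {s..t} (\<lambda>t. norm (p t) + norm (q t))"
          unfolding m_def integral_0_diff[OF np st(1-3), symmetric] by (simp add: right_diff_distrib)
        then show ?thesis
          using has_integral_mult_right[OF integrable_integral[OF npi], of "\<epsilon> * K"] by (simp add: mult.assoc)
      qed
      show ?thesis
      proof (rule has_integral_norm_bound_integral_component[OF hi ni, of 1, simplified])
        fix r assume r: "s \<le> r \<and> r \<le> t"
        have "norm (Q t - Q r) \<le> \<epsilon>" "norm (P s - P r) \<le> \<epsilon>"
          using d1(2)[of r s] d2(2)[of r t] r st by (auto simp: dist_norm dist_real_def)
        moreover have "prod (p r) (Q t) + prod (P s) (q r) - ?g r = prod (p r) (Q t - Q r) + prod (P s - P r) (q r)"
          by (simp add: diff_left diff_right)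
        ultimately have "norm (prod (p r) (Q t) + prod (P s) (q r) - ?g r)
            \<le> norm (p r) * \<epsilon> * K + \<epsilon> * norm (q r) * K"
          using K eps
          by (auto intro!: order_trans[OF norm_triangle_ineq] add_mono order_trans[OF K(2)] mult_mono)
        then show "norm (prod (p r) (Q t) + prod (P s) (q r) - ?g r) \<le> \<epsilon> * K * (norm (p r) + norm (q r))"
          by (simp add: algebra_simps)
      qed
    qed
    then show "\<exists>\<delta>>0. \<forall>s t. 0 \<le> s \<and> s \<le> t \<and> t \<le> T \<and> t - s < \<delta> \<longrightarrow> norm (D t - D s) \<le> \<epsilon> * (m t - m s)"
      using d1(1) d2(1) by (intro exI[of _ "min d1 d2"]) auto
  qed (rule that)
  then show ?thesis
    unfolding primitive_def
  proof (intro conjI ballI g)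
    fix t assume "t \<in> {0..T}"
    then have "D t = D 0" by (rule \<open>\<And>t. t \<in> {0..T} \<Longrightarrow> D t = D 0\<close>)
    then show "prod (P t) (Q t) = prod (P 0) (Q 0) + integral {0..t} ?g"
      by (simp add: D_def algebra_simps)
  qed
qed

section \<open>Gronwall's inequality and the energy of a single mode\<close>

lemma primitive_nonpos:
  assumes F: "primitive T g F" and le: "AE t in lebesgue_on {0..T}. g t \<le> (0::real)" and t: "t \<in> {0..T}"
  shows "F t \<le> F 0"
proof -
  have "g absolutely_integrable_on {0..t}"
    using primitive_integrable_sub[OF F, of 0 t] t by auto
  then have "integral {0..t} g = integral\<^sup>L (lebesgue_on {0..t}) g"
    unfolding absolutely_integrable_iff_lebesgue_on
    by (intro lebesgue_integral_eq_integral[symmetric]) auto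
  also have "\<dots> \<le> 0"
  proof -
    have "AE t in lebesgue_on {0..t}. 0 \<le> - g t"
      using le t by (auto simp: AE_restrict_space_iff elim!: eventually_mono)
    then have "0 \<le> integral\<^sup>L (lebesgue_on {0..t}) (\<lambda>t. - g t)"
      by (rule integral_nonneg_AE)
    then show ?thesis by simp
  qed
  finally show ?thesis using primitiveD(2)[OF F t] by simp
qed

text \<open>The integrating factor exp (- K t) removes the term K E; in front of the nonnegative
  forcing it is estimated by 1.\<close>

lemma energy_growth:
  fixes E :: "real \<Rightarrow> real"
  assumes E: "primitive T E' E" and F: "F absolutely_integrable_on {0..T}"
    and le: "AE t in lebesgue_on {0..T}. E' t \<le> K * E t + F t"
    and nn: "\<And>t. t \<in> {0..T} \<Longrightarrow> 0 \<le> F t" and K: "0 \<le> K" and t: "t \<in> {0..T}"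
  shows "E t \<le> exp (K * t) * (E 0 + integral {0..t} F)"
proof -
  have T: "0 \<le> T" using t by auto
  have ex: "primitive T (\<lambda>t. - K * exp (- K * t)) (\<lambda>t. exp (- K * t))"
    by (rule primitive_deriv)
       (auto intro!: derivative_eq_intros continuous_absolutely_integrable continuous_intros
         simp: has_real_derivative_iff_has_vector_derivative[symmetric])
  have "primitive T (\<lambda>t. (- K * exp (- K * t)) * E t + exp (- K * t) * E' t - F t)
      (\<lambda>t. exp (- K * t) * E t - (0 + integral {0..t} F))"
    by (intro primitive_diff_fun primitive_bilinear[OF bounded_bilinear_mult] ex E T primitive_integral F)
  moreover have "AE t in lebesgue_on {0..T}. (- K * exp (- K * t)) * E t + exp (- K * t) * E' t - F t \<le> 0"
  proof -
    have "AE t in lebesgue_on {0..T}. t \<in> {0..T}" by (rule AE_I2) simp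
    with le show ?thesis
    proof eventually_elim
      fix t assume t: "t \<in> {0..T}" and *: "E' t \<le> K * E t + F t"
      have "exp (- K * t) * E' t \<le> exp (- K * t) * (K * E t + F t)" by (rule mult_left_mono[OF *]) simp
      moreover have "exp (- K * t) * F t \<le> 1 * F t"
        using K t by (intro mult_right_mono nn) auto
      ultimately show "(- K * exp (- K * t)) * E t + exp (- K * t) * E' t - F t \<le> 0"
        by (simp add: algebra_simps)
    qed
  qed
  ultimately have "exp (- K * t) * E t - (0 + integral {0..t} F) \<le> exp (- K * 0) * E 0 - (0 + integral {0..0} F)"
    by (rule primitive_nonpos) (rule t)
  then have "exp (- K * t) * E t \<le> E 0 + integral {0..t} F" by simp
  then have "exp (K * t) * (exp (- K * t) * E t) \<le> exp (K * t) * (E 0 + integral {0..t} F)"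
    by (rule mult_left_mono) simp
  then show ?thesis by (simp add: mult.assoc[symmetric] exp_add[symmetric])
qed

text \<open>For one mode the energy is \<open>a (1 + \<lambda>) |v|\<^sup>2 + |v'|\<^sup>2\<close>; writing \<open>a \<lambda> = a (1 + \<lambda>) - a\<close> cancels the
  terms of its derivative that are unbounded in \<open>\<lambda>\<close>, except for \<open>a' (1 + \<lambda>) |v|\<^sup>2\<close>.\<close>

lemma mode_energy_estimate:
  fixes v v' f g :: "real \<Rightarrow> complex" and a a' q :: "real \<Rightarrow> real"
  assumes a: "primitive T a' a" and a0: "0 < a0"
    and a_bounds: "\<And>t. t \<in> {0..T} \<Longrightarrow> a0 \<le> a t \<and> a t \<le> A"
    and a'_bound: "AE t in lebesgue_on {0..T}. \<bar>a' t\<bar> \<le> A'"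
    and q_bound: "AE t in lebesgue_on {0..T}. \<bar>q t\<bar> \<le> Q"
    and v: "primitive T v' v" and v': "primitive T g v'"
    and g: "AE t in lebesgue_on {0..T}. g t = f t - of_real (a t * l + q t) * v t"
    and f: "(\<lambda>t. (cmod (f t))\<^sup>2) absolutely_integrable_on {0..T}"
    and l: "0 \<le> l" and nn: "0 \<le> A'" "0 \<le> Q" and t: "t \<in> {0..T}"
  shows "min a0 1 * ((1 + l) * (cmod (v t))\<^sup>2 + (cmod (v' t))\<^sup>2)
    \<le> exp (inverse (min a0 1) * (1 + A' + Q + A) * t) *
       (a 0 * (1 + l) * (cmod (v 0))\<^sup>2 + (cmod (v' 0))\<^sup>2 + integral {0..t} (\<lambda>t. (cmod (f t))\<^sup>2))"
proof -
  let ?c = "min a0 1"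
  let ?K = "inverse ?c * (1 + A' + Q + A)"
  have T: "0 \<le> T" using t by auto
  have A0: "0 \<le> A" using a_bounds[OF t] a0 by linarith
  have c: "0 < ?c" using a0 by simp
  define E where "E t = (1 + l) * (a t * (v t \<bullet> v t)) + v' t \<bullet> v' t" for t
  define E' where "E' t = (1 + l) * (a' t * (v t \<bullet> v t) + a t * (v' t \<bullet> v t + v t \<bullet> v' t))
      + (g t \<bullet> v' t + v' t \<bullet> g t)" for t
  have E: "primitive T E' E"
    unfolding E_def[abs_def] E'_def[abs_def]
    by (intro primitive_add primitive_cmult primitive_bilinear[OF bounded_bilinear_mult]
        primitive_bilinear[OF bounded_bilinear_inner] a v v' T)
  have low: "?c * ((1 + l) * (v t \<bullet> v t) + v' t \<bullet> v' t) \<le> E t" if "t \<in> {0..T}" for t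
  proof -
    have "?c * ((1 + l) * (v t \<bullet> v t)) \<le> a t * ((1 + l) * (v t \<bullet> v t))"
      using a_bounds[OF that] l by (intro mult_right_mono) auto
    moreover have "?c * (v' t \<bullet> v' t) \<le> 1 * (v' t \<bullet> v' t)" by (intro mult_right_mono) auto
    ultimately show ?thesis unfolding E_def by (simp add: algebra_simps)
  qed
  have "AE t in lebesgue_on {0..T}. t \<in> {0..T}" by (rule AE_I2) simp
  with a'_bound q_bound g have le: "AE t in lebesgue_on {0..T}. E' t \<le> ?K * E t + (cmod (f t))\<^sup>2"
  proof eventually_elim
    fix t assume A': "\<bar>a' t\<bar> \<le> A'" and Q: "\<bar>q t\<bar> \<le> Q"
      and g: "g t = f t - of_real (a t * l + q t) * v t" and t: "t \<in> {0..T}"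
    define x where "x = v t \<bullet> v t"
    define y where "y = v' t \<bullet> v' t"
    define X where "X = (1 + l) * x"
    have x0: "0 \<le> x" "0 \<le> y" by (auto simp: x_def y_def)
    have xX: "x \<le> X" unfolding X_def using x0 l by (simp add: algebra_simps)
    have X0: "0 \<le> X" using x0 xX by linarith
    have scal: "2 * \<bar>z \<bullet> w\<bar> \<le> z \<bullet> z + w \<bullet> w" for z w :: complex
    proof -
      have "\<bar>z \<bullet> w\<bar> \<le> norm z * norm w" by (rule Cauchy_Schwarz_ineq2)
      moreover have "2 * (norm z * norm w) \<le> (norm z)\<^sup>2 + (norm w)\<^sup>2"
        using sum_squares_bound[of "norm z" "norm w"] by (simp add: mult.assoc)
      ultimately show ?thesis by (simp add: power2_norm_eq_inner)
    qed
    have gv: "g t = f t - (a t * l + q t) *\<^sub>R v t" unfolding g by (simp add: scaleR_conv_of_real)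
    have "E' t = a' t * X + 2 * (a t - q t) * (v t \<bullet> v' t) + 2 * (f t \<bullet> v' t)"
      unfolding E'_def gv X_def x_def
      by (simp add: inner_diff_left inner_diff_right inner_commute[of "v' t"] algebra_simps)
    also have "a' t * X \<le> A' * X"
      using A' X0 by (intro mult_right_mono) auto
    also have "2 * (a t - q t) * (v t \<bullet> v' t) \<le> (A + Q) * (x + y)"
    proof -
      have "2 * (a t - q t) * (v t \<bullet> v' t) \<le> \<bar>2 * (a t - q t) * (v t \<bullet> v' t)\<bar>"
        by (rule abs_ge_self)
      also have "\<dots> = \<bar>a t - q t\<bar> * (2 * \<bar>v t \<bullet> v' t\<bar>)"
        unfolding abs_mult by simp
      also have "\<dots> \<le> (A + Q) * (x + y)"
      proof (rule mult_mono)
        show "\<bar>a t - q t\<bar> \<le> A + Q" using a_bounds[OF t] a0 Q by (simp add: abs_le_iff)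
        show "2 * \<bar>v t \<bullet> v' t\<bar> \<le> x + y" unfolding x_def y_def by (rule scal)
      qed (use A0 nn in auto)
      finally show ?thesis .
    qed
    also have "2 * (f t \<bullet> v' t) \<le> (cmod (f t))\<^sup>2 + y"
      using scal[of "f t" "v' t"] by (simp add: y_def power2_norm_eq_inner)
    finally have "E' t \<le> A' * X + (A + Q) * (x + y) + ((cmod (f t))\<^sup>2 + y)" by simp
    \<comment> \<open>The coefficients of X add up to at most A' + A + Q and those of y to A + Q +
      1; the rate is their common bound.\<close>
    also have "\<dots> \<le> (1 + A' + Q + A) * (X + y) + (cmod (f t))\<^sup>2"
    proof -
      have "(A + Q) * x \<le> (A + Q) * X" using xX A0 nn by (intro mult_left_mono) auto
      moreover have "0 \<le> X + A' * y" using X0 x0 nn by simp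
      ultimately show ?thesis by (simp add: algebra_simps)
    qed
    \<comment> \<open>Here the factor \<open>inverse ?c\<close> enters the rate: E is only known to
      dominate c (X + y).\<close>
    also have "(1 + A' + Q + A) * (X + y) \<le> ?K * E t"
    proof -
      have "(1 + A' + Q + A) * (X + y) = ?K * (?c * (X + y))" using c by (simp add: field_simps)
      also have "\<dots> \<le> ?K * E t"
        using low[OF t] c A0 nn unfolding X_def x_def y_def by (intro mult_left_mono) auto
      finally show ?thesis .
    qed
    finally show "E' t \<le> ?K * E t + (cmod (f t))\<^sup>2" by simp
  qed
  have "E t \<le> exp (?K * t) * (E 0 + integral {0..t} (\<lambda>t. (cmod (f t))\<^sup>2))"
    by (rule energy_growth[OF E f le _ _ t]) (use c A0 nn in auto)
  then show ?thesis
    using low[OF t] unfolding E_def by (simp add: power2_norm_eq_inner[symmetric] mult_ac)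
qed

subsection \<open>Smooth bump functions\<close>

text \<open>Smoothness is reached through finite orders: by \<open>diff_upto_Suc\<close>, order n +
  1 of f reduces to order n of its derivative, which is what the inductions for products and
  compositions run on.\<close>

definition diff_upto :: "nat \<Rightarrow> (real \<Rightarrow> real) \<Rightarrow> bool" where
  "diff_upto n f \<longleftrightarrow> (\<forall>k<n. \<forall>x. (deriv ^^ k) f field_differentiable at x)"

lemma diff_upto_0 [simp]: "diff_upto 0 f"
  by (simp add: diff_upto_def)

lemma diff_upto_Suc:
  "diff_upto (Suc n) f \<longleftrightarrow> (\<forall>x. f field_differentiable at x) \<and> diff_upto n (deriv f)"
  unfolding diff_upto_def by (auto simp: less_Suc_eq_0_disj funpow_Suc_right simp del: funpow.simps)

lemma diff_upto_mono: "diff_upto n f \<Longrightarrow> m \<le> n \<Longrightarrow> diff_upto m f"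
  unfolding diff_upto_def by auto

lemma diff_upto_add: "diff_upto n f \<Longrightarrow> diff_upto n g \<Longrightarrow> diff_upto n (\<lambda>x. f x + g x)"
proof (induction n arbitrary: f g)
  case (Suc n)
  have "deriv (\<lambda>x. f x + g x) = (\<lambda>x. deriv f x + deriv g x)"
    using Suc.prems by (auto simp: diff_upto_Suc)
  then show ?case using Suc by (auto simp: diff_upto_Suc intro: field_differentiable_add)
qed simp

lemma diff_upto_mult: "diff_upto n f \<Longrightarrow> diff_upto n g \<Longrightarrow> diff_upto n (\<lambda>x. f x * g x)"
proof (induction n arbitrary: f g)
  case (Suc n)
  have "deriv (\<lambda>x. f x * g x) = (\<lambda>x. f x * deriv g x + deriv f x * g x)"
    using Suc.prems by (auto simp: diff_upto_Suc)
  moreover have "diff_upto n f" "diff_upto n g"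
    using Suc.prems diff_upto_mono by (meson le_SucI order_refl)+
  ultimately show ?case
    using Suc by (auto simp: diff_upto_Suc intro: field_differentiable_mult diff_upto_add)
qed simp

lemma diff_upto_affine: "diff_upto n f \<Longrightarrow> diff_upto n (\<lambda>x. f (c * x + d))"
proof (induction n arbitrary: f)
  case (Suc n)
  have D: "((\<lambda>x. f (c * x + d)) has_field_derivative deriv f (c * x + d) * c) (at x)" for x
  proof -
    have "(f has_field_derivative deriv f (c * x + d)) (at (c * x + d))"
      using Suc.prems by (simp add: diff_upto_Suc field_differentiable_derivI)
    moreover have "((\<lambda>x. c * x + d) has_field_derivative c) (at x)"
      by (auto intro!: derivative_eq_intros)
    ultimately show ?thesis by (rule DERIV_chain2)
  qed
  have const: "diff_upto m (\<lambda>x. k)" for m and k :: real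
    by (induction m arbitrary: k) (auto simp: diff_upto_Suc)
  have "deriv (\<lambda>x. f (c * x + d)) = (\<lambda>x. deriv f (c * x + d) * c)"
    using D DERIV_imp_deriv by blast
  moreover have "diff_upto n (\<lambda>x. deriv f (c * x + d) * c)"
    by (rule diff_upto_mult[OF Suc.IH const]) (use Suc.prems in \<open>simp add: diff_upto_Suc\<close>)
  ultimately show ?case
    using D by (auto simp: diff_upto_Suc field_differentiable_def)
qed simp

text \<open>The polynomial is carried along because the family is closed under differentiation: with
  z = 1 / x, the derivative of p(z) e^(-z) in x is z^2 (p(z) - p'(z)) e^(-z).\<close>

definition flat_exp :: "real poly \<Rightarrow> real \<Rightarrow> real" where
  "flat_exp p x = (if x > 0 then poly p (inverse x) * exp (- inverse x) else 0)"

lemma poly_times_exp_minus_tendsto_0: "((\<lambda>z. poly p z * exp (- z)) \<longlongrightarrow> (0::real)) at_top"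
proof -
  have "((\<lambda>z. \<Sum>i\<le>degree p. coeff p i * (z ^ i / exp z)) \<longlongrightarrow> (\<Sum>i\<le>degree p. coeff p i * 0)) at_top"
    by (intro tendsto_intros tendsto_power_div_exp_0)
  moreover have "(\<Sum>i\<le>degree p. coeff p i * (z ^ i / exp z)) = poly p z * exp (- z)" for z
    by (simp add: poly_altdef exp_minus sum_distrib_right divide_inverse mult.assoc)
  ultimately show ?thesis by simp
qed

text \<open>Away from 0 this is the chain rule. At 0 the difference quotient vanishes on the left,
  and on the right it is z p(z) e^(-z) with z = 1 / x, which tends to 0.\<close>

lemma flat_exp_deriv:
  "(flat_exp p has_field_derivative flat_exp ([:0, 0, 1:] * (p - pderiv p)) x) (at x)"
proof -
  consider "x < 0" | "x = 0" | "x > 0" by linarith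
  then show ?thesis
  proof cases
    case 1
    then have "\<forall>\<^sub>F y in nhds x. flat_exp p y = 0"
      by (auto simp: flat_exp_def eventually_nhds intro!: exI[of _ "{..<0}"])
    then show ?thesis
      using 1 by (subst DERIV_cong_ev[OF refl _ refl]) (auto simp: flat_exp_def)
  next
    case 3
    have "\<forall>\<^sub>F y in nhds x. flat_exp p y = poly p (inverse y) * exp (- inverse y)"
      using 3 by (auto simp: flat_exp_def eventually_nhds intro!: exI[of _ "{0<..}"])
    moreover have "((\<lambda>y. poly p (inverse y) * exp (- inverse y)) has_field_derivative
        flat_exp ([:0, 0, 1:] * (p - pderiv p)) x) (at x)"
      using 3 by (auto intro!: derivative_eq_intros DERIV_chain'[OF _ poly_DERIV]
          simp: flat_exp_def field_simps power2_eq_square)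
    ultimately show ?thesis by (subst DERIV_cong_ev[OF refl _ refl])
  next
    case 2
    have "((\<lambda>y. flat_exp p y / y) \<longlongrightarrow> 0) (at 0)"
    proof (rule filterlim_split_at_real)
      show "((\<lambda>y. flat_exp p y / y) \<longlongrightarrow> 0) (at_left 0)"
        by (rule tendsto_eventually)
           (auto simp: flat_exp_def eventually_at_filter)
      have "((\<lambda>y. poly ([:0, 1:] * p) (inverse y) * exp (- inverse y)) \<longlongrightarrow> 0) (at_right 0)"
        using filterlim_compose[OF poly_times_exp_minus_tendsto_0 filterlim_inverse_at_top_right] .
      then show "((\<lambda>y. flat_exp p y / y) \<longlongrightarrow> 0) (at_right 0)"
        by (rule Lim_transform_eventually)
           (auto simp: flat_exp_def eventually_at_filter divide_inverse)
    qed
    then show ?thesis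
      using 2 by (simp add: has_field_derivative_iff flat_exp_def)
  qed
qed

lemma diff_upto_flat_exp: "diff_upto n (flat_exp p)"
proof (induction n arbitrary: p)
  case (Suc n)
  have "deriv (flat_exp p) = flat_exp ([:0, 0, 1:] * (p - pderiv p))"
    using flat_exp_deriv DERIV_imp_deriv by blast
  then show ?case
    using Suc flat_exp_deriv by (auto simp: diff_upto_Suc field_differentiable_def)
qed simp

definition bump :: "real \<Rightarrow> real \<Rightarrow> real" where
  "bump \<epsilon> x = flat_exp 1 x * flat_exp 1 (- 1 * x + \<epsilon>)"

lemma bump_smooth: "diff_upto n (bump \<epsilon>)"
  unfolding bump_def[abs_def] by (intro diff_upto_mult diff_upto_affine diff_upto_flat_exp)

lemma bump_nonneg: "0 \<le> bump \<epsilon> x"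
  and bump_pos: "0 < x \<Longrightarrow> x < \<epsilon> \<Longrightarrow> 0 < bump \<epsilon> x"
  and bump_zero: "x \<le> 0 \<or> \<epsilon> \<le> x \<Longrightarrow> bump \<epsilon> x = 0"
  by (auto simp: bump_def flat_exp_def)

lemma bump_continuous: "continuous_on S (bump \<epsilon>)"
proof -
  have "bump \<epsilon> field_differentiable at x" for x
    using bump_smooth[of 1 \<epsilon>] by (simp add: diff_upto_def)
  then show ?thesis
    by (intro continuous_at_imp_continuous_on ballI field_differentiable_imp_continuous_at)
qed

text \<open>J is a smooth step: constant outside the interval from 0 to \<epsilon>, with positive
  height. The difference of two translates of J has compact support and serves as a test
  function.\<close>

lemma bump_antiderivative:
  assumes "0 < \<epsilon>"
  obtains J where "\<And>x. (J has_field_derivative bump \<epsilon> x) (at x)" "\<And>x. x \<le> 0 \<Longrightarrow> J x = 0"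
    "\<And>x. \<epsilon> \<le> x \<Longrightarrow> J x = J \<epsilon>" "0 < J \<epsilon>"
proof -
  define J where "J x = (LBINT y=ereal 0..ereal x. bump \<epsilon> y)" for x
  have J: "(J has_field_derivative bump \<epsilon> x) (at x)" for x
  proof -
    \<comment> \<open>A compact interval with 0 and x in its interior, on which the fundamental
      theorem is applied.\<close>
    define M where "M = \<bar>x\<bar> + 1"
    have "(J has_vector_derivative bump \<epsilon> x) (at x within {-M..M})"
      unfolding J_def
      by (rule interval_integral_FTC2[where a="-M" and b=M and c=0])
         (auto simp: M_def bump_continuous)
    moreover have "at x within {-M..M} = at x"
      by (rule at_within_interior) (auto simp: M_def)
    ultimately show ?thesis by (simp add: has_real_derivative_iff_has_vector_derivative)
  qed
  have diff: "\<exists>z. a < z \<and> z < b \<and> J b - J a = (b - a) * bump \<epsilon> z" if "a < b" for a b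
    using MVT2[OF that, of J "bump \<epsilon>"] J by blast
  have J0: "J 0 = 0" by (simp add: J_def)
  show ?thesis
  proof (rule that[of J, OF J])
    show "J x = 0" if "x \<le> 0" for x
      using diff[of x 0] that J0 bump_zero by (cases "x = 0") force+
    show "J x = J \<epsilon>" if "\<epsilon> \<le> x" for x
      using diff[of \<epsilon> x] that bump_zero by (cases "x = \<epsilon>") force+
    show "0 < J \<epsilon>"
      using diff[OF assms] J0 bump_pos assms by fastforce
  qed
qed

text \<open>The translated bump has mass \<open>J \<epsilon>\<close> and lives on
  [x, x + \<epsilon>], so integrating P against it gives \<open>J \<epsilon>\<close> times P x up to
  the oscillation of P there.\<close>

lemma integral_bump_shift:
  fixes P :: "real \<Rightarrow> 'a::euclidean_space"
  assumes J: "\<And>x. (J has_field_derivative bump \<epsilon> x) (at x)" "\<And>x. x \<le> 0 \<Longrightarrow> J x = 0"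
      "\<And>x. \<epsilon> \<le> x \<Longrightarrow> J x = J \<epsilon>"
    and x: "0 \<le> x" "x + \<epsilon> \<le> T" and \<epsilon>: "0 < \<epsilon>" and P: "continuous_on {0..T} P"
    and close: "\<And>t. x \<le> t \<Longrightarrow> t \<le> x + \<epsilon> \<Longrightarrow> norm (P t - P x) \<le> \<omega>"
  shows "norm (integral {0..T} (\<lambda>t. bump \<epsilon> (t - x) *\<^sub>R P t) - J \<epsilon> *\<^sub>R P x) \<le> \<omega> * J \<epsilon>"
proof -
  have B: "((\<lambda>t. bump \<epsilon> (t - x)) has_integral J (T - x) - J (0 - x)) {0..T}"
  proof (rule fundamental_theorem_of_calculus)
    show "0 \<le> T" using x \<epsilon> by linarith
    fix t
    have "((\<lambda>t. J (t - x)) has_field_derivative bump \<epsilon> (t - x) * 1) (at t)"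
      by (rule DERIV_chain2[OF J(1)]) (auto intro!: derivative_eq_intros)
    then show "((\<lambda>t. J (t - x)) has_vector_derivative bump \<epsilon> (t - x)) (at t within {0..T})"
      by (simp add: has_real_derivative_iff_has_vector_derivative has_vector_derivative_at_within)
  qed
  then have B: "((\<lambda>t. bump \<epsilon> (t - x)) has_integral J \<epsilon>) {0..T}"
    using J(2)[of "- x"] J(3)[of "T - x"] x by simp
  have c: "continuous_on {0..T} (\<lambda>t. bump \<epsilon> (t - x))"
    by (rule continuous_on_compose2[OF bump_continuous[of UNIV]]) (auto intro!: continuous_intros)
  have "((\<lambda>t. bump \<epsilon> (t - x) *\<^sub>R P t) has_integral integral {0..T} (\<lambda>t. bump \<epsilon> (t - x) *\<^sub>R P t)) {0..T}"
    by (intro integrable_integral integrable_continuous_interval continuous_intros c P)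
  from has_integral_diff[OF this has_integral_scaleR_left[OF B, of "P x"]]
  show ?thesis
  proof (rule has_integral_norm_bound_integral_component[where k=1 and g="\<lambda>t. \<omega> * bump \<epsilon> (t - x)", simplified])
    show "((\<lambda>t. \<omega> * bump \<epsilon> (t - x)) has_integral \<omega> * J \<epsilon>) {0..T}"
      by (rule has_integral_mult_right[OF B])
    fix t assume "t \<in> {0..T}"
    show "norm (bump \<epsilon> (t - x) *\<^sub>R P t - bump \<epsilon> (t - x) *\<^sub>R P x) \<le> \<omega> * bump \<epsilon> (t - x)"
    proof (cases "x \<le> t \<and> t \<le> x + \<epsilon>")
      case True
      then show ?thesis
        using mult_right_mono[OF close[of t] bump_nonneg[of \<epsilon> "t - x"]]
        by (simp add: scaleR_diff_right[symmetric] bump_nonneg mult.commute)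
    next
      case False
      then have "bump \<epsilon> (t - x) = 0" by (intro bump_zero) auto
      then show ?thesis by simp
    qed
  qed
qed

text \<open>The test function is the step at x minus the step at y. Its derivative is a difference
  of two bumps of equal mass, so the hypothesis equates the averages of P just to the right of x and
  of y.\<close>

lemma du_bois_reymond_interior:
  fixes P :: "real \<Rightarrow> 'a::euclidean_space"
  assumes P: "continuous_on {0..T} P"
    and weak: "\<And>\<psi>. test_function T \<psi> \<Longrightarrow> integral {0..T} (\<lambda>t. deriv \<psi> t *\<^sub>R P t) = 0"
    and xy: "0 < x" "x < y" "y < T"
  shows "P x = P y"
proof -
  have "norm (P x - P y) \<le> 2 * \<omega>" if om: "0 < \<omega>" for \<omega>
  proof -
    obtain d where d: "0 < d" "\<And>s t. s \<in> {0..T} \<Longrightarrow> t \<in> {0..T} \<Longrightarrow> dist t s < d \<Longrightarrow> dist (P t) (P s) < \<omega>"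
      using compact_uniformly_continuous[OF P] om unfolding uniformly_continuous_on_def by force
    \<comment> \<open>Below d for the oscillation of P, and small enough that the support of the
      test function ends before T.\<close>
    define \<epsilon> where "\<epsilon> = min (d / 2) ((T - y) / 2)"
    have e: "0 < \<epsilon>" "\<epsilon> < d" "y + \<epsilon> < T" using d(1) xy by (auto simp: \<epsilon>_def min_def field_simps)
    obtain J where J: "\<And>x. (J has_field_derivative bump \<epsilon> x) (at x)" "\<And>x. x \<le> 0 \<Longrightarrow> J x = 0"
      "\<And>x. \<epsilon> \<le> x \<Longrightarrow> J x = J \<epsilon>" "0 < J \<epsilon>"
      using bump_antiderivative[OF e(1)] by blast
    define \<psi> where "\<psi> t = J (t - x) - J (t - y)" for t
    have D: "(\<psi> has_field_derivative bump \<epsilon> (t - x) - bump \<epsilon> (t - y)) (at t)" for t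
    proof -
      have "((\<lambda>t. J (t - z)) has_field_derivative bump \<epsilon> (t - z) * 1) (at t)" for z
        by (rule DERIV_chain2[OF J(1)]) (auto intro!: derivative_eq_intros)
      from DERIV_diff[OF this[of x] this[of y]] show ?thesis unfolding \<psi>_def by simp
    qed
    then have d\<psi>: "deriv \<psi> = (\<lambda>t. bump \<epsilon> (t - x) - bump \<epsilon> (t - y))"
      using DERIV_imp_deriv by blast
    have "diff_upto n (\<lambda>t. bump \<epsilon> (t - x) + bump \<epsilon> (t - y) * (- 1))" for n
    proof -
      have "diff_upto m (\<lambda>x. k)" for m and k :: real
        by (induction m arbitrary: k) (auto simp: diff_upto_Suc)
      moreover have "diff_upto n (\<lambda>t. bump \<epsilon> (t - z))" for z
        using diff_upto_affine[OF bump_smooth, of n \<epsilon> 1 "- z"] by simp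
      ultimately show ?thesis by (intro diff_upto_add diff_upto_mult)
    qed
    then have "diff_upto (Suc n) \<psi>" for n
      unfolding diff_upto_Suc d\<psi> using D by (auto simp: field_differentiable_def)
    then have "(deriv ^^ n) \<psi> field_differentiable at t" for n t
      unfolding diff_upto_def by blast
    moreover have "\<psi> t = 0" if "t \<notin> {x..y + \<epsilon>}" for t
      using that J(2)[of "t - x"] J(2)[of "t - y"] J(3)[of "t - x"] J(3)[of "t - y"] xy
      by (cases "t < x") (auto simp: \<psi>_def)
    ultimately have "test_function T \<psi>"
      unfolding test_function_def using xy e by blast
    then have 0: "integral {0..T} (\<lambda>t. (bump \<epsilon> (t - x) - bump \<epsilon> (t - y)) *\<^sub>R P t) = 0"
      using weak[of \<psi>] by (simp add: d\<psi>)
    have c: "continuous_on {0..T} (\<lambda>t. bump \<epsilon> (t - z))" for z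
      by (rule continuous_on_compose2[OF bump_continuous[of UNIV]]) (auto intro!: continuous_intros)
    let ?I = "\<lambda>z. integral {0..T} (\<lambda>t. bump \<epsilon> (t - z) *\<^sub>R P t)"
    have "(\<lambda>t. bump \<epsilon> (t - z) *\<^sub>R P t) integrable_on {0..T}" for z
      by (intro integrable_continuous_interval continuous_intros c P)
    then have eq: "?I x = ?I y"
      using 0 by (simp add: scaleR_diff_left Henstock_Kurzweil_Integration.integral_diff)
    have b: "norm (?I z - J \<epsilon> *\<^sub>R P z) \<le> \<omega> * J \<epsilon>" if "0 < z" "z + \<epsilon> \<le> T" for z
    proof (rule integral_bump_shift[OF J(1-3) _ _ e(1) P])
      show "norm (P t - P z) \<le> \<omega>" if "z \<le> t" "t \<le> z + \<epsilon>" for t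
        using d(2)[of z t] that \<open>0 < z\<close> \<open>z + \<epsilon> \<le> T\<close> e by (auto simp: dist_norm less_imp_le)
    qed (use that in auto)
    have "J \<epsilon> * norm (P x - P y) = norm ((?I y - J \<epsilon> *\<^sub>R P y) - (?I x - J \<epsilon> *\<^sub>R P x))"
      using J(4) by (simp add: eq scaleR_diff_right[symmetric])
    also have "\<dots> \<le> \<omega> * J \<epsilon> + \<omega> * J \<epsilon>"
      by (rule order_trans[OF norm_triangle_ineq4 add_mono[OF b b]]) (use xy e in auto)
    finally show ?thesis using J(4) by (simp add: mult.commute algebra_simps)
  qed
  from this[of "\<omega> / 2" for \<omega>] have "norm (P x - P y) \<le> \<omega>" if "0 < \<omega>" for \<omega>
    using that by (metis field_sum_of_halves half_gt_zero_iff mult_2)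
  then have "norm (P x - P y) \<le> 0" by (meson dense_ge)
  then show ?thesis by simp
qed

text \<open>Test functions see only the open interval; continuity extends the constancy to the end
  points.\<close>

lemma du_bois_reymond:
  fixes P :: "real \<Rightarrow> 'a::euclidean_space"
  assumes T: "0 < T" and P: "continuous_on {0..T} P"
    and weak: "\<And>\<psi>. test_function T \<psi> \<Longrightarrow> integral {0..T} (\<lambda>t. deriv \<psi> t *\<^sub>R P t) = 0"
    and t: "t \<in> {0..T}"
  shows "P t = P 0"
proof -
  have eq: "P x = P (T / 2)" if "x \<in> {0<..<T}" for x
  proof (cases x "T / 2" rule: linorder_cases)
    case less
    then show ?thesis by (intro du_bois_reymond_interior[OF P weak]) (use that T in simp_all)
  next
    case greater
    then show ?thesis by (intro du_bois_reymond_interior[OF P weak, symmetric]) (use that T in simp_all)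
  qed (simp only:)
  have cl: "closure {0<..<T} = {0..T}" using T by simp
  have "P x = P (T / 2)" if "x \<in> {0..T}" for x
  proof (rule continuous_constant_on_closure[of "{0<..<T}" P "P (T / 2)" x])
    show "continuous_on (closure {0<..<T}) P" unfolding cl by (rule P)
    show "x \<in> closure {0<..<T}" unfolding cl by (rule that)
  qed (rule eq)
  from this[OF t] this[of 0] show ?thesis using T by simp
qed

section \<open>Test functions and integration by parts\<close>

lemma test_function_deriv:
  assumes "test_function T \<psi>"
  shows "test_function T (deriv \<psi>)"
proof -
  obtain c d where cd: "0 < c" "d < T" "\<And>x. x \<notin> {c..d} \<Longrightarrow> \<psi> x = 0"
    using assms unfolding test_function_def by blast
  have "(deriv ^^ n) (deriv \<psi>) field_differentiable at x" for n x
  proof -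
    have "(deriv ^^ Suc n) \<psi> field_differentiable at x"
      using assms unfolding test_function_def by blast
    then show ?thesis by (simp only: funpow_Suc_right o_apply)
  qed
  moreover have "deriv \<psi> x = 0" if "x \<notin> {c..d}" for x
  proof -
    have "open (- {c..d})" by (simp add: open_Compl)
    then have "\<forall>\<^sub>F y in nhds x. \<psi> y = 0"
      unfolding eventually_nhds using that cd(3) by (intro exI[of _ "- {c..d}"]) auto
    then have "(\<psi> has_field_derivative 0) (at x)"
      by (subst DERIV_cong_ev[OF refl _ refl]) auto
    then show ?thesis by (rule DERIV_imp_deriv)
  qed
  ultimately show ?thesis unfolding test_function_def using cd by blast
qed

lemma test_function_has_derivative:
  "test_function T \<psi> \<Longrightarrow> (\<psi> has_field_derivative deriv \<psi> x) (at x)"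
  unfolding test_function_def by (metis field_differentiable_derivI funpow_0)

lemma test_function_continuous: "test_function T \<psi> \<Longrightarrow> continuous_on S \<psi>"
  using test_function_has_derivative by (meson DERIV_continuous continuous_at_imp_continuous_on)

lemma test_function_boundary:
  assumes "test_function T \<psi>"
  shows "\<psi> 0 = 0" "\<psi> T = 0"
  using assms unfolding test_function_def by force+

lemma test_function_primitive:
  assumes "test_function T \<psi>"
  shows "primitive T (deriv \<psi>) \<psi>"
proof (rule primitive_deriv)
  show "(\<psi> has_vector_derivative deriv \<psi> t) (at t within {0..T})" for t
    using test_function_has_derivative[OF assms, of t]
    by (simp add: has_real_derivative_iff_has_vector_derivative has_vector_derivative_at_within)
qed (intro continuous_absolutely_integrable test_function_continuous[OF test_function_deriv[OF assms]])

lemma test_function_by_parts: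
  fixes G :: "real \<Rightarrow> 'a::euclidean_space"
  assumes \<psi>: "test_function T \<psi>" and G: "primitive T g G" and T: "0 \<le> T"
  shows "integral {0..T} (\<lambda>t. \<psi> t *\<^sub>R g t) = - integral {0..T} (\<lambda>t. deriv \<psi> t *\<^sub>R G t)"
    "(\<lambda>t. \<psi> t *\<^sub>R g t) absolutely_integrable_on {0..T}"
    "(\<lambda>t. deriv \<psi> t *\<^sub>R G t) absolutely_integrable_on {0..T}"
proof -
  have p: "primitive T (\<lambda>t. deriv \<psi> t *\<^sub>R G t + \<psi> t *\<^sub>R g t) (\<lambda>t. \<psi> t *\<^sub>R G t)"
    by (rule primitive_bilinear[OF bounded_bilinear_scaleR test_function_primitive[OF \<psi>] G T])
  show 1: "(\<lambda>t. \<psi> t *\<^sub>R g t) absolutely_integrable_on {0..T}"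
    by (rule absolutely_integrable_bilinear_continuous[OF bounded_bilinear_scaleR
          test_function_continuous[OF \<psi>] primitiveD(1)[OF G]])
  show 2: "(\<lambda>t. deriv \<psi> t *\<^sub>R G t) absolutely_integrable_on {0..T}"
    by (intro continuous_absolutely_integrable continuous_intros primitive_continuous[OF G]
        test_function_continuous[OF test_function_deriv[OF \<psi>]])
  have "integral {0..T} (\<lambda>t. deriv \<psi> t *\<^sub>R G t + \<psi> t *\<^sub>R g t) = 0"
    using primitiveD(2)[OF p, of T] T test_function_boundary[OF \<psi>] by simp
  then show "integral {0..T} (\<lambda>t. \<psi> t *\<^sub>R g t) = - integral {0..T} (\<lambda>t. deriv \<psi> t *\<^sub>R G t)"
    using set_lebesgue_integral_eq_integral(1)[OF 1] set_lebesgue_integral_eq_integral(1)[OF 2]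
    by (subst (asm) Henstock_Kurzweil_Integration.integral_add) (auto simp: add_eq_0_iff)
qed

text \<open>After integration by parts on both sides, v' minus the indefinite integral of g is
  annihilated by the derivatives of all test functions. Being continuous, it is constant by the
  lemma of du Bois-Reymond.\<close>

lemma weak_second_derivative:
  fixes v v' g :: "real \<Rightarrow> 'a::euclidean_space"
  assumes T: "0 < T" and v: "primitive T v' v" and v': "continuous_on {0..T} v'"
    and g: "g absolutely_integrable_on {0..T}"
    and weak: "\<And>\<psi>. test_function T \<psi> \<Longrightarrow>
      integral {0..T} (\<lambda>t. deriv (deriv \<psi>) t *\<^sub>R v t) = integral {0..T} (\<lambda>t. \<psi> t *\<^sub>R g t)"
  shows "primitive T g v'"
proof -
  define G where "G t = 0 + integral {0..t} g" for t
  have G: "primitive T g G" unfolding G_def[abs_def] by (rule primitive_integral[OF g])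
  have eq: "v' t - G t = v' 0 - G 0" if "t \<in> {0..T}" for t
  proof (rule du_bois_reymond[OF T _ _ that, of "\<lambda>t. v' t - G t"])
    show "continuous_on {0..T} (\<lambda>t. v' t - G t)"
      by (intro continuous_intros v' primitive_continuous[OF G])
    fix \<psi> assume \<psi>: "test_function T \<psi>"
    note \<psi>' = test_function_deriv[OF \<psi>]
    have T0: "0 \<le> T" using T by simp
    have "integral {0..T} (\<lambda>t. deriv \<psi> t *\<^sub>R v' t) = - integral {0..T} (\<lambda>t. \<psi> t *\<^sub>R g t)"
      using test_function_by_parts(1)[OF \<psi>' v T0] weak[OF \<psi>] by simp
    also have "\<dots> = integral {0..T} (\<lambda>t. deriv \<psi> t *\<^sub>R G t)"
      using test_function_by_parts(1)[OF \<psi> G T0] by simp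
    finally show "integral {0..T} (\<lambda>t. deriv \<psi> t *\<^sub>R (v' t - G t)) = 0"
      using set_lebesgue_integral_eq_integral(1)[OF test_function_by_parts(2)[OF \<psi>' v T0]]
        set_lebesgue_integral_eq_integral(1)[OF test_function_by_parts(3)[OF \<psi> G T0]]
      by (simp add: scaleR_diff_right Henstock_Kurzweil_Integration.integral_diff)
  qed
  then show ?thesis
    unfolding primitive_def
  proof (intro conjI ballI g)
    show "v' t = v' 0 + integral {0..t} g" if "t \<in> {0..T}" for t
      using eq[OF that] by (simp add: G_def algebra_simps)
  qed
qed

subsection \<open>Existence for a single mode\<close>

lemma exp_weighted_integral_bound:
  fixes u :: "real \<Rightarrow> complex"
  assumes "u integrable_on {0..s}" "0 \<le> s" "0 < K" "0 \<le> C"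
    and "\<And>r. r \<in> {0..s} \<Longrightarrow> cmod (u r) \<le> C * exp (K * r)"
  shows "cmod (integral {0..s} u) \<le> C / K * exp (K * s)"
proof -
  have "((\<lambda>r. C * exp (K * r)) has_integral (C / K * exp (K * s) - C / K * exp (K * 0))) {0..s}"
    by (rule fundamental_theorem_of_calculus)
       (use assms(2,3) in \<open>auto intro!: derivative_eq_intros simp: has_real_derivative_iff_has_vector_derivative[symmetric]\<close>)
  from has_integral_norm_bound_integral_component[OF integrable_integral[OF assms(1)] this, of 1]
  have "cmod (integral {0..s} u) \<le> C / K * exp (K * s) - C / K" using assms(5) by simp
  also have "\<dots> \<le> C / K * exp (K * s)" using assms(3,4) by simp
  finally show ?thesis .
qed

text \<open>A fixed point of the twice integrated equation. The unknown is z = e^(-K t) v rather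
  than v, which amounts to a weighted supremum norm and makes the map a contraction on the whole
  interval at once.\<close>

lemma mode_solution_exists:
  fixes b :: "real \<Rightarrow> real" and f :: "real \<Rightarrow> complex" and v0 v1 :: complex
  assumes T: "0 \<le> T" and bm: "b \<in> borel_measurable (lebesgue_on {0..T})"
    and bM: "\<And>t. t \<in> {0..T} \<Longrightarrow> \<bar>b t\<bar> \<le> M" and f: "f absolutely_integrable_on {0..T}"
  obtains v v' where "primitive T v' v" "primitive T (\<lambda>t. f t - of_real (b t) * v t) v'"
    "v 0 = v0" "v' 0 = v1"
proof -
  have M0: "0 \<le> M" using bM[of 0] T by simp
  \<comment> \<open>Each integration of e^(K t) gains a factor 1 / K, so the map contracts by M /
    K^2. This choice makes that at most 1 / 2 and keeps K positive when M = 0.\<close>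
  define K where "K = 2 * M + 1"
  have K: "0 < K" "M / K / K \<le> 1 / 2"
  proof -
    show K0: "0 < K" using M0 by (simp add: K_def)
    have "M * 2 \<le> K * K" unfolding K_def using M0 by (simp add: algebra_simps)
    then show "M / K / K \<le> 1 / 2" using K0 by (simp add: field_simps)
  qed
  \<comment> \<open>Clamping time to {0..T} extends functions to the real line by constants, so that
    the complete space of bounded continuous functions on the line can carry the fixed point
    argument.\<close>
  define \<tau> where "\<tau> t = max 0 (min T t)" for t
  have \<tau>: "\<tau> t \<in> {0..T}" for t using T by (auto simp: \<tau>_def)
  have \<tau>_id: "\<tau> t = t" if "t \<in> {0..T}" for t using that by (auto simp: \<tau>_def)
  define g where "g z t = f t - of_real (b t) * (of_real (exp (K * t)) * apply_bcontfun z t)" for z t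
  define A where "A z t = v1 + integral {0..t} (g z)" for z t
  define B where "B z t = v0 + integral {0..t} (A z)" for z t
  have bw: "(\<lambda>t. of_real (b t) * w t) absolutely_integrable_on {0..T}"
    if "continuous_on {0..T} w" for w :: "real \<Rightarrow> complex"
  proof -
    have bi: "bilinear (\<lambda>x (y::complex). x *\<^sub>R y)"
      using bilinear_conv_bounded_bilinear bounded_bilinear_scaleR by blast
    have "bounded (b ` {0..T})" using bM by (auto simp: bounded_iff intro!: exI[of _ M])
    from absolutely_integrable_bounded_measurable_product[OF bi bm _ this continuous_absolutely_integrable[OF that]]
    show ?thesis by (simp add: scaleR_conv_of_real)
  qed
  have cz: "continuous_on {0..T} (\<lambda>t. of_real (exp (K * t)) * apply_bcontfun z t :: complex)" for z
    by (intro continuous_intros continuous_on_apply_bcontfun)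
  have gi: "g z absolutely_integrable_on {0..T}" for z
    unfolding g_def[abs_def] by (intro set_integral_diff f bw cz)
  have pA: "primitive T (g z) (A z)" for z
    unfolding A_def[abs_def] by (rule primitive_integral[OF gi])
  have pB: "primitive T (A z) (B z)" for z
    unfolding B_def[abs_def]
    by (rule primitive_integral[OF continuous_absolutely_integrable[OF primitive_continuous[OF pA]]])
  define \<Psi> where "\<Psi> z = Bcontfun (\<lambda>t. of_real (exp (- K * \<tau> t)) * B z (\<tau> t))" for z
  have \<Psi>: "apply_bcontfun (\<Psi> z) t = of_real (exp (- K * \<tau> t)) * B z (\<tau> t)" for z t
  proof -
    let ?h = "\<lambda>t. of_real (exp (- K * t)) * B z t"
    have c: "continuous_on {0..T} ?h"
      by (intro continuous_intros primitive_continuous[OF pB])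
    have "continuous_on UNIV (\<lambda>t. ?h (\<tau> t))"
      by (rule continuous_on_compose2[OF c]) (use \<tau> in \<open>auto simp: \<tau>_def intro!: continuous_intros\<close>)
    moreover have "bounded (range (\<lambda>t. ?h (\<tau> t)))"
      by (rule bounded_subset[OF compact_imp_bounded[OF compact_continuous_image[OF c compact_Icc]]])
         (use \<tau> in auto)
    ultimately show ?thesis
      unfolding \<Psi>_def by (subst Bcontfun_inverse) (auto simp: bcontfun_def)
  qed
  have contr: "dist (\<Psi> z) (\<Psi> w) \<le> 1 / 2 * dist z w" for z w
  proof (rule dist_bound)
    fix t
    have D: "cmod (apply_bcontfun z r - apply_bcontfun w r) \<le> dist z w" for r
      using dist_bounded[of z r w] by (simp add: dist_norm)
    have A: "cmod (A z s - A w s) \<le> M * dist z w / K * exp (K * s)" if s: "s \<in> {0..T}" for s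
    proof -
      have gs: "g z integrable_on {0..s}" for z
        using primitive_integrable_sub[OF pA, of 0 s z] s set_lebesgue_integral_eq_integral(1) by auto
      have "A z s - A w s = integral {0..s} (\<lambda>r. g z r - g w r)"
        unfolding A_def using gs by (simp add: Henstock_Kurzweil_Integration.integral_diff)
      also have "cmod \<dots> \<le> M * dist z w / K * exp (K * s)"
      proof (rule exp_weighted_integral_bound)
        show "(\<lambda>r. g z r - g w r) integrable_on {0..s}" by (intro integrable_diff gs)
        fix r assume r: "r \<in> {0..s}"
        have "g z r - g w r = - of_real (b r * exp (K * r)) * (apply_bcontfun z r - apply_bcontfun w r)"
          by (simp add: g_def algebra_simps)
        then have "cmod (g z r - g w r) = \<bar>b r\<bar> * exp (K * r) * cmod (apply_bcontfun z r - apply_bcontfun w r)"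
          by (simp add: norm_mult abs_mult)
        also have "\<dots> \<le> M * exp (K * r) * dist z w"
          using r s by (intro mult_mono bM D) (auto simp: M0)
        finally show "cmod (g z r - g w r) \<le> M * dist z w * exp (K * r)" by (simp add: mult_ac)
      qed (use s K M0 in auto)
      finally show ?thesis .
    qed
    have "cmod (B z (\<tau> t) - B w (\<tau> t)) \<le> M * dist z w / K / K * exp (K * \<tau> t)"
    proof -
      have As: "A z integrable_on {0..\<tau> t}" for z
        using primitive_integrable_sub[OF pB, of 0 "\<tau> t" z] \<tau>[of t] set_lebesgue_integral_eq_integral(1) by auto
      have "B z (\<tau> t) - B w (\<tau> t) = integral {0..\<tau> t} (\<lambda>r. A z r - A w r)"
        unfolding B_def using As by (simp add: Henstock_Kurzweil_Integration.integral_diff)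
      also have "cmod \<dots> \<le> M * dist z w / K / K * exp (K * \<tau> t)"
        by (rule exp_weighted_integral_bound) (use \<tau>[of t] K M0 A in \<open>auto intro!: integrable_diff As\<close>)
      finally show ?thesis .
    qed
    then have "exp (- K * \<tau> t) * cmod (B z (\<tau> t) - B w (\<tau> t))
        \<le> exp (- K * \<tau> t) * (M * dist z w / K / K * exp (K * \<tau> t))"
      by (intro mult_left_mono) auto
    also have "\<dots> = M / K / K * dist z w" by (simp add: exp_minus field_simps)
    also have "\<dots> \<le> 1 / 2 * dist z w" using K by (intro mult_right_mono) auto
    finally show "dist (apply_bcontfun (\<Psi> z) t) (apply_bcontfun (\<Psi> w) t) \<le> 1 / 2 * dist z w"
      unfolding \<Psi> dist_norm by (simp add: norm_mult flip: right_diff_distrib)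
  qed
  obtain z where z: "\<Psi> z = z"
    using banach_fix_type[of "1 / 2" \<Psi>] contr by auto
  define v where "v t = of_real (exp (K * t)) * apply_bcontfun z t" for t
  have vB: "v t = B z t" if "t \<in> {0..T}" for t
  proof -
    have "apply_bcontfun z t = of_real (exp (- K * t)) * B z t"
      using \<Psi>[of z t] unfolding z \<tau>_id[OF that] .
    then have "v t = of_real (exp (K * t) * exp (- K * t)) * B z t" by (simp add: v_def mult.assoc)
    also have "exp (K * t) * exp (- K * t) = 1" by (simp add: exp_minus)
    finally show ?thesis by simp
  qed
  show ?thesis
  proof (rule that)
    show "primitive T (A z) v" by (rule primitive_cong[OF pB _ T]) (simp add: vB)
    show "primitive T (\<lambda>t. f t - of_real (b t) * v t) (A z)"
      using pA[of z] by (simp add: g_def[abs_def] v_def)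
    show "v 0 = v0" using vB[of 0] T by (simp add: B_def)
    show "A z 0 = v1" by (simp add: A_def)
  qed
qed

subsection \<open>Test functions and distributions in terms of Fourier coefficients\<close>

locale eigen_system = schroedinger_operator h V + ell2_basis h b
  for h :: real and V :: "real ^ 'n::finite \<Rightarrow> real" and b :: "nat \<Rightarrow> 'n gridfun" +
  fixes lam :: "nat \<Rightarrow> real"
  assumes lam_nonneg: "0 \<le> lam \<xi>" and b_dom: "b \<xi> \<in> dom_H h V"
    and b_eigen: "schroedinger h V (b \<xi>) = (\<lambda>k. of_real (lam \<xi>) * b \<xi> k)"
begin

lemma coef_schroedinger:
  assumes "u \<in> dom_H h V"
  shows "coef (schroedinger h V u) \<xi> = of_real (lam \<xi>) * coef u \<xi>"
  unfolding coef_def schroedinger_sym[OF assms b_dom] b_eigen ell2_inner_scale_right by simp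

lemma coef_one_plus_H:
  assumes "u \<in> dom_H h V"
  shows "coef (one_plus_H h V u) \<xi> = of_real (1 + lam \<xi>) * coef u \<xi>"
  unfolding one_plus_H_def
  by (simp add: coef_add[OF dom_H_ell2[OF assms] schroedinger_ell2[OF assms]]
      coef_schroedinger[OF assms] distrib_right)

lemma one_plus_H_ell2: "u \<in> dom_H h V \<Longrightarrow> one_plus_H h V u \<in> ell2 h"
  by (simp add: dom_H_def)

text \<open>At a given point H involves finitely many values of u, so it acts termwise on the
  pointwise expansion, even for u outside the domain. This is how decay of the coefficients yields
  membership of the domain.\<close>

lemma schroedinger_sums:
  assumes u: "u \<in> ell2 h"
  shows "(\<lambda>\<xi>. coef u \<xi> * (of_real (lam \<xi>) * b \<xi> k)) sums schroedinger h V u k"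
proof -
  have e: "(\<lambda>\<xi>. coef u \<xi> * b \<xi> l) sums u l" for l by (rule basis_expansion[OF u])
  let ?S = "\<lambda>u. of_real (inverse (h\<^sup>2)) * (\<Sum>j\<in>UNIV. 2 * u k - u (k + h *\<^sub>R axis j 1) - u (k + - (h *\<^sub>R axis j 1)))
      + of_real (V k) * u k"
  have "(\<lambda>\<xi>. of_real (inverse (h\<^sup>2)) * (\<Sum>j\<in>UNIV. 2 * (coef u \<xi> * b \<xi> k) - coef u \<xi> * b \<xi> (k + h *\<^sub>R axis j 1)
        - coef u \<xi> * b \<xi> (k + - (h *\<^sub>R axis j 1))) + of_real (V k) * (coef u \<xi> * b \<xi> k)) sums ?S u"
    by (intro sums_add sums_mult sums_sum sums_diff e)
  moreover have "of_real (inverse (h\<^sup>2)) * (\<Sum>j\<in>UNIV. 2 * (coef u \<xi> * b \<xi> k) - coef u \<xi> * b \<xi> (k + h *\<^sub>R axis j 1)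
        - coef u \<xi> * b \<xi> (k + - (h *\<^sub>R axis j 1))) + of_real (V k) * (coef u \<xi> * b \<xi> k)
      = coef u \<xi> * schroedinger h V (b \<xi>) k" for \<xi>
    unfolding schroedinger_eq[OF b_ell2] lap_def
    by (simp add: sum_distrib_left algebra_simps del: add_uminus_conv_diff)
  ultimately show ?thesis
    unfolding schroedinger_eq[OF u] lap_def b_eigen by simp
qed

lemma dom_H_iff_coef:
  "u \<in> dom_H h V \<longleftrightarrow> u \<in> ell2 h \<and> summable (\<lambda>\<xi>. (1 + lam \<xi>)\<^sup>2 * (cmod (coef u \<xi>))\<^sup>2)"
proof safe
  assume u: "u \<in> dom_H h V"
  show "u \<in> ell2 h" by (rule dom_H_ell2[OF u])
  have "summable (\<lambda>\<xi>. (cmod (of_real (1 + lam \<xi>) * coef u \<xi>))\<^sup>2)"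
    using coef_summable[OF one_plus_H_ell2[OF u]] unfolding coef_one_plus_H[OF u] .
  then show "summable (\<lambda>\<xi>. (1 + lam \<xi>)\<^sup>2 * (cmod (coef u \<xi>))\<^sup>2)"
    unfolding norm_mult power_mult_distrib norm_of_real power2_abs .
next
  assume u: "u \<in> ell2 h" and "summable (\<lambda>\<xi>. (1 + lam \<xi>)\<^sup>2 * (cmod (coef u \<xi>))\<^sup>2)"
  from this(2) have s: "summable (\<lambda>\<xi>. (cmod (of_real (1 + lam \<xi>) * coef u \<xi>))\<^sup>2)"
    unfolding norm_mult power_mult_distrib norm_of_real power2_abs .
  have "one_plus_H h V u k = synth (\<lambda>\<xi>. of_real (1 + lam \<xi>) * coef u \<xi>) k" for k
  proof -
    have "(\<lambda>\<xi>. coef u \<xi> * b \<xi> k + coef u \<xi> * (of_real (lam \<xi>) * b \<xi> k)) sums one_plus_H h V u k"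
      unfolding one_plus_H_def by (intro sums_add basis_expansion schroedinger_sums u)
    then have "(\<lambda>\<xi>. of_real (1 + lam \<xi>) * coef u \<xi> * b \<xi> k) sums one_plus_H h V u k"
      by (simp add: algebra_simps)
    then show ?thesis unfolding synth_def by (simp add: sums_iff)
  qed
  then have "one_plus_H h V u = synth (\<lambda>\<xi>. of_real (1 + lam \<xi>) * coef u \<xi>)" by blast
  then show "u \<in> dom_H h V" using u synth_ell2[OF s] by (simp add: dom_H_def)
qed

text \<open>The recursion iterates H and not I + H, so the factor \<lambda>^2 it produces has to be
  compared with (1 + \<lambda>)^2.\<close>

lemma dom_H_pow_iff_coef:
  "u \<in> dom_H_pow h V m \<longleftrightarrow> u \<in> ell2 h \<and> summable (\<lambda>\<xi>. (1 + lam \<xi>) ^ (2 * m) * (cmod (coef u \<xi>))\<^sup>2)"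
proof (induction m arbitrary: u)
  case 0
  then show ?case using coef_summable by auto
next
  case (Suc m)
  let ?c = "\<lambda>\<xi>. (cmod (coef u \<xi>))\<^sup>2"
  have n1: "1 \<le> 1 + lam \<xi>" for \<xi> using lam_nonneg[of \<xi>] by simp
  have H: "schroedinger h V u \<in> dom_H_pow h V m \<longleftrightarrow> summable (\<lambda>\<xi>. (1 + lam \<xi>) ^ (2 * m) * ((lam \<xi>)\<^sup>2 * ?c \<xi>))"
    if "u \<in> dom_H h V"
    using schroedinger_ell2[OF that]
    by (simp add: Suc.IH coef_schroedinger[OF that] norm_mult power_mult_distrib)
  show ?case
  proof safe
    assume "u \<in> dom_H_pow h V (Suc m)"
    then have u: "u \<in> dom_H h V" and "schroedinger h V u \<in> dom_H_pow h V m" by auto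
    then have s: "summable (\<lambda>\<xi>. (1 + lam \<xi>) ^ (2 * m) * ((lam \<xi>)\<^sup>2 * ?c \<xi>))" using H by blast
    show u2: "u \<in> ell2 h" by (rule dom_H_ell2[OF u])
    show "summable (\<lambda>\<xi>. (1 + lam \<xi>) ^ (2 * Suc m) * ?c \<xi>)"
    proof (rule summable_comparison_test')
      show "summable (\<lambda>\<xi>. 4 * ((1 + lam \<xi>) ^ (2 * m) * ((lam \<xi>)\<^sup>2 * ?c \<xi>)) + 4 ^ Suc m * ?c \<xi>)"
        by (intro summable_add summable_mult s coef_summable[OF u2])
      fix \<xi>
      \<comment> \<open>For \<lambda> > 1 one has (1 + \<lambda>)^2 \<le> 4 \<lambda>^2; for
        \<lambda> \<le> 1 the left side is at most 4^(m + 1), and that part is absorbed by the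
        square summability of the coefficients.\<close>
      have "(1 + lam \<xi>) ^ (2 * Suc m) \<le> 4 * ((1 + lam \<xi>) ^ (2 * m) * (lam \<xi>)\<^sup>2) + 4 ^ Suc m"
      proof (cases "lam \<xi> \<le> 1")
        case True
        then have "(1 + lam \<xi>) ^ (2 * Suc m) \<le> 2 ^ (2 * Suc m)"
          using lam_nonneg[of \<xi>] by (intro power_mono) auto
        also have "\<dots> = 4 ^ Suc m" unfolding power_mult by simp
        finally show ?thesis using lam_nonneg[of \<xi>] by (smt (verit) mult_nonneg_nonneg zero_le_power zero_le_power2)
      next
        case False
        then have "(1 + lam \<xi>)\<^sup>2 \<le> (2 * lam \<xi>)\<^sup>2" by (intro power_mono) auto
        then have "(1 + lam \<xi>) ^ (2 * m) * (1 + lam \<xi>)\<^sup>2 \<le> (1 + lam \<xi>) ^ (2 * m) * (4 * (lam \<xi>)\<^sup>2)"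
          using lam_nonneg[of \<xi>] by (intro mult_left_mono) (auto simp: power_mult_distrib)
        then show ?thesis by (simp add: power_add[symmetric] mult_ac add_increasing2)
      qed
      from mult_right_mono[OF this, of "?c \<xi>"]
      show "norm ((1 + lam \<xi>) ^ (2 * Suc m) * ?c \<xi>)
          \<le> 4 * ((1 + lam \<xi>) ^ (2 * m) * ((lam \<xi>)\<^sup>2 * ?c \<xi>)) + 4 ^ Suc m * ?c \<xi>"
        using n1[of \<xi>] by (simp add: distrib_right mult.assoc abs_mult)
    qed
  next
    assume u: "u \<in> ell2 h" and s: "summable (\<lambda>\<xi>. (1 + lam \<xi>) ^ (2 * Suc m) * ?c \<xi>)"
    have "summable (\<lambda>\<xi>. (1 + lam \<xi>)\<^sup>2 * ?c \<xi>)"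
    proof (rule summable_comparison_test'[OF s])
      fix \<xi>
      have "(1 + lam \<xi>)\<^sup>2 \<le> (1 + lam \<xi>) ^ (2 * Suc m)" using n1 by (intro power_increasing) auto
      then show "norm ((1 + lam \<xi>)\<^sup>2 * ?c \<xi>) \<le> (1 + lam \<xi>) ^ (2 * Suc m) * ?c \<xi>"
        by (simp add: mult_right_mono)
    qed
    then have d: "u \<in> dom_H h V" using u by (simp add: dom_H_iff_coef)
    have "summable (\<lambda>\<xi>. (1 + lam \<xi>) ^ (2 * m) * ((lam \<xi>)\<^sup>2 * ?c \<xi>))"
    proof (rule summable_comparison_test'[OF s])
      fix \<xi>
      have "(1 + lam \<xi>) ^ (2 * m) * (lam \<xi>)\<^sup>2 \<le> (1 + lam \<xi>) ^ (2 * m) * (1 + lam \<xi>)\<^sup>2"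
        using lam_nonneg[of \<xi>] by (intro mult_left_mono power_mono) auto
      also have "\<dots> = (1 + lam \<xi>) ^ (2 * Suc m)" by (simp add: power_add[symmetric])
      finally have "(1 + lam \<xi>) ^ (2 * m) * (lam \<xi>)\<^sup>2 * ?c \<xi> \<le> (1 + lam \<xi>) ^ (2 * Suc m) * ?c \<xi>"
        by (rule mult_right_mono) simp
      then show "norm ((1 + lam \<xi>) ^ (2 * m) * ((lam \<xi>)\<^sup>2 * ?c \<xi>)) \<le> (1 + lam \<xi>) ^ (2 * Suc m) * ?c \<xi>"
        using n1[of \<xi>] by (simp add: mult.assoc abs_mult)
    qed
    then show "u \<in> dom_H_pow h V (Suc m)" using d H by simp
  qed
qed

section \<open>Smooth vectors and rapidly decreasing coefficients\<close>

definition rapid :: "(nat \<Rightarrow> complex) \<Rightarrow> bool" where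
  "rapid c \<longleftrightarrow> (\<forall>m. summable (\<lambda>\<xi>. (1 + lam \<xi>) ^ (2 * m) * (cmod (c \<xi>))\<^sup>2))"

lemma rapid_sq_summable: "rapid c \<Longrightarrow> summable (\<lambda>\<xi>. (cmod (c \<xi>))\<^sup>2)"
  unfolding rapid_def by (drule spec[of _ 0]) simp

lemma H_inf_iff: "u \<in> H_inf h V \<longleftrightarrow> u \<in> ell2 h \<and> rapid (coef u)"
proof
  assume u: "u \<in> H_inf h V"
  then have *: "u \<in> dom_H_pow h V m" if "1 \<le> m" for m using that by (auto simp: H_inf_def)
  have u2: "u \<in> ell2 h" using *[of 1] dom_H_ell2 by simp
  have "summable (\<lambda>\<xi>. (1 + lam \<xi>) ^ (2 * m) * (cmod (coef u \<xi>))\<^sup>2)" for m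
    using *[of m] u2 coef_summable[OF u2] by (cases "m = 0") (auto simp: dom_H_pow_iff_coef)
  then show "u \<in> ell2 h \<and> rapid (coef u)" using u2 by (simp add: rapid_def)
qed (auto simp: H_inf_def dom_H_pow_iff_coef rapid_def)

lemma H_inf_ell2: "u \<in> H_inf h V \<Longrightarrow> u \<in> ell2 h" and H_inf_rapid: "u \<in> H_inf h V \<Longrightarrow> rapid (coef u)"
  by (simp_all add: H_inf_iff)

lemma H_inf_dom_H: "u \<in> H_inf h V \<Longrightarrow> u \<in> dom_H h V"
  unfolding H_inf_iff dom_H_iff_coef rapid_def by (metis mult_1_right)

lemma rapid_add: "rapid c \<Longrightarrow> rapid d \<Longrightarrow> rapid (\<lambda>\<xi>. c \<xi> + d \<xi>)"
  unfolding rapid_def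
proof
  fix m
  assume "\<forall>m. summable (\<lambda>\<xi>. (1 + lam \<xi>) ^ (2 * m) * (cmod (c \<xi>))\<^sup>2)"
    and "\<forall>m. summable (\<lambda>\<xi>. (1 + lam \<xi>) ^ (2 * m) * (cmod (d \<xi>))\<^sup>2)"
  then have "summable (\<lambda>\<xi>. 2 * ((1 + lam \<xi>) ^ (2 * m) * (cmod (c \<xi>))\<^sup>2) + 2 * ((1 + lam \<xi>) ^ (2 * m) * (cmod (d \<xi>))\<^sup>2))"
    by (intro summable_add summable_mult) auto
  then show "summable (\<lambda>\<xi>. (1 + lam \<xi>) ^ (2 * m) * (cmod (c \<xi> + d \<xi>))\<^sup>2)"
  proof (rule summable_comparison_test'[of _ 0])
    fix \<xi>
    have "(1 + lam \<xi>) ^ (2 * m) * (cmod (c \<xi> + d \<xi>))\<^sup>2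
        \<le> (1 + lam \<xi>) ^ (2 * m) * (2 * (cmod (c \<xi>))\<^sup>2 + 2 * (cmod (d \<xi>))\<^sup>2)"
      using lam_nonneg[of \<xi>] by (intro mult_left_mono cmod_add_sq_le) auto
    then show "norm ((1 + lam \<xi>) ^ (2 * m) * (cmod (c \<xi> + d \<xi>))\<^sup>2)
        \<le> 2 * ((1 + lam \<xi>) ^ (2 * m) * (cmod (c \<xi>))\<^sup>2) + 2 * ((1 + lam \<xi>) ^ (2 * m) * (cmod (d \<xi>))\<^sup>2)"
      using lam_nonneg[of \<xi>] by (simp add: distrib_left abs_mult mult_ac)
  qed
qed

lemma rapid_bounded_mult:
  assumes "rapid c" "\<And>\<xi>. cmod (d \<xi>) \<le> K * (1 + lam \<xi>) ^ j * cmod (c \<xi>)"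
  shows "rapid d"
  unfolding rapid_def
proof
  fix m
  have "summable (\<lambda>\<xi>. (1 + lam \<xi>) ^ (2 * (m + j)) * (cmod (c \<xi>))\<^sup>2)"
    using assms(1) unfolding rapid_def by blast
  then have "summable (\<lambda>\<xi>. K\<^sup>2 * ((1 + lam \<xi>) ^ (2 * (m + j)) * (cmod (c \<xi>))\<^sup>2))"
    by (rule summable_mult)
  then show "summable (\<lambda>\<xi>. (1 + lam \<xi>) ^ (2 * m) * (cmod (d \<xi>))\<^sup>2)"
  proof (rule summable_comparison_test'[of _ 0])
    fix \<xi>
    have "(1 + lam \<xi>) ^ (2 * m) * (cmod (d \<xi>))\<^sup>2 \<le> (1 + lam \<xi>) ^ (2 * m) * (K * (1 + lam \<xi>) ^ j * cmod (c \<xi>))\<^sup>2"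
      using lam_nonneg[of \<xi>] by (intro mult_left_mono power_mono assms) auto
    also have "\<dots> = K\<^sup>2 * ((1 + lam \<xi>) ^ (2 * (m + j)) * (cmod (c \<xi>))\<^sup>2)"
      by (simp add: power_mult_distrib power_add distrib_left power_mult[symmetric] mult_ac)
    finally show "norm ((1 + lam \<xi>) ^ (2 * m) * (cmod (d \<xi>))\<^sup>2) \<le> K\<^sup>2 * ((1 + lam \<xi>) ^ (2 * (m + j)) * (cmod (c \<xi>))\<^sup>2)"
      using lam_nonneg[of \<xi>] by (simp add: abs_mult)
  qed
qed

lemma rapid_scale: "rapid c \<Longrightarrow> rapid (\<lambda>\<xi>. k * c \<xi>)"
  by (rule rapid_bounded_mult[where K="cmod k" and j=0 and c=c]) (auto simp: norm_mult)

lemma H_inf_add: "u \<in> H_inf h V \<Longrightarrow> v \<in> H_inf h V \<Longrightarrow> (\<lambda>k. u k + v k) \<in> H_inf h V"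
  using rapid_add[of "coef u" "coef v"] by (simp add: H_inf_iff ell2_add coef_add rapid_def)

lemma H_inf_scale: "u \<in> H_inf h V \<Longrightarrow> (\<lambda>k. c * u k) \<in> H_inf h V"
  using rapid_scale[of "coef u" c] by (simp add: H_inf_iff ell2_scale coef_scale rapid_def)

lemma H_inf_diff: "u \<in> H_inf h V \<Longrightarrow> v \<in> H_inf h V \<Longrightarrow> (\<lambda>k. u k - v k) \<in> H_inf h V"
  using H_inf_add[OF _ H_inf_scale[of v "- 1"], of u] by simp

lemma H_inf_zero: "(\<lambda>k. 0) \<in> H_inf h V"
  by (simp add: H_inf_iff rapid_def coef_def)

lemma H_inf_b: "b \<xi> \<in> H_inf h V"
  unfolding H_inf_iff rapid_def
proof (intro conjI allI b_ell2)
  fix m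
  show "summable (\<lambda>\<eta>. (1 + lam \<eta>) ^ (2 * m) * (cmod (coef (b \<xi>) \<eta>))\<^sup>2)"
    by (rule summable_finite[of "{\<xi>}"]) (auto simp: coef_b)
qed

lemma H_inf_comb: "(\<lambda>k. \<Sum>\<xi><N. c \<xi> * b \<xi> k) \<in> H_inf h V"
proof (induction N)
  case (Suc N)
  then show ?case using H_inf_add[OF _ H_inf_scale[OF H_inf_b]] by simp
qed (simp add: H_inf_zero)

lemma H_inf_synth: "rapid c \<Longrightarrow> synth c \<in> H_inf h V"
  using synth_ell2[OF rapid_sq_summable] coef_synth[OF rapid_sq_summable] by (simp add: H_inf_iff rapid_def)

lemma H_inf_schroedinger: "u \<in> H_inf h V \<Longrightarrow> schroedinger h V u \<in> H_inf h V"
proof -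
  assume u: "u \<in> H_inf h V"
  note d = H_inf_dom_H[OF u]
  have "rapid (coef (schroedinger h V u))"
  proof (rule rapid_bounded_mult[OF H_inf_rapid[OF u], where K=1 and j=1])
    fix \<xi>
    have "lam \<xi> * cmod (coef u \<xi>) \<le> (1 + lam \<xi>) * cmod (coef u \<xi>)" by (rule mult_right_mono) auto
    then show "cmod (coef (schroedinger h V u) \<xi>) \<le> 1 * (1 + lam \<xi>) ^ 1 * cmod (coef u \<xi>)"
      using lam_nonneg[of \<xi>] by (simp add: coef_schroedinger[OF d] norm_mult)
  qed
  then show ?thesis using schroedinger_ell2[OF d] by (simp add: H_inf_iff)
qed

lemma H_inf_one_plus_H: "u \<in> H_inf h V \<Longrightarrow> one_plus_H h V u \<in> H_inf h V"
  unfolding one_plus_H_def by (intro H_inf_add H_inf_schroedinger)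

lemma H_inf_one_plus_H_pow:
  assumes "u \<in> H_inf h V"
  shows "(one_plus_H h V ^^ j) u \<in> H_inf h V \<and>
    (\<forall>\<xi>. coef ((one_plus_H h V ^^ j) u) \<xi> = of_real ((1 + lam \<xi>) ^ j) * coef u \<xi>)"
proof (induction j)
  case (Suc j)
  then show ?case using coef_one_plus_H[OF H_inf_dom_H] by (simp add: H_inf_one_plus_H)
qed (simp add: assms)

lemma one_plus_H_pow_norm:
  assumes "u \<in> H_inf h V"
  shows "(\<lambda>\<xi>. (1 + lam \<xi>) ^ (2 * j) * (cmod (coef u \<xi>))\<^sup>2) sums (ell2_norm h ((one_plus_H h V ^^ j) u))\<^sup>2"
proof -
  have "(cmod (coef ((one_plus_H h V ^^ j) u) \<xi>))\<^sup>2 = (1 + lam \<xi>) ^ (2 * j) * (cmod (coef u \<xi>))\<^sup>2" for \<xi>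
    unfolding conjunct2[OF H_inf_one_plus_H_pow[OF assms], rule_format] norm_mult norm_of_real power_mult_distrib
      power2_abs power_mult[symmetric] mult.commute[of j] ..
  then show ?thesis
    using parseval[OF H_inf_ell2[OF conjunct1[OF H_inf_one_plus_H_pow[OF assms]]], of j] by simp
qed

lemma H_inf_norm_ge: "j \<le> m \<Longrightarrow> ell2_norm h ((one_plus_H h V ^^ j) u) \<le> H_inf_norm h V m u"
  unfolding H_inf_norm_def by (rule Max_ge) auto

lemma H_inf_norm_le_sum: "H_inf_norm h V m u \<le> (\<Sum>j\<le>m. ell2_norm h ((one_plus_H h V ^^ j) u))"
proof -
  have "ell2_norm h ((one_plus_H h V ^^ i) u) \<le> (\<Sum>j\<le>m. ell2_norm h ((one_plus_H h V ^^ j) u))"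
    if "i \<le> m" for i
    by (rule member_le_sum[of i "{..m}" "\<lambda>j. ell2_norm h ((one_plus_H h V ^^ j) u)"]) (use that in auto)
  then show ?thesis unfolding H_inf_norm_def by auto
qed

text \<open>The difference has coefficient 0 below N and that of - u from N on, so each norm of a
  power of I + H is the root of the tail of a convergent series. The maximum in
  \<open>H_inf_norm\<close> is bounded by a sum to take the limit.\<close>

lemma H_inf_partial_sums:
  assumes u: "u \<in> H_inf h V"
  shows "(\<lambda>N. H_inf_norm h V m (\<lambda>k. (\<Sum>\<xi><N. coef u \<xi> * b \<xi> k) - u k)) \<longlonglongrightarrow> 0"
proof -
  let ?r = "\<lambda>N k. (\<Sum>\<xi><N. coef u \<xi> * b \<xi> k) - u k"
  have r: "?r N \<in> H_inf h V" for N by (intro H_inf_diff H_inf_comb u)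
  have c: "coef (?r N) \<xi> = (if \<xi> < N then 0 else - coef u \<xi>)" for N \<xi>
  proof -
    have "coef (\<lambda>k. \<Sum>\<xi><N. coef u \<xi> * b \<xi> k) \<xi> = (\<Sum>\<eta><N. coef u \<eta> * coef (b \<eta>) \<xi>)"
      unfolding coef_def
      by (subst ell2_inner_sum_left) (auto intro: ell2_scale simp: ell2_inner_scale_left)
    also have "\<dots> = (if \<xi> < N then coef u \<xi> else 0)"
      by (simp add: coef_b if_distrib[of "\<lambda>x. _ * x"] cong: if_cong)
    finally show ?thesis
      using coef_diff[OF H_inf_ell2[OF H_inf_comb] H_inf_ell2[OF u]] by simp
  qed
  have "(\<lambda>N. ell2_norm h ((one_plus_H h V ^^ j) (?r N))) \<longlonglongrightarrow> 0" for j
  proof -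
    let ?f = "\<lambda>\<xi>. (1 + lam \<xi>) ^ (2 * j) * (cmod (coef u \<xi>))\<^sup>2"
    have s: "summable ?f" using H_inf_rapid[OF u] by (simp add: rapid_def)
    have "(ell2_norm h ((one_plus_H h V ^^ j) (?r N)))\<^sup>2 = suminf ?f - (\<Sum>\<xi><N. ?f \<xi>)" for N
    proof -
      have "(\<lambda>\<xi>. if \<xi> < N then ?f \<xi> else 0) sums (\<Sum>\<xi><N. ?f \<xi>)"
        using sums_If_finite_set[of "{..<N}" ?f] by simp
      from sums_diff[OF summable_sums[OF s] this]
      have "(\<lambda>\<xi>. (1 + lam \<xi>) ^ (2 * j) * (cmod (coef (?r N) \<xi>))\<^sup>2) sums (suminf ?f - (\<Sum>\<xi><N. ?f \<xi>))"
        by (rule sums_cong[THEN iffD1, rotated]) (simp add: c)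
      then show ?thesis using one_plus_H_pow_norm[OF r] sums_unique2 by blast
    qed
    moreover have "(\<lambda>N. suminf ?f - (\<Sum>\<xi><N. ?f \<xi>)) \<longlonglongrightarrow> suminf ?f - suminf ?f"
      by (intro tendsto_diff tendsto_const summable_LIMSEQ s)
    ultimately have "(\<lambda>N. (ell2_norm h ((one_plus_H h V ^^ j) (?r N)))\<^sup>2) \<longlonglongrightarrow> 0" by simp
    from tendsto_real_sqrt[OF this] show ?thesis by simp
  qed
  then have "(\<lambda>N. \<Sum>j\<le>m. ell2_norm h ((one_plus_H h V ^^ j) (?r N))) \<longlonglongrightarrow> (\<Sum>j\<le>m. 0)"
    by (intro tendsto_sum)
  then have lim: "(\<lambda>N. \<Sum>j\<le>m. ell2_norm h ((one_plus_H h V ^^ j) (?r N))) \<longlonglongrightarrow> 0" by simp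
  show ?thesis
  proof (rule tendsto_sandwich[OF _ _ tendsto_const lim])
    show "\<forall>\<^sub>F N in sequentially. 0 \<le> H_inf_norm h V m (?r N)"
      using order_trans[OF ell2_norm_nonneg H_inf_norm_ge[of 0]] by simp
  qed (use H_inf_norm_le_sum in simp)
qed

text \<open>Continuity of \<open>w\<close> is applied along the partial sums of \<open>u\<close>,
  which converge in every seminorm. Thus a distribution is determined by its values on the
  basis.\<close>

lemma H_minus_inf_expansion:
  assumes w: "w \<in> H_minus_inf h V" and u: "u \<in> H_inf h V"
  shows "(\<lambda>\<xi>. coef u \<xi> * w (b \<xi>)) sums w u"
  unfolding sums_def
proof (rule LIMSEQ_I)
  fix \<epsilon> :: real assume "0 < \<epsilon>"
  have add: "w (\<lambda>k. \<phi> k + \<psi> k) = w \<phi> + w \<psi>" if "\<phi> \<in> H_inf h V" "\<psi> \<in> H_inf h V" for \<phi> \<psi>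
    using w that by (simp add: H_minus_inf_def)
  have scale: "w (\<lambda>k. c * \<phi> k) = c * w \<phi>" if "\<phi> \<in> H_inf h V" for \<phi> c
    using w that by (simp add: H_minus_inf_def)
  have part: "w (\<lambda>k. \<Sum>\<xi><N. c \<xi> * b \<xi> k) = (\<Sum>\<xi><N. c \<xi> * w (b \<xi>))" for N c
  proof (induction N)
    case 0
    show ?case using scale[OF H_inf_zero, of 0] by simp
  next
    case (Suc N)
    then show ?case by (simp add: add[OF H_inf_comb H_inf_scale[OF H_inf_b]] scale[OF H_inf_b])
  qed
  obtain m \<delta> where "0 < \<delta>" and cont: "\<And>\<psi>. \<psi> \<in> H_inf h V \<Longrightarrow> H_inf_norm h V m (\<lambda>k. \<psi> k - u k) < \<delta> \<Longrightarrow> cmod (w \<psi> - w u) < \<epsilon>"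
    using w u \<open>0 < \<epsilon>\<close> unfolding H_minus_inf_def by blast
  obtain N0 where N0: "\<And>N. N \<ge> N0 \<Longrightarrow> norm (H_inf_norm h V m (\<lambda>k. (\<Sum>\<xi><N. coef u \<xi> * b \<xi> k) - u k) - 0) < \<delta>"
    using LIMSEQ_D[OF H_inf_partial_sums[OF u] \<open>0 < \<delta>\<close>] by metis
  have "norm ((\<Sum>\<xi><N. coef u \<xi> * w (b \<xi>)) - w u) < \<epsilon>" if "N \<ge> N0" for N
    unfolding part[symmetric] by (rule cont[OF H_inf_comb]) (use N0[OF that] in simp)
  then show "\<exists>N0. \<forall>N\<ge>N0. norm ((\<Sum>\<xi><N. coef u \<xi> * w (b \<xi>)) - w u) < \<epsilon>" by blast
qed

text \<open>Synthesis carries the sequences isometrically into \<open>ell2 h\<close>, where the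
  inequality is known; \<open>y\<close> is conjugated to turn the bilinear sum into an inner
  product.\<close>

lemma sequence_cauchy_schwarz:
  fixes x y :: "nat \<Rightarrow> complex"
  assumes "summable (\<lambda>\<xi>. (cmod (x \<xi>))\<^sup>2)" "summable (\<lambda>\<xi>. (cmod (y \<xi>))\<^sup>2)"
  shows "cmod (\<Sum>\<xi>. x \<xi> * y \<xi>) \<le> sqrt (\<Sum>\<xi>. (cmod (x \<xi>))\<^sup>2) * sqrt (\<Sum>\<xi>. (cmod (y \<xi>))\<^sup>2)"
proof -
  have y: "summable (\<lambda>\<xi>. (cmod (cnj (y \<xi>)))\<^sup>2)" using assms(2) by simp
  note e = synth_ell2[OF assms(1)] synth_ell2[OF y]
  have n: "ell2_norm h (synth c) = sqrt (\<Sum>\<xi>. (cmod (c \<xi>))\<^sup>2)" if "summable (\<lambda>\<xi>. (cmod (c \<xi>))\<^sup>2)" for c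
    using parseval[OF synth_ell2[OF that]] coef_synth[OF that] by (simp add: sums_iff real_sqrt_unique)
  have "(\<Sum>\<xi>. x \<xi> * y \<xi>) = ell2_inner h (synth x) (synth (\<lambda>\<xi>. cnj (y \<xi>)))"
    using basis_expansion_inner[OF e] by (simp add: coef_synth[OF assms(1)] coef_synth[OF y] sums_iff)
  then show ?thesis
    using ell2_cauchy_schwarz[OF e] by (simp add: n[OF assms(1)] n[OF y])
qed

section \<open>Weighted sequences and the distributions they define\<close>

definition weighted_summable :: "real \<Rightarrow> (nat \<Rightarrow> complex) \<Rightarrow> bool" where
  "weighted_summable r c \<longleftrightarrow> summable (\<lambda>\<xi>. (1 + lam \<xi>) powr r * (cmod (c \<xi>))\<^sup>2)"

lemma weighted_summable_mono:
  assumes "weighted_summable r c" "r' \<le> r"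
  shows "weighted_summable r' c"
  unfolding weighted_summable_def
proof (rule summable_comparison_test'[OF assms(1)[unfolded weighted_summable_def], of 0])
  fix \<xi>
  have "(1 + lam \<xi>) powr r' \<le> (1 + lam \<xi>) powr r"
    using assms(2) lam_nonneg[of \<xi>] by (intro powr_mono) auto
  then show "norm ((1 + lam \<xi>) powr r' * (cmod (c \<xi>))\<^sup>2) \<le> (1 + lam \<xi>) powr r * (cmod (c \<xi>))\<^sup>2"
    by (simp add: mult_right_mono)
qed

lemma rapid_imp_weighted_summable:
  assumes "rapid c"
  shows "weighted_summable r c"
proof -
  obtain m :: nat where m: "r \<le> real (2 * m)"
  proof -
    obtain m :: nat where "r \<le> real m" using real_arch_simple by blast
    then show ?thesis using that[of m] by simp
  qed
  have "(1 + lam \<xi>) powr real (2 * m) = (1 + lam \<xi>) ^ (2 * m)" for \<xi>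
    using lam_nonneg[of \<xi>] by (intro powr_realpow) linarith
  then have "weighted_summable (real (2 * m)) c"
    using assms unfolding weighted_summable_def rapid_def by simp
  then show ?thesis by (rule weighted_summable_mono[OF _ m])
qed

lemma weighted_sq:
  "(cmod (of_real ((1 + lam \<xi>) powr (r / 2)) * c))\<^sup>2 = (1 + lam \<xi>) powr r * (cmod c)\<^sup>2"
proof -
  have "((1 + lam \<xi>) powr (r / 2))\<^sup>2 = (1 + lam \<xi>) powr r"
    using lam_nonneg[of \<xi>] by (simp add: power2_eq_square powr_add[symmetric])
  then show ?thesis by (simp add: norm_mult power_mult_distrib)
qed

text \<open>The factor 1 is split as (1 + \<lambda>)^(-r/2) on \<open>c\<close> times (1 +
  \<lambda>)^(r/2) on \<open>y\<close>: the weights - r and r are dual to each other.\<close>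

lemma weighted_pairing:
  assumes "weighted_summable (- r) c" "weighted_summable r y"
  shows "summable (\<lambda>\<xi>. cmod (c \<xi> * y \<xi>))"
    "cmod (\<Sum>\<xi>. c \<xi> * y \<xi>) \<le> sqrt (\<Sum>\<xi>. (1 + lam \<xi>) powr (- r) * (cmod (c \<xi>))\<^sup>2) *
       sqrt (\<Sum>\<xi>. (1 + lam \<xi>) powr r * (cmod (y \<xi>))\<^sup>2)"
proof -
  let ?x = "\<lambda>\<xi>. of_real ((1 + lam \<xi>) powr (- r / 2)) * c \<xi>"
  let ?y = "\<lambda>\<xi>. of_real ((1 + lam \<xi>) powr (r / 2)) * y \<xi>"
  have eq: "c \<xi> * y \<xi> = ?x \<xi> * ?y \<xi>" for \<xi>
  proof -
    have "(1 + lam \<xi>) powr (- r / 2) * (1 + lam \<xi>) powr (r / 2) = 1"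
      using lam_nonneg[of \<xi>] by (simp add: powr_add[symmetric])
    then have "complex_of_real ((1 + lam \<xi>) powr (- r / 2)) * of_real ((1 + lam \<xi>) powr (r / 2)) = 1"
      by (metis of_real_1 of_real_mult)
    then show ?thesis by (simp add: mult_ac)
  qed
  have sx: "summable (\<lambda>\<xi>. (cmod (?x \<xi>))\<^sup>2)" and sy: "summable (\<lambda>\<xi>. (cmod (?y \<xi>))\<^sup>2)"
    using assms unfolding weighted_sq weighted_summable_def by auto
  show "cmod (\<Sum>\<xi>. c \<xi> * y \<xi>) \<le> sqrt (\<Sum>\<xi>. (1 + lam \<xi>) powr (- r) * (cmod (c \<xi>))\<^sup>2) *
       sqrt (\<Sum>\<xi>. (1 + lam \<xi>) powr r * (cmod (y \<xi>))\<^sup>2)"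
    using sequence_cauchy_schwarz[OF sx sy] unfolding eq[symmetric] weighted_sq .
  show "summable (\<lambda>\<xi>. cmod (c \<xi> * y \<xi>))"
  proof (rule summable_comparison_test'[OF summable_add[OF sx sy], of 0])
    show "norm (cmod (c \<xi> * y \<xi>)) \<le> (cmod (?x \<xi>))\<^sup>2 + (cmod (?y \<xi>))\<^sup>2" for \<xi>
      unfolding eq[of \<xi>] using cmod_mult_cnj_le[of "?x \<xi>" "cnj (?y \<xi>)"]
      by (simp only: complex_cnj_cnj complex_mod_cnj real_norm_def abs_norm_cancel)
  qed
qed

text \<open>The only possible functional with value \<open>y \<xi>\<close> at
  \<open>b \<xi>\<close>, by linearity and continuity. The pairing is bilinear, in agreement with
  \<open>emb\<close>.\<close>

definition distr_of :: "(nat \<Rightarrow> complex) \<Rightarrow> 'n distr" where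
  "distr_of y = (\<lambda>\<phi>. if \<phi> \<in> H_inf h V then \<Sum>\<xi>. coef \<phi> \<xi> * y \<xi> else 0)"

lemma distr_of_sums:
  assumes "weighted_summable r y" "\<phi> \<in> H_inf h V"
  shows "(\<lambda>\<xi>. coef \<phi> \<xi> * y \<xi>) sums distr_of y \<phi>"
  using summable_norm_cancel[OF weighted_pairing(1)[OF rapid_imp_weighted_summable[OF H_inf_rapid[OF assms(2)]] assms(1)]]
    assms(2) by (simp add: distr_of_def summable_sums)

lemma distr_of_b: "distr_of y (b \<xi>) = y \<xi>"
proof -
  have "(\<lambda>\<eta>. coef (b \<xi>) \<eta> * y \<eta>) sums (\<Sum>\<eta>\<in>{\<xi>}. coef (b \<xi>) \<eta> * y \<eta>)"
    by (rule sums_finite) (auto simp: coef_b)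
  then show ?thesis by (simp add: distr_of_def H_inf_b coef_b sums_iff)
qed

lemma distr_of_bound:
  assumes y: "weighted_summable r y" and \<phi>: "\<phi> \<in> H_inf h V"
  shows "cmod (distr_of y \<phi>) \<le> sqrt (\<Sum>\<xi>. (1 + lam \<xi>) powr (- r) * (cmod (coef \<phi> \<xi>))\<^sup>2) *
       sqrt (\<Sum>\<xi>. (1 + lam \<xi>) powr r * (cmod (y \<xi>))\<^sup>2)"
  using weighted_pairing(2)[OF rapid_imp_weighted_summable[OF H_inf_rapid[OF \<phi>]] y] \<phi>
  by (simp add: distr_of_def)

lemma distr_of_add_fun:
  assumes y: "weighted_summable r y" and "\<phi> \<in> H_inf h V" "\<psi> \<in> H_inf h V"
  shows "distr_of y (\<lambda>k. \<phi> k + \<psi> k) = distr_of y \<phi> + distr_of y \<psi>"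
proof -
  have "(\<lambda>\<xi>. coef \<phi> \<xi> * y \<xi> + coef \<psi> \<xi> * y \<xi>) sums (distr_of y \<phi> + distr_of y \<psi>)"
    by (intro sums_add distr_of_sums[OF y] assms)
  moreover have "(\<lambda>\<xi>. coef (\<lambda>k. \<phi> k + \<psi> k) \<xi> * y \<xi>) sums distr_of y (\<lambda>k. \<phi> k + \<psi> k)"
    by (intro distr_of_sums[OF y] H_inf_add assms)
  ultimately show ?thesis
    using assms by (simp add: coef_add H_inf_ell2 distrib_right sums_unique2)
qed

lemma distr_of_scale_fun:
  assumes y: "weighted_summable r y" and "\<phi> \<in> H_inf h V"
  shows "distr_of y (\<lambda>k. c * \<phi> k) = c * distr_of y \<phi>"
proof -
  have "(\<lambda>\<xi>. c * (coef \<phi> \<xi> * y \<xi>)) sums (c * distr_of y \<phi>)"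
    by (intro sums_mult distr_of_sums[OF y] assms)
  moreover have "(\<lambda>\<xi>. coef (\<lambda>k. c * \<phi> k) \<xi> * y \<xi>) sums distr_of y (\<lambda>k. c * \<phi> k)"
    by (intro distr_of_sums[OF y] H_inf_scale assms)
  ultimately show ?thesis by (simp add: coef_scale mult.assoc sums_unique2)
qed

lemma distr_of_H_minus_inf:
  assumes y: "weighted_summable r y"
  shows "distr_of y \<in> H_minus_inf h V"
  unfolding H_minus_inf_def mem_Collect_eq
proof (intro conjI allI ballI impI)
  show "distr_of y \<phi> = 0" if "\<phi> \<notin> H_inf h V" for \<phi> using that by (simp add: distr_of_def)
next
  fix \<phi> :: "'n gridfun" and \<epsilon> :: real assume \<phi>: "\<phi> \<in> H_inf h V" and \<epsilon>: "0 < \<epsilon>"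
  \<comment> \<open>With this m the weight (1 + \<lambda>)^(-r) is at most (1 + \<lambda>)^(2 m), so
    the single seminorm of order m controls the functional.\<close>
  obtain m :: nat where m: "- r \<le> real m" using real_arch_simple by blast
  define C where "C = sqrt (\<Sum>\<xi>. (1 + lam \<xi>) powr r * (cmod (y \<xi>))\<^sup>2)"
  have C0: "0 \<le> C"
    unfolding C_def using y by (simp add: weighted_summable_def suminf_nonneg)
  have bound: "cmod (distr_of y \<psi>) \<le> H_inf_norm h V m \<psi> * C" if \<psi>: "\<psi> \<in> H_inf h V" for \<psi>
  proof -
    have "(\<Sum>\<xi>. (1 + lam \<xi>) powr (- r) * (cmod (coef \<psi> \<xi>))\<^sup>2) \<le> (\<Sum>\<xi>. (1 + lam \<xi>) ^ (2 * m) * (cmod (coef \<psi> \<xi>))\<^sup>2)"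
    proof (rule suminf_le)
      fix \<xi>
      have l: "1 \<le> 1 + lam \<xi>" using lam_nonneg[of \<xi>] by simp
      have "(1 + lam \<xi>) powr (- r) \<le> (1 + lam \<xi>) powr real (2 * m)"
        using m l by (intro powr_mono) auto
      also have "\<dots> = (1 + lam \<xi>) ^ (2 * m)" using l by (intro powr_realpow) linarith
      finally show "(1 + lam \<xi>) powr (- r) * (cmod (coef \<psi> \<xi>))\<^sup>2 \<le> (1 + lam \<xi>) ^ (2 * m) * (cmod (coef \<psi> \<xi>))\<^sup>2"
        by (rule mult_right_mono) simp
    next
      show "summable (\<lambda>\<xi>. (1 + lam \<xi>) powr (- r) * (cmod (coef \<psi> \<xi>))\<^sup>2)"
        using rapid_imp_weighted_summable[OF H_inf_rapid[OF \<psi>]] by (simp add: weighted_summable_def)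
      show "summable (\<lambda>\<xi>. (1 + lam \<xi>) ^ (2 * m) * (cmod (coef \<psi> \<xi>))\<^sup>2)"
        using one_plus_H_pow_norm[OF \<psi>] by (rule sums_summable)
    qed
    also have "\<dots> = (ell2_norm h ((one_plus_H h V ^^ m) \<psi>))\<^sup>2"
      using one_plus_H_pow_norm[OF \<psi>, of m] by (simp add: sums_iff)
    finally have "sqrt (\<Sum>\<xi>. (1 + lam \<xi>) powr (- r) * (cmod (coef \<psi> \<xi>))\<^sup>2) \<le> ell2_norm h ((one_plus_H h V ^^ m) \<psi>)"
      by (rule real_le_lsqrt[rotated]) simp_all
    also have "\<dots> \<le> H_inf_norm h V m \<psi>" by (rule H_inf_norm_ge) simp
    finally show ?thesis
      using distr_of_bound[OF y \<psi>] C0 unfolding C_def[symmetric]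
      by (meson mult_right_mono order_trans)
  qed
  show "\<exists>m. \<exists>\<delta>>0. \<forall>\<psi>\<in>H_inf h V. H_inf_norm h V m (\<lambda>k. \<psi> k - \<phi> k) < \<delta> \<longrightarrow> cmod (distr_of y \<psi> - distr_of y \<phi>) < \<epsilon>"
  proof (rule exI[of _ m], rule exI[of _ "\<epsilon> / (C + 1)"], intro conjI ballI impI)
    show "0 < \<epsilon> / (C + 1)" using \<epsilon> C0 by simp
    fix \<psi> assume \<psi>: "\<psi> \<in> H_inf h V" and d: "H_inf_norm h V m (\<lambda>k. \<psi> k - \<phi> k) < \<epsilon> / (C + 1)"
    have df: "(\<lambda>k. \<psi> k - \<phi> k) \<in> H_inf h V" by (rule H_inf_diff[OF \<psi> \<phi>])
    have "distr_of y \<psi> = distr_of y (\<lambda>k. \<psi> k - \<phi> k) + distr_of y \<phi>"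
      using distr_of_add_fun[OF y df \<phi>] by simp
    then have "cmod (distr_of y \<psi> - distr_of y \<phi>) = cmod (distr_of y (\<lambda>k. \<psi> k - \<phi> k))" by simp
    also have "\<dots> \<le> H_inf_norm h V m (\<lambda>k. \<psi> k - \<phi> k) * C" by (rule bound[OF df])
    also have "\<dots> \<le> \<epsilon> / (C + 1) * C" using d C0 by (intro mult_right_mono) auto
    also have "\<dots> < \<epsilon>" using \<epsilon> C0 by (simp add: field_simps)
    finally show "cmod (distr_of y \<psi> - distr_of y \<phi>) < \<epsilon>" .
  qed
qed (auto intro: distr_of_add_fun[OF y] distr_of_scale_fun[OF y])

lemma distr_of_coefs:
  assumes w: "w \<in> H_minus_inf h V"
  shows "distr_of (\<lambda>\<xi>. w (b \<xi>)) = w"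
proof
  fix \<phi>
  show "distr_of (\<lambda>\<xi>. w (b \<xi>)) \<phi> = w \<phi>"
  proof (cases "\<phi> \<in> H_inf h V")
    case True
    then show ?thesis using H_minus_inf_expansion[OF w True] by (simp add: distr_of_def sums_iff)
  next
    case False
    then show ?thesis using w by (simp add: distr_of_def H_minus_inf_def)
  qed
qed

end

section \<open>The conjugate basis and independence of the choice of basis\<close>

lemma (in schroedinger_operator) eigenbasis_eigen_system:
  assumes "eigenbasis h V lam e"
  shows "eigen_system h V e lam"
proof unfold_locales
  show "orthonormal_on h UNIV e"
    using assms dom_H_ell2 by (auto simp: eigenbasis_def orthonormal_on_def)
qed (use assms in \<open>auto simp: eigenbasis_def\<close>)

context eigen_system
begin

lemma schroedinger_cnj: 
  assumes "u \<in> ell2 h"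
  shows "schroedinger h V (\<lambda>k. cnj (u k)) = (\<lambda>k. cnj (schroedinger h V u k))"
  by (simp add: schroedinger_eq assms ell2_cnj lap_cnj)

lemma cnj_eigen_system: "eigen_system h V (\<lambda>\<xi> k. cnj (b \<xi> k)) lam"
proof unfold_locales
  show "orthonormal_on h UNIV (\<lambda>\<xi> k. cnj (b \<xi> k))"
    unfolding orthonormal_on_def by (auto simp: ell2_cnj ell2_inner_cnj b_inner)
  fix g :: "'n gridfun" assume g: "g \<in> ell2 h"
  have i: "ell2_inner h g (\<lambda>k. cnj (b \<xi> k)) = cnj (ell2_inner h (\<lambda>k. cnj (g k)) (b \<xi>))" for \<xi>
    using ell2_inner_cnj[of h g "\<lambda>k. cnj (b \<xi> k)"] by simp
  have "(\<lambda>k. g k - (\<Sum>\<xi><N. ell2_inner h g (\<lambda>k. cnj (b \<xi> k)) * cnj (b \<xi> k)))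
    = (\<lambda>k. cnj (cnj (g k) - (\<Sum>\<xi><N. ell2_inner h (\<lambda>k. cnj (g k)) (b \<xi>) * b \<xi> k)))" for N
    unfolding i by (simp add: cnj_sum)
  then show "(\<lambda>N. ell2_norm h (\<lambda>k. g k - (\<Sum>\<xi><N. ell2_inner h g (\<lambda>k. cnj (b \<xi> k)) * cnj (b \<xi> k)))) \<longlonglongrightarrow> 0"
    using complete[OF ell2_cnj[OF g]] by (simp only: ell2_norm_cnj)
next
  fix \<xi>
  show "(\<lambda>k. cnj (b \<xi> k)) \<in> dom_H h V"
    using ell2_cnj[OF one_plus_H_ell2[OF b_dom, of \<xi>]] ell2_cnj[OF b_ell2, of \<xi>]
    by (simp add: dom_H_def one_plus_H_def schroedinger_cnj)
  show "schroedinger h V (\<lambda>k. cnj (b \<xi> k)) = (\<lambda>k. of_real (lam \<xi>) * cnj (b \<xi> k))"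
    by (simp add: schroedinger_cnj b_eigen)
qed (rule lam_nonneg)

text \<open>Spectral multipliers do not depend on the choice of the eigenbasis, as eigenvectors of
  different eigenvalues are orthogonal.\<close>

lemma multiplier_other_basis:
  assumes other: "eigen_system h V b' lam'" and u: "u \<in> ell2 h" and g: "g \<in> ell2 h"
    and mult: "\<And>\<xi>. coef g \<xi> = F (lam \<xi>) * coef u \<xi>"
  shows "ell2_inner h g (b' \<eta>) = F (lam' \<eta>) * ell2_inner h u (b' \<eta>)"
proof -
  interpret o: eigen_system h V b' lam' by (rule other)
  have "lam' \<eta> = lam \<xi>" if "coef (b' \<eta>) \<xi> \<noteq> 0" for \<xi>
  proof -
    have "of_real (lam \<xi>) * coef (b' \<eta>) \<xi> = of_real (lam' \<eta>) * coef (b' \<eta>) \<xi>"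
      using coef_schroedinger[OF o.b_dom, of \<eta> \<xi>] by (auto simp add: o.b_eigen coef_scale)
    then show ?thesis using that by auto
  qed
  then have eq: "coef g \<xi> * cnj (coef (b' \<eta>) \<xi>) = F (lam' \<eta>) * (coef u \<xi> * cnj (coef (b' \<eta>) \<xi>))" for \<xi>
    unfolding mult by (cases "coef (b' \<eta>) \<xi> = 0") auto
  have "(\<lambda>\<xi>. coef g \<xi> * cnj (coef (b' \<eta>) \<xi>)) sums (F (lam' \<eta>) * ell2_inner h u (b' \<eta>))"
    unfolding eq by (rule sums_mult[OF basis_expansion_inner[OF u o.b_ell2]])
  then show ?thesis using basis_expansion_inner[OF g o.b_ell2] sums_unique2 by blast
qed

end

subsection \<open>Sobolev spaces\<close>

context confining_operator
begin

lemma eigen_system_chosen: "eigen_system h V (eigvec h V) (eigval h V)"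
proof (rule eigenbasis_eigen_system)
  have "\<exists>p. case p of (lam, e) \<Rightarrow> eigenbasis h V lam e" using eigenbasis_exists by auto
  then have "case the_eigenbasis h V of (lam, e) \<Rightarrow> eigenbasis h V lam e"
    unfolding the_eigenbasis_def by (rule someI_ex)
  then show "eigenbasis h V (eigval h V) (eigvec h V)"
    unfolding eigval_def eigvec_def by (cases "the_eigenbasis h V") simp
qed

text \<open>E is the chosen basis, in which \<open>H_power\<close> is defined and square summable
  functions are expanded. D is its conjugate, in which smooth vectors are expanded, because Fourier
  coefficients of distributions are values at conjugate eigenvectors. Weights depend on the
  eigenvalues only, so they agree for both.\<close>

sublocale E: eigen_system h V "eigvec h V" "eigval h V"
  by (rule eigen_system_chosen)

sublocale D: eigen_system h V "\<lambda>\<xi> k. cnj (eigvec h V \<xi> k)" "eigval h V"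
  by (rule E.cnj_eigen_system)

definition hat :: "'n distr \<Rightarrow> nat \<Rightarrow> complex" where
  "hat w \<xi> = w (\<lambda>k. cnj (eigvec h V \<xi> k))"

lemma powr_le_power_ex: "\<exists>j. \<forall>\<xi>. (1 + eigval h V \<xi>) powr r \<le> (1 + eigval h V \<xi>) ^ j"
proof -
  obtain j :: nat where j: "r \<le> real j" using real_arch_simple by blast
  have "(1 + eigval h V \<xi>) powr r \<le> (1 + eigval h V \<xi>) ^ j" for \<xi>
  proof -
    have l: "1 \<le> 1 + eigval h V \<xi>" using E.lam_nonneg[of \<xi>] by simp
    have "(1 + eigval h V \<xi>) powr r \<le> (1 + eigval h V \<xi>) powr real j" by (rule powr_mono[OF j l])
    also have "\<dots> = (1 + eigval h V \<xi>) ^ j" using l by (intro powr_realpow) linarith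
    finally show ?thesis .
  qed
  then show ?thesis by blast
qed

lemma rapid_powr:
  assumes "E.rapid c"
  shows "E.rapid (\<lambda>\<xi>. of_real ((1 + eigval h V \<xi>) powr r) * c \<xi>)"
proof -
  obtain j where j: "\<And>\<xi>. (1 + eigval h V \<xi>) powr r \<le> (1 + eigval h V \<xi>) ^ j"
    using powr_le_power_ex by blast
  show ?thesis
    by (rule E.rapid_bounded_mult[OF assms, where K=1 and j=j]) (simp add: norm_mult mult_right_mono j)
qed

lemma H_power_eq_synth:
  assumes "\<phi> \<in> H_inf h V"
  shows "H_power h V r \<phi> = E.synth (\<lambda>\<xi>. of_real ((1 + eigval h V \<xi>) powr r) * E.coef \<phi> \<xi>)"
proof
  fix k
  let ?c = "\<lambda>\<xi>. of_real ((1 + eigval h V \<xi>) powr r) * E.coef \<phi> \<xi>"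
  have s: "summable (\<lambda>\<xi>. (cmod (?c \<xi>))\<^sup>2)"
    by (rule E.rapid_sq_summable[OF rapid_powr[OF E.H_inf_rapid[OF assms]]])
  have "((\<lambda>\<xi>. ?c \<xi> * eigvec h V \<xi> k) has_sum E.synth ?c k) UNIV"
    by (rule norm_summable_imp_has_sum[OF E.synth_abs_summable[OF s] E.synth_sums[OF s]])
  then show "H_power h V r \<phi> k = E.synth ?c k"
    unfolding H_power_def E.coef_def by (rule infsumI)
qed

lemma H_power_H_inf: "\<phi> \<in> H_inf h V \<Longrightarrow> H_power h V r \<phi> \<in> H_inf h V"
  by (simp add: H_power_eq_synth E.H_inf_synth rapid_powr E.H_inf_rapid)

text \<open>\<open>H_power\<close> is diagonal in E by construction; that it is diagonal in D as
  well is what makes it its own transpose for the bilinear pairing.\<close>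

lemma coef_H_power:
  assumes "\<phi> \<in> H_inf h V"
  shows "D.coef (H_power h V r \<phi>) \<xi> = of_real ((1 + eigval h V \<xi>) powr r) * D.coef \<phi> \<xi>"
proof -
  have "E.coef (H_power h V r \<phi>) \<eta> = of_real ((1 + eigval h V \<eta>) powr r) * E.coef \<phi> \<eta>" for \<eta>
    unfolding H_power_eq_synth[OF assms]
    by (rule E.coef_synth[OF E.rapid_sq_summable[OF rapid_powr[OF E.H_inf_rapid[OF assms]]]])
  then show ?thesis
    unfolding D.coef_def
    by (rule E.multiplier_other_basis[OF D.eigen_system_axioms E.H_inf_ell2[OF assms]
          E.H_inf_ell2[OF H_power_H_inf[OF assms]], where F="\<lambda>l. of_real ((1 + l) powr r)"])
qed

lemma emb_basis: "emb h V g (\<lambda>k. cnj (eigvec h V \<xi> k)) = E.coef g \<xi>"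
  by (simp add: emb_def D.H_inf_b E.coef_def ell2_inner_def)

lemma emb_inj: "inj_on (emb h V) (ell2 h)"
proof (rule inj_onI)
  fix f g assume "f \<in> ell2 h" "g \<in> ell2 h" "emb h V f = emb h V g"
  then show "f = g" using emb_basis E.coef_inject by metis
qed

lemma emb_sums:
  assumes "g \<in> ell2 h" "\<phi> \<in> H_inf h V"
  shows "(\<lambda>\<xi>. D.coef \<phi> \<xi> * E.coef g \<xi>) sums emb h V g \<phi>"
proof -
  have "E.coef (\<lambda>k. cnj (\<phi> k)) \<xi> = cnj (D.coef \<phi> \<xi>)" for \<xi>
    unfolding E.coef_def D.coef_def
    using ell2_inner_cnj[of h \<phi> "\<lambda>k. cnj (eigvec h V \<xi> k)"] by simp
  then have "(\<lambda>\<xi>. E.coef g \<xi> * D.coef \<phi> \<xi>) sums ell2_inner h g (\<lambda>k. cnj (\<phi> k))"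
    using E.basis_expansion_inner[OF assms(1) ell2_cnj[OF E.H_inf_ell2[OF assms(2)]]] by simp
  moreover have "ell2_inner h g (\<lambda>k. cnj (\<phi> k)) = emb h V g \<phi>"
    using assms(2) by (simp add: emb_def ell2_inner_def)
  ultimately show ?thesis by (simp add: mult.commute)
qed

lemma H_power_distr_sums:
  assumes w: "w \<in> H_minus_inf h V" and \<phi>: "\<phi> \<in> H_inf h V"
  shows "(\<lambda>\<xi>. D.coef \<phi> \<xi> * (of_real ((1 + eigval h V \<xi>) powr r) * hat w \<xi>)) sums H_power_distr h V r w \<phi>"
  using D.H_minus_inf_expansion[OF w H_power_H_inf[OF \<phi>, of r]] \<phi>
  by (simp add: H_power_distr_def coef_H_power hat_def mult_ac)

lemma H_power_distr_basis:
  assumes "w \<in> H_minus_inf h V"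
  shows "H_power_distr h V r w (\<lambda>k. cnj (eigvec h V \<xi> k)) = of_real ((1 + eigval h V \<xi>) powr r) * hat w \<xi>"
proof -
  have "(\<lambda>\<eta>. D.coef (\<lambda>k. cnj (eigvec h V \<xi> k)) \<eta> * (of_real ((1 + eigval h V \<eta>) powr r) * hat w \<eta>))
      sums (\<Sum>\<eta>\<in>{\<xi>}. D.coef (\<lambda>k. cnj (eigvec h V \<xi> k)) \<eta> * (of_real ((1 + eigval h V \<eta>) powr r) * hat w \<eta>))"
    by (rule sums_finite) (auto simp: D.coef_b)
  then show ?thesis
    using sums_unique2[OF H_power_distr_sums[OF assms D.H_inf_b]] by (simp add: D.coef_b)
qed

text \<open>Testing at the conjugate eigenvectors reads off the coefficients of the representing
  function. Conversely, the function synthesised from the weighted coefficients has the right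
  pairing with every smooth vector.\<close>

lemma Hs_characterization:
  assumes w: "w \<in> H_minus_inf h V"
  shows "w \<in> Hs h V s \<longleftrightarrow> E.weighted_summable s (hat w)"
    and "w \<in> Hs h V s \<Longrightarrow> (Hs_norm h V s w)\<^sup>2 = (\<Sum>\<xi>. (1 + eigval h V \<xi>) powr s * (cmod (hat w \<xi>))\<^sup>2)"
proof -
  let ?c = "\<lambda>\<xi>. of_real ((1 + eigval h V \<xi>) powr (s / 2)) * hat w \<xi>"
  have fwd: "E.weighted_summable s (hat w) \<and>
      (ell2_norm h g)\<^sup>2 = (\<Sum>\<xi>. (1 + eigval h V \<xi>) powr s * (cmod (hat w \<xi>))\<^sup>2)"
    if g: "g \<in> ell2 h" "H_power_distr h V (s / 2) w = emb h V g" for g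
  proof -
    have "E.coef g \<xi> = ?c \<xi>" for \<xi>
      unfolding emb_basis[symmetric] g(2)[symmetric] by (rule H_power_distr_basis[OF w])
    then show ?thesis
      using E.parseval[OF g(1)] unfolding E.weighted_summable_def by (simp only: E.weighted_sq sums_iff)
  qed
  show "w \<in> Hs h V s \<longleftrightarrow> E.weighted_summable s (hat w)"
  proof
    assume "w \<in> Hs h V s"
    then show "E.weighted_summable s (hat w)" using fwd by (auto simp: Hs_def)
  next
    assume "E.weighted_summable s (hat w)"
    then have s: "summable (\<lambda>\<xi>. (cmod (?c \<xi>))\<^sup>2)" unfolding E.weighted_sq E.weighted_summable_def .
    have "H_power_distr h V (s / 2) w = emb h V (E.synth ?c)"
    proof
      fix \<phi>
      show "H_power_distr h V (s / 2) w \<phi> = emb h V (E.synth ?c) \<phi>"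
      proof (cases "\<phi> \<in> H_inf h V")
        case True
        then show ?thesis
          using H_power_distr_sums[OF w True, of "s / 2"] emb_sums[OF E.synth_ell2[OF s] True]
          by (simp add: E.coef_synth[OF s] sums_unique2)
      qed (simp add: H_power_distr_def emb_def)
    qed
    then show "w \<in> Hs h V s" using w E.synth_ell2[OF s] by (auto simp: Hs_def)
  qed
  show "(Hs_norm h V s w)\<^sup>2 = (\<Sum>\<xi>. (1 + eigval h V \<xi>) powr s * (cmod (hat w \<xi>))\<^sup>2)" if ws: "w \<in> Hs h V s"
  proof -
    obtain g where g: "g \<in> ell2 h" "H_power_distr h V (s / 2) w = emb h V g"
      using ws by (auto simp: Hs_def)
    then show ?thesis
      using fwd[OF g] by (simp add: Hs_norm_def the_inv_into_f_f[OF emb_inj])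
  qed
qed

lemma Hs_H_minus_inf: "w \<in> Hs h V s \<Longrightarrow> w \<in> H_minus_inf h V"
  by (simp add: Hs_def)

lemma Hs_hat_summable: "w \<in> Hs h V s \<Longrightarrow> E.weighted_summable s (hat w)"
  using Hs_characterization(1) Hs_H_minus_inf by blast

lemma Hs_norm_nonneg [simp]: "0 \<le> Hs_norm h V s w"
  by (simp add: Hs_norm_def)

lemma Hs_norm_sums:
  assumes "w \<in> Hs h V s"
  shows "(\<lambda>\<xi>. (1 + eigval h V \<xi>) powr s * (cmod (hat w \<xi>))\<^sup>2) sums (Hs_norm h V s w)\<^sup>2"
  using Hs_hat_summable[OF assms] Hs_characterization(2)[OF Hs_H_minus_inf assms] assms
  by (simp add: E.weighted_summable_def summable_sums)

lemma hat_distr_of: "hat (D.distr_of y) = y"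
  by (rule ext) (simp add: hat_def D.distr_of_b)

lemma distr_of_hat:
  assumes "w \<in> Hs h V s"
  shows "D.distr_of (hat w) = w"
  using D.distr_of_coefs[OF Hs_H_minus_inf[OF assms]] by (simp add: hat_def[abs_def])

lemma distr_of_Hs: "E.weighted_summable s y \<Longrightarrow> D.distr_of y \<in> Hs h V s"
  by (simp add: Hs_characterization(1)[OF D.distr_of_H_minus_inf] hat_distr_of)

lemma Hs_eqI:
  assumes "w \<in> Hs h V s" "w' \<in> Hs h V s'" "\<And>\<xi>. hat w \<xi> = hat w' \<xi>"
  shows "w = w'"
proof -
  have "hat w = hat w'" using assms(3) by blast
  then show ?thesis using distr_of_hat assms(1,2) by metis
qed

lemma weighted_summable_add:
  assumes "E.weighted_summable s x" "E.weighted_summable s y"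
  shows "E.weighted_summable s (\<lambda>\<xi>. x \<xi> + y \<xi>)"
  unfolding E.weighted_summable_def
proof (rule summable_comparison_test')
  show "summable (\<lambda>\<xi>. 2 * ((1 + eigval h V \<xi>) powr s * (cmod (x \<xi>))\<^sup>2) + 2 * ((1 + eigval h V \<xi>) powr s * (cmod (y \<xi>))\<^sup>2))"
    using assms unfolding E.weighted_summable_def by (intro summable_add summable_mult)
  fix \<xi>
  have "(1 + eigval h V \<xi>) powr s * (cmod (x \<xi> + y \<xi>))\<^sup>2
      \<le> (1 + eigval h V \<xi>) powr s * (2 * (cmod (x \<xi>))\<^sup>2 + 2 * (cmod (y \<xi>))\<^sup>2)"
    by (intro mult_left_mono cmod_add_sq_le) auto
  then show "norm ((1 + eigval h V \<xi>) powr s * (cmod (x \<xi> + y \<xi>))\<^sup>2)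
      \<le> 2 * ((1 + eigval h V \<xi>) powr s * (cmod (x \<xi>))\<^sup>2) + 2 * ((1 + eigval h V \<xi>) powr s * (cmod (y \<xi>))\<^sup>2)"
    by (simp add: distrib_left mult_ac)
qed

lemma weighted_summable_scale:
  "E.weighted_summable s x \<Longrightarrow> E.weighted_summable s (\<lambda>\<xi>. c * x \<xi>)"
  unfolding E.weighted_summable_def
  using summable_mult[of "\<lambda>\<xi>. (1 + eigval h V \<xi>) powr s * (cmod (x \<xi>))\<^sup>2" "(cmod c)\<^sup>2"]
  by (simp add: norm_mult power_mult_distrib mult_ac)

lemma distr_of_lin:
  assumes "E.weighted_summable s x" "E.weighted_summable s y"
  shows "D.distr_of (\<lambda>\<xi>. x \<xi> + c * y \<xi>) = (\<lambda>\<phi>. D.distr_of x \<phi> + c * D.distr_of y \<phi>)"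
proof
  fix \<phi>
  show "D.distr_of (\<lambda>\<xi>. x \<xi> + c * y \<xi>) \<phi> = D.distr_of x \<phi> + c * D.distr_of y \<phi>"
  proof (cases "\<phi> \<in> H_inf h V")
    case True
    have "(\<lambda>\<xi>. D.coef \<phi> \<xi> * x \<xi> + c * (D.coef \<phi> \<xi> * y \<xi>)) sums (D.distr_of x \<phi> + c * D.distr_of y \<phi>)"
      by (intro sums_add sums_mult D.distr_of_sums[OF assms(1) True] D.distr_of_sums[OF assms(2) True])
    moreover have "(\<lambda>\<xi>. D.coef \<phi> \<xi> * (x \<xi> + c * y \<xi>)) sums D.distr_of (\<lambda>\<xi>. x \<xi> + c * y \<xi>) \<phi>"
      by (rule D.distr_of_sums[OF weighted_summable_add[OF assms(1) weighted_summable_scale[OF assms(2)]] True])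
    moreover have "D.coef \<phi> \<xi> * (x \<xi> + c * y \<xi>) = D.coef \<phi> \<xi> * x \<xi> + c * (D.coef \<phi> \<xi> * y \<xi>)" for \<xi>
      by (simp add: algebra_simps)
    ultimately show ?thesis using sums_unique2 by simp
  qed (simp add: D.distr_of_def)
qed

lemma Hs_lin:
  assumes "w \<in> Hs h V s" "w' \<in> Hs h V s"
  shows "(\<lambda>\<phi>. w \<phi> + c * w' \<phi>) \<in> Hs h V s"
proof -
  note s = Hs_hat_summable[OF assms(1)] Hs_hat_summable[OF assms(2)]
  have "D.distr_of (\<lambda>\<xi>. hat w \<xi> + c * hat w' \<xi>) = (\<lambda>\<phi>. w \<phi> + c * w' \<phi>)"
    using distr_of_lin[OF s, of c] by (simp add: distr_of_hat[OF assms(1)] distr_of_hat[OF assms(2)])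
  then show ?thesis
    using distr_of_Hs[OF weighted_summable_add[OF s(1) weighted_summable_scale[OF s(2), of c]]] by simp
qed

lemma Hs_diff: "w \<in> Hs h V s \<Longrightarrow> w' \<in> Hs h V s \<Longrightarrow> (\<lambda>\<phi>. w \<phi> - w' \<phi>) \<in> Hs h V s"
  using Hs_lin[of w s w' "- 1"] by simp

lemma Hs_scale: "w \<in> Hs h V s \<Longrightarrow> (\<lambda>\<phi>. c * w \<phi>) \<in> Hs h V s"
  using Hs_lin[of w s w "c - 1"] by (simp add: algebra_simps)

lemma Hs_pairing_bound:
  assumes "w \<in> Hs h V s" "\<phi> \<in> H_inf h V"
  shows "cmod (w \<phi>) \<le> sqrt (\<Sum>\<xi>. (1 + eigval h V \<xi>) powr (- s) * (cmod (D.coef \<phi> \<xi>))\<^sup>2) * Hs_norm h V s w"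
proof -
  have "sqrt (\<Sum>\<xi>. (1 + eigval h V \<xi>) powr s * (cmod (hat w \<xi>))\<^sup>2) = Hs_norm h V s w"
    using Hs_norm_sums[OF assms(1)] by (simp add: sums_iff)
  then show ?thesis
    using D.distr_of_bound[OF Hs_hat_summable[OF assms(1)] assms(2)] by (simp add: distr_of_hat[OF assms(1)])
qed

text \<open>The passage from curves of distributions to scalar functions: evaluation at a smooth
  vector is bounded in every Sobolev norm.\<close>

lemma Hs_tendsto_pairing:
  assumes "\<phi> \<in> H_inf h V" "\<forall>\<^sub>F x in F. W x \<in> Hs h V s" "w \<in> Hs h V s"
    and "((\<lambda>x. Hs_norm h V s (\<lambda>\<phi>. W x \<phi> - w \<phi>)) \<longlongrightarrow> 0) F"
  shows "((\<lambda>x. W x \<phi>) \<longlongrightarrow> w \<phi>) F"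
proof -
  let ?C = "sqrt (\<Sum>\<xi>. (1 + eigval h V \<xi>) powr (- s) * (cmod (D.coef \<phi> \<xi>))\<^sup>2)"
  have "\<forall>\<^sub>F x in F. cmod (W x \<phi> - w \<phi>) \<le> ?C * Hs_norm h V s (\<lambda>\<phi>. W x \<phi> - w \<phi>)"
    using assms(2) by eventually_elim (rule Hs_pairing_bound[OF Hs_diff[OF _ assms(3)] assms(1)])
  then have "((\<lambda>x. W x \<phi> - w \<phi>) \<longlongrightarrow> 0) F"
    by (rule Lim_null_comparison) (rule tendsto_mult_right_zero[OF assms(4)])
  then show ?thesis using LIM_zero_iff by blast
qed

end

subsection \<open>Curves in Sobolev spaces\<close>

lemma eventually_at_within_mem: "\<forall>\<^sub>F x in at t within S. x \<in> S"
  by (simp add: eventually_at_filter)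

text \<open>Brings the scalar derivative into the shape of \<open>has_Hs_derivative\<close>, where
  the candidate is subtracted from the difference quotient.\<close>

lemma has_vector_derivative_quotient:
  fixes g :: "real \<Rightarrow> complex"
  shows "(g has_vector_derivative w) (at t within S) \<longleftrightarrow>
    ((\<lambda>\<tau>. (g \<tau> - g t) / of_real (\<tau> - t) - w) \<longlongrightarrow> 0) (at t within S)"
proof -
  have "\<forall>\<^sub>F \<tau> in at t within S. norm ((1 / norm (\<tau> - t)) *\<^sub>R (g \<tau> - (g t + (\<tau> - t) *\<^sub>R w)))
      = norm ((g \<tau> - g t) / of_real (\<tau> - t) - w)"
  proof -
    have "\<forall>\<^sub>F \<tau> in at t within S. \<tau> \<noteq> t" by (simp add: eventually_at_filter)
    then show ?thesis
    proof eventually_elim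
      fix \<tau> assume "\<tau> \<noteq> t"
      then have "g \<tau> - (g t + (\<tau> - t) *\<^sub>R w) = of_real (\<tau> - t) * ((g \<tau> - g t) / of_real (\<tau> - t) - w)"
        by (simp add: field_simps scaleR_conv_of_real)
      then show "norm ((1 / norm (\<tau> - t)) *\<^sub>R (g \<tau> - (g t + (\<tau> - t) *\<^sub>R w)))
          = norm ((g \<tau> - g t) / of_real (\<tau> - t) - w)"
        using \<open>\<tau> \<noteq> t\<close> by (simp only: norm_scaleR norm_mult norm_of_real) simp
    qed
  qed
  then have "((\<lambda>\<tau>. norm ((1 / norm (\<tau> - t)) *\<^sub>R (g \<tau> - (g t + (\<tau> - t) *\<^sub>R w)))) \<longlongrightarrow> 0) (at t within S)
      \<longleftrightarrow> ((\<lambda>\<tau>. norm ((g \<tau> - g t) / of_real (\<tau> - t) - w)) \<longlongrightarrow> 0) (at t within S)"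
    by (rule tendsto_cong)
  then show ?thesis
    unfolding has_vector_derivative_def has_derivative_within
    by (simp only: tendsto_norm_zero_iff bounded_linear_scaleR_left simp_thms)
qed

context confining_operator
begin

lemma C0_Hs_pairing_continuous:
  assumes u: "C0_Hs h V T s u" and \<phi>: "\<phi> \<in> H_inf h V"
  shows "continuous_on {0..T} (\<lambda>t. u t \<phi>)"
  unfolding continuous_on_def
proof
  fix t assume t: "t \<in> {0..T}"
  show "((\<lambda>t. u t \<phi>) \<longlongrightarrow> u t \<phi>) (at t within {0..T})"
  proof (rule Hs_tendsto_pairing[OF \<phi>])
    show "\<forall>\<^sub>F x in at t within {0..T}. u x \<in> Hs h V s"
      using eventually_at_within_mem[of "{0..T}" t] u by (auto simp: C0_Hs_def elim!: eventually_mono)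
  qed (use u t in \<open>auto simp: C0_Hs_def\<close>)
qed

lemma has_Hs_derivative_pairing:
  assumes d: "has_Hs_derivative h V T s u w t" and u: "\<And>\<tau>. \<tau> \<in> {0..T} \<Longrightarrow> u \<tau> \<in> Hs h V s"
    and t: "t \<in> {0..T}" and \<phi>: "\<phi> \<in> H_inf h V"
  shows "((\<lambda>\<tau>. u \<tau> \<phi>) has_vector_derivative w \<phi>) (at t within {0..T})"
proof -
  have "((\<lambda>\<tau>. (u \<tau> \<phi> - u t \<phi>) / of_real (\<tau> - t)) \<longlongrightarrow> w \<phi>) (at t within {0..T})"
  proof (rule Hs_tendsto_pairing[OF \<phi>, where W="\<lambda>\<tau> \<phi>. (u \<tau> \<phi> - u t \<phi>) / of_real (\<tau> - t)" and s=s])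
    show "\<forall>\<^sub>F \<tau> in at t within {0..T}. (\<lambda>\<phi>. (u \<tau> \<phi> - u t \<phi>) / of_real (\<tau> - t)) \<in> Hs h V s"
      using eventually_at_within_mem[of "{0..T}" t]
    proof eventually_elim
      fix \<tau> assume "\<tau> \<in> {0..T}"
      from Hs_scale[OF Hs_diff[OF u[OF this] u[OF t]], of "inverse (of_real (\<tau> - t))"]
      show "(\<lambda>\<phi>. (u \<tau> \<phi> - u t \<phi>) / of_real (\<tau> - t)) \<in> Hs h V s"
        by (simp add: divide_inverse mult.commute)
    qed
  qed (use d in \<open>auto simp: has_Hs_derivative_def\<close>)
  then show ?thesis
    unfolding has_vector_derivative_quotient by (rule LIM_zero)
qed

text \<open>\<open>Hs_deriv\<close> is a definite description, so uniqueness has to be supplied. It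
  is inherited from the scalar derivatives at the conjugate eigenvectors, which are unique since T >
  0 makes the interval nondegenerate.\<close>

lemma Hs_deriv_eqI:
  assumes d: "has_Hs_derivative h V T s u w t" and u: "\<And>\<tau>. \<tau> \<in> {0..T} \<Longrightarrow> u \<tau> \<in> Hs h V s"
    and t: "t \<in> {0..T}" and T: "0 < T"
  shows "Hs_deriv h V T s u t = w"
  unfolding Hs_deriv_def
proof (rule the_equality[where P="\<lambda>w. has_Hs_derivative h V T s u w t", OF d])
  fix w' assume d': "has_Hs_derivative h V T s u w' t"
  have "w' \<phi> = w \<phi>" if "\<phi> \<in> H_inf h V" for \<phi>
    using vector_derivative_unique_within_closed_interval[of 0 T t "\<lambda>\<tau>. u \<tau> \<phi>" "w' \<phi>" "w \<phi>"]
      has_Hs_derivative_pairing[OF d u t that] has_Hs_derivative_pairing[OF d' u t that] t T by simp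
  then have "hat w' \<xi> = hat w \<xi>" for \<xi> by (simp add: hat_def D.H_inf_b)
  then show "w' = w"
    using d d' by (intro Hs_eqI[of w' s w s]) (auto simp: has_Hs_derivative_def)
qed

lemma C1_Hs_primitive:
  assumes u: "C1_Hs h V T s u" and T: "0 < T" and \<phi>: "\<phi> \<in> H_inf h V"
  shows "primitive T (\<lambda>t. Hs_deriv h V T s u t \<phi>) (\<lambda>t. u t \<phi>)"
    "continuous_on {0..T} (\<lambda>t. Hs_deriv h V T s u t \<phi>)"
proof -
  have uH: "u \<tau> \<in> Hs h V s" if "\<tau> \<in> {0..T}" for \<tau> using u that by (simp add: C1_Hs_def C0_Hs_def)
  show c: "continuous_on {0..T} (\<lambda>t. Hs_deriv h V T s u t \<phi>)"
    using u by (intro C0_Hs_pairing_continuous[OF _ \<phi>, where s=s]) (simp add: C1_Hs_def)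
  show "primitive T (\<lambda>t. Hs_deriv h V T s u t \<phi>) (\<lambda>t. u t \<phi>)"
  proof (rule primitive_deriv[OF _ continuous_absolutely_integrable[OF c]])
    fix t assume t: "t \<in> {0..T}"
    then obtain w where w: "has_Hs_derivative h V T s u w t" using u unfolding C1_Hs_def by blast
    show "((\<lambda>t. u t \<phi>) has_vector_derivative Hs_deriv h V T s u t \<phi>) (at t within {0..T})"
      using has_Hs_derivative_pairing[OF w uH t \<phi>] Hs_deriv_eqI[OF w uH t T] by simp
  qed
qed

lemma weighted_summable_bounded:
  assumes "summable M" "\<And>\<xi>. (1 + eigval h V \<xi>) powr s * (cmod (y \<xi>))\<^sup>2 \<le> M \<xi>"
  shows "E.weighted_summable s y"
  unfolding E.weighted_summable_def
  by (rule summable_comparison_test'[OF assms(1), of 0]) (use assms(2) in auto)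

text \<open>Dominated convergence for series, that is Tannery's theorem, applied to the squared
  norm: every term tends to 0 and \<open>M\<close> is a majorant that does not depend on x.\<close>

lemma Hs_norm_tendsto_0:
  assumes lim: "\<And>\<xi>. ((\<lambda>x. Y x \<xi>) \<longlongrightarrow> 0) F"
    and bound: "\<forall>\<^sub>F x in F. \<forall>\<xi>. (1 + eigval h V \<xi>) powr s * (cmod (Y x \<xi>))\<^sup>2 \<le> M \<xi>"
    and M: "summable M"
  shows "((\<lambda>x. Hs_norm h V s (D.distr_of (Y x))) \<longlongrightarrow> 0) F"
proof (cases "F = bot")
  case False
  let ?a = "\<lambda>\<xi> x. (1 + eigval h V \<xi>) powr s * (cmod (Y x \<xi>))\<^sup>2"
  have "((\<lambda>x. \<Sum>\<xi>. ?a \<xi> x) \<longlongrightarrow> (\<Sum>\<xi>. 0)) F"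
  proof (rule conjunct2[OF conjunct2[OF tannerys_theorem[OF _ _ M False]]])
    show "((\<lambda>x. ?a \<xi> x) \<longlongrightarrow> 0) F" for \<xi>
      using tendsto_mult_right_zero[OF tendsto_null_power[OF tendsto_norm_zero[OF lim[of \<xi>]], of 2], of "(1 + eigval h V \<xi>) powr s"]
      by simp
    have "\<forall>\<^sub>F x in F. \<forall>\<xi>. norm (?a \<xi> x) \<le> M \<xi>" using bound by simp
    from eventually_prodI[OF eventually_True[of sequentially] this]
    show "\<forall>\<^sub>F (\<xi>, x) in sequentially \<times>\<^sub>F F. norm (?a \<xi> x) \<le> M \<xi>"
      by (auto elim!: eventually_mono)
  qed
  moreover have "\<forall>\<^sub>F x in F. (\<Sum>\<xi>. ?a \<xi> x) = (Hs_norm h V s (D.distr_of (Y x)))\<^sup>2"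
    using bound
  proof eventually_elim
    fix x assume "\<forall>\<xi>. (1 + eigval h V \<xi>) powr s * (cmod (Y x \<xi>))\<^sup>2 \<le> M \<xi>"
    then have "D.distr_of (Y x) \<in> Hs h V s" by (intro distr_of_Hs weighted_summable_bounded[OF M]) auto
    from Hs_norm_sums[OF this] show "(\<Sum>\<xi>. ?a \<xi> x) = (Hs_norm h V s (D.distr_of (Y x)))\<^sup>2"
      by (simp add: hat_distr_of sums_iff)
  qed
  ultimately have "((\<lambda>x. (Hs_norm h V s (D.distr_of (Y x)))\<^sup>2) \<longlongrightarrow> 0) F"
    by (simp add: tendsto_cong)
  from tendsto_real_sqrt[OF this] show ?thesis by simp
qed simp

lemma C0_Hs_distr_of:
  assumes M: "summable M" and c: "\<And>\<xi>. continuous_on {0..T} (y \<xi>)"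
    and bound: "\<And>\<xi> t. t \<in> {0..T} \<Longrightarrow> (1 + eigval h V \<xi>) powr s * (cmod (y \<xi> t))\<^sup>2 \<le> M \<xi>"
  shows "C0_Hs h V T s (\<lambda>t. D.distr_of (\<lambda>\<xi>. y \<xi> t))"
  unfolding C0_Hs_def
proof (intro ballI conjI)
  fix t assume t: "t \<in> {0..T}"
  have ws: "E.weighted_summable s (\<lambda>\<xi>. y \<xi> \<tau>)" if "\<tau> \<in> {0..T}" for \<tau>
    by (rule weighted_summable_bounded[OF M bound[OF that]])
  show "D.distr_of (\<lambda>\<xi>. y \<xi> t) \<in> Hs h V s" by (rule distr_of_Hs[OF ws[OF t]])
  have "((\<lambda>\<tau>. Hs_norm h V s (D.distr_of (\<lambda>\<xi>. y \<xi> \<tau> - y \<xi> t))) \<longlongrightarrow> 0) (at t within {0..T})"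
  proof (rule Hs_norm_tendsto_0)
    show "((\<lambda>\<tau>. y \<xi> \<tau> - y \<xi> t) \<longlongrightarrow> 0) (at t within {0..T})" for \<xi>
      using c[of \<xi>] t by (simp add: continuous_on_def LIM_zero)
    show "summable (\<lambda>\<xi>. 4 * M \<xi>)" by (rule summable_mult[OF M])
    show "\<forall>\<^sub>F \<tau> in at t within {0..T}. \<forall>\<xi>. (1 + eigval h V \<xi>) powr s * (cmod (y \<xi> \<tau> - y \<xi> t))\<^sup>2 \<le> 4 * M \<xi>"
      using eventually_at_within_mem[of "{0..T}" t]
    proof eventually_elim
      fix \<tau> assume \<tau>: "\<tau> \<in> {0..T}"
      show "\<forall>\<xi>. (1 + eigval h V \<xi>) powr s * (cmod (y \<xi> \<tau> - y \<xi> t))\<^sup>2 \<le> 4 * M \<xi>"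
      proof
        fix \<xi>
        have "(1 + eigval h V \<xi>) powr s * (cmod (y \<xi> \<tau> - y \<xi> t))\<^sup>2
            \<le> (1 + eigval h V \<xi>) powr s * (2 * (cmod (y \<xi> \<tau>))\<^sup>2 + 2 * (cmod (y \<xi> t))\<^sup>2)"
          by (intro mult_left_mono cmod_diff_sq_le) auto
        then show "(1 + eigval h V \<xi>) powr s * (cmod (y \<xi> \<tau> - y \<xi> t))\<^sup>2 \<le> 4 * M \<xi>"
          using bound[OF \<tau>, of \<xi>] bound[OF t, of \<xi>] by (simp add: distrib_left mult_ac)
      qed
    qed
  qed
  moreover have "\<forall>\<^sub>F \<tau> in at t within {0..T}. D.distr_of (\<lambda>\<xi>. y \<xi> \<tau> - y \<xi> t)
      = (\<lambda>\<phi>. D.distr_of (\<lambda>\<xi>. y \<xi> \<tau>) \<phi> - D.distr_of (\<lambda>\<xi>. y \<xi> t) \<phi>)"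
    using eventually_at_within_mem[of "{0..T}" t]
  proof eventually_elim
    fix \<tau> assume \<tau>: "\<tau> \<in> {0..T}"
    show "D.distr_of (\<lambda>\<xi>. y \<xi> \<tau> - y \<xi> t)
      = (\<lambda>\<phi>. D.distr_of (\<lambda>\<xi>. y \<xi> \<tau>) \<phi> - D.distr_of (\<lambda>\<xi>. y \<xi> t) \<phi>)"
      using distr_of_lin[OF ws[OF \<tau>] ws[OF t], of "- 1"] by simp
  qed
  ultimately show "((\<lambda>\<tau>. Hs_norm h V s (\<lambda>\<phi>. D.distr_of (\<lambda>\<xi>. y \<xi> \<tau>) \<phi> - D.distr_of (\<lambda>\<xi>. y \<xi> t) \<phi>)) \<longlongrightarrow> 0)
      (at t within {0..T})"
    by (rule Lim_transform_eventually[OF _ eventually_mono]) simp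
qed

text \<open>Each mode is differentiable by the fundamental theorem of calculus. The bound on its
  derivative limits its increments too, so the difference quotients are dominated uniformly in
  \<tau>.\<close>

lemma has_Hs_derivative_distr_of:
  assumes M: "summable M" and p: "\<And>\<xi>. primitive T (y' \<xi>) (y \<xi>)" and c: "\<And>\<xi>. continuous_on {0..T} (y' \<xi>)"
    and bound: "\<And>\<xi> t. t \<in> {0..T} \<Longrightarrow> (1 + eigval h V \<xi>) powr s * (cmod (y \<xi> t))\<^sup>2 \<le> M \<xi>"
    and bound': "\<And>\<xi> t. t \<in> {0..T} \<Longrightarrow> (1 + eigval h V \<xi>) powr s * (cmod (y' \<xi> t))\<^sup>2 \<le> M \<xi>"
    and t: "t \<in> {0..T}"
  shows "has_Hs_derivative h V T s (\<lambda>t. D.distr_of (\<lambda>\<xi>. y \<xi> t)) (D.distr_of (\<lambda>\<xi>. y' \<xi> t)) t"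
  unfolding has_Hs_derivative_def
proof
  have ws: "E.weighted_summable s (\<lambda>\<xi>. y \<xi> \<tau>)" if "\<tau> \<in> {0..T}" for \<tau>
    by (rule weighted_summable_bounded[OF M bound[OF that]])
  have ws': "E.weighted_summable s (\<lambda>\<xi>. y' \<xi> t)"
    by (rule weighted_summable_bounded[OF M bound'[OF t]])
  show "D.distr_of (\<lambda>\<xi>. y' \<xi> t) \<in> Hs h V s" by (rule distr_of_Hs[OF ws'])
  define q where "q \<tau> \<xi> = (y \<xi> \<tau> - y \<xi> t) / of_real (\<tau> - t) - y' \<xi> t" for \<tau> \<xi>
  have "((\<lambda>\<tau>. Hs_norm h V s (D.distr_of (q \<tau>))) \<longlongrightarrow> 0) (at t within {0..T})"
  proof (rule Hs_norm_tendsto_0)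
    fix \<xi>
    have FT: "((\<lambda>u. y \<xi> 0 + integral {0..u} (y' \<xi>)) has_vector_derivative 0 + y' \<xi> t) (at t within {0..T})"
      by (intro has_vector_derivative_add has_vector_derivative_const integral_has_vector_derivative c t)
    have "(y \<xi> has_vector_derivative 0 + y' \<xi> t) (at t within {0..T})"
      by (rule has_vector_derivative_transform[OF t _ FT]) (rule primitiveD(2)[OF p])
    then have "(y \<xi> has_vector_derivative y' \<xi> t) (at t within {0..T})" by simp
    then show "((\<lambda>\<tau>. q \<tau> \<xi>) \<longlongrightarrow> 0) (at t within {0..T})"
      unfolding has_vector_derivative_quotient q_def .
  next
    show "summable (\<lambda>\<xi>. 4 * M \<xi>)" by (rule summable_mult[OF M])
    show "\<forall>\<^sub>F \<tau> in at t within {0..T}. \<forall>\<xi>. (1 + eigval h V \<xi>) powr s * (cmod (q \<tau> \<xi>))\<^sup>2 \<le> 4 * M \<xi>"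
      using eventually_at_within_mem[of "{0..T}" t]
    proof eventually_elim
      fix \<tau> assume \<tau>: "\<tau> \<in> {0..T}"
      show "\<forall>\<xi>. (1 + eigval h V \<xi>) powr s * (cmod (q \<tau> \<xi>))\<^sup>2 \<le> 4 * M \<xi>"
      proof
        fix \<xi>
        let ?w = "(1 + eigval h V \<xi>) powr s"
        have w: "0 < ?w" using E.lam_nonneg[of \<xi>] by simp
        \<comment> \<open>The bound on |y'| that \<open>bound'\<close> amounts to. It limits both
          the difference quotient and y' at t, so their difference has square at most 4 B^2, which
          explains the majorant 4 M.\<close>
        define B where "B = sqrt (M \<xi> / ?w)"
        have M0: "0 \<le> M \<xi>" by (rule order_trans[OF _ bound[OF t]]) simp
        have B2: "B\<^sup>2 = M \<xi> / ?w" and B0: "0 \<le> B" using w M0 by (auto simp: B_def)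
        have yB: "cmod (y' \<xi> r) \<le> B" if "r \<in> {0..T}" for r
          unfolding B_def by (rule real_le_rsqrt) (use bound'[OF that, of \<xi>] w in \<open>simp add: field_simps\<close>)
        have inc: "cmod (y \<xi> r - y \<xi> r') \<le> B * (r - r')" if "0 \<le> r'" "r' \<le> r" "r \<le> T" for r r'
          unfolding primitive_diff[OF p that]
          by (rule integral_bound[OF that(2)]) (use that c[of \<xi>] yB in \<open>auto intro: continuous_on_subset\<close>)
        have "cmod (y \<xi> \<tau> - y \<xi> t) \<le> B * \<bar>\<tau> - t\<bar>"
          using inc[of t \<tau>] inc[of \<tau> t] t \<tau> by (cases "\<tau> \<le> t") (auto simp: norm_minus_commute)
        then have "cmod ((y \<xi> \<tau> - y \<xi> t) / of_real (\<tau> - t)) \<le> B"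
          using B0 by (cases "\<tau> = t") (auto simp: norm_divide field_simps simp flip: of_real_diff)
        then have "(cmod ((y \<xi> \<tau> - y \<xi> t) / of_real (\<tau> - t)))\<^sup>2 \<le> B\<^sup>2" by (intro power_mono) auto
        moreover have "(cmod (y' \<xi> t))\<^sup>2 \<le> B\<^sup>2" using yB[OF t] by (intro power_mono) auto
        ultimately have "(cmod (q \<tau> \<xi>))\<^sup>2 \<le> 4 * B\<^sup>2"
          using cmod_diff_sq_le[of "(y \<xi> \<tau> - y \<xi> t) / of_real (\<tau> - t)" "y' \<xi> t"] unfolding q_def by linarith
        then have "?w * (cmod (q \<tau> \<xi>))\<^sup>2 \<le> ?w * (4 * B\<^sup>2)" using w by (intro mult_left_mono) auto
        also have "\<dots> = 4 * M \<xi>" using w by (simp add: B2)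
        finally show "?w * (cmod (q \<tau> \<xi>))\<^sup>2 \<le> 4 * M \<xi>" .
      qed
    qed
  qed
  moreover have "\<forall>\<^sub>F \<tau> in at t within {0..T}. D.distr_of (q \<tau>)
      = (\<lambda>\<phi>. (D.distr_of (\<lambda>\<xi>. y \<xi> \<tau>) \<phi> - D.distr_of (\<lambda>\<xi>. y \<xi> t) \<phi>) / of_real (\<tau> - t) - D.distr_of (\<lambda>\<xi>. y' \<xi> t) \<phi>)"
    using eventually_at_within_mem[of "{0..T}" t]
  proof eventually_elim
    fix \<tau> assume \<tau>: "\<tau> \<in> {0..T}"
    let ?c = "inverse (of_real (\<tau> - t)) :: complex"
    have w1: "E.weighted_summable s (\<lambda>\<xi>. y \<xi> \<tau> + - 1 * y \<xi> t)"
      by (intro weighted_summable_add weighted_summable_scale ws \<tau> t)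
    have "q \<tau> = (\<lambda>\<xi>. - 1 * y' \<xi> t + ?c * (y \<xi> \<tau> + - 1 * y \<xi> t))"
      by (auto simp: q_def divide_inverse mult.commute)
    then have "D.distr_of (q \<tau>) = (\<lambda>\<phi>. D.distr_of (\<lambda>\<xi>. - 1 * y' \<xi> t) \<phi> + ?c * D.distr_of (\<lambda>\<xi>. y \<xi> \<tau> + - 1 * y \<xi> t) \<phi>)"
      using distr_of_lin[OF weighted_summable_scale[OF ws', of "- 1"] w1, of ?c] by simp
    moreover have "D.distr_of (\<lambda>\<xi>. y \<xi> \<tau> + - 1 * y \<xi> t) = (\<lambda>\<phi>. D.distr_of (\<lambda>\<xi>. y \<xi> \<tau>) \<phi> + - 1 * D.distr_of (\<lambda>\<xi>. y \<xi> t) \<phi>)"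
      by (rule distr_of_lin[OF ws[OF \<tau>] ws[OF t]])
    \<comment> \<open>The coefficient - 2 writes - y' as y' - 2 y', to fit
      \<open>distr_of_lin\<close>.\<close>
    moreover have "D.distr_of (\<lambda>\<xi>. - 1 * y' \<xi> t) = (\<lambda>\<phi>. - D.distr_of (\<lambda>\<xi>. y' \<xi> t) \<phi>)"
      using distr_of_lin[OF ws' ws', of "- 2"] by simp
    ultimately show "D.distr_of (q \<tau>)
      = (\<lambda>\<phi>. (D.distr_of (\<lambda>\<xi>. y \<xi> \<tau>) \<phi> - D.distr_of (\<lambda>\<xi>. y \<xi> t) \<phi>) / of_real (\<tau> - t) - D.distr_of (\<lambda>\<xi>. y' \<xi> t) \<phi>)"
      by (simp add: divide_inverse mult.commute)
  qed
  ultimately show "((\<lambda>\<tau>. Hs_norm h V s (\<lambda>\<phi>. (D.distr_of (\<lambda>\<xi>. y \<xi> \<tau>) \<phi> - D.distr_of (\<lambda>\<xi>. y \<xi> t) \<phi>) / of_real (\<tau> - t)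
      - D.distr_of (\<lambda>\<xi>. y' \<xi> t) \<phi>)) \<longlongrightarrow> 0) (at t within {0..T})"
    by (rule Lim_transform_eventually[OF _ eventually_mono]) simp
qed

end

subsection \<open>Coefficients and forcing term\<close>

text \<open>Turns an almost everywhere statement into an exceptional set that the gauge integral can
  ignore.\<close>

lemma AE_interval_null:
  fixes T :: real
  assumes "AE t in lebesgue_on {0..T}. P t"
  obtains N where "N \<in> sets (lebesgue_on {0..T})" "negligible N" "\<And>t. t \<in> {0..T} \<Longrightarrow> t \<notin> N \<Longrightarrow> P t"
proof -
  obtain N where N: "{x \<in> space (lebesgue_on {0..T}). \<not> P x} \<subseteq> N" "emeasure (lebesgue_on {0..T}) N = 0"
    "N \<in> sets (lebesgue_on {0..T})"
    using AE_E[OF assms] by metis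
  then have "N \<in> null_sets (lebesgue_on {0..T})" by auto
  then have "negligible N"
    using null_sets_restrict_space[of "{0..T}" lebesgue N] by (simp add: negligible_iff_null_sets)
  then show ?thesis using N that by auto
qed

lemma not_negligible_interval: "l < (r::real) \<Longrightarrow> \<not> negligible {l..r}"
  using negligible_interval(1)[of l r] by simp

lemma AE_interval_nontrivial:
  fixes T :: real
  assumes "0 < T" "AE t in lebesgue_on {0..T}. P t"
  obtains t where "t \<in> {0..T}" "P t"
proof -
  obtain N where "negligible N" "\<And>t. t \<in> {0..T} \<Longrightarrow> t \<notin> N \<Longrightarrow> P t"
    using AE_interval_null[OF assms(2)] by metis
  then show ?thesis
    using not_negligible_interval[OF assms(1)] negligible_subset that by (metis subsetI)
qed

lemma AE_lebesgue_on_mem: "AE t in lebesgue_on {0..T}. t \<in> {0..T::real}"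
  by (rule AE_I2) simp

text \<open>A violation at t persists on a neighbourhood of t, and even when clipped to {0..T} that
  has positive length. The essential bound on \<open>a\<close> thereby becomes a bound at every
  time.\<close>

lemma continuous_AE_le:
  fixes a :: "real \<Rightarrow> real"
  assumes c: "continuous_on {0..T} a" and T: "0 < T" and ae: "AE t in lebesgue_on {0..T}. a t \<le> A"
    and t: "t \<in> {0..T}"
  shows "a t \<le> A"
proof (rule ccontr)
  assume "\<not> a t \<le> A"
  then obtain d where d: "0 < d" "\<And>x. x \<in> {0..T} \<Longrightarrow> dist x t < d \<Longrightarrow> dist (a x) (a t) < a t - A"
    using c t unfolding continuous_on_iff by (metis diff_gt_0_iff_gt not_le)
  obtain N where N: "negligible N" "\<And>t. t \<in> {0..T} \<Longrightarrow> t \<notin> N \<Longrightarrow> a t \<le> A"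
    using AE_interval_null[OF ae] by metis
  define l where "l = max 0 (t - d / 2)"
  define r where "r = min T (t + d / 2)"
  have lr: "l < r" using t T d(1) by (auto simp: l_def r_def)
  have "{l..r} \<subseteq> N"
  proof
    fix x assume x: "x \<in> {l..r}"
    then have "x \<in> {0..T}" "dist x t < d"
      using d(1) by (auto simp: l_def r_def dist_real_def abs_less_iff)
    with d(2)[of x] have "\<not> a x \<le> A" by (auto simp: dist_real_def)
    then show "x \<in> N" using N(2) \<open>x \<in> {0..T}\<close> by blast
  qed
  then show False using not_negligible_interval[OF lr] N(1) negligible_subset by blast
qed

lemma L_infty_AE_bound:
  assumes "L_infty T g"
  shows "AE t in lebesgue_on {0..T}. \<bar>g t\<bar> \<le> L_infty_norm T g"
  using esssup_AE[of "\<lambda>t. ereal \<bar>g t\<bar>" "lebesgue_on {0..T}"]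
proof eventually_elim
  fix t assume "ereal \<bar>g t\<bar> \<le> esssup (lebesgue_on {0..T}) (\<lambda>t. ereal \<bar>g t\<bar>)"
  moreover have "esssup (lebesgue_on {0..T}) (\<lambda>t. ereal \<bar>g t\<bar>) < \<infinity>"
    using assms by (simp add: L_infty_def)
  ultimately show "\<bar>g t\<bar> \<le> L_infty_norm T g"
    unfolding L_infty_norm_def
    by (cases "esssup (lebesgue_on {0..T}) (\<lambda>t. ereal \<bar>g t\<bar>)") auto
qed

lemma L_infty_norm_nonneg: "0 < T \<Longrightarrow> L_infty T g \<Longrightarrow> 0 \<le> L_infty_norm T g"
  using AE_interval_nontrivial[OF _ L_infty_AE_bound] by (metis abs_ge_zero order_trans)

lemma L_infty_measurable: "L_infty T g \<Longrightarrow> g \<in> borel_measurable (lebesgue_on {0..T})"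
  by (simp add: L_infty_def)

lemma L_infty_absolutely_integrable:
  assumes "L_infty T g"
  shows "g absolutely_integrable_on {0..T}"
proof -
  interpret finite_measure "lebesgue_on {0..T}"
    by (rule finite_measure_lebesgue_on) simp
  show ?thesis
    unfolding absolutely_integrable_iff_lebesgue_on
    using L_infty_AE_bound[OF assms] L_infty_measurable[OF assms]
    by (intro integrable_const_bound[where B="L_infty_norm T g"]) auto
qed

lemma L_infty_mult_continuous:
  fixes w :: "real \<Rightarrow> complex"
  assumes "L_infty T g" "continuous_on {0..T} w"
  shows "(\<lambda>t. of_real (g t) * w t) absolutely_integrable_on {0..T}"
  using absolutely_integrable_bilinear_continuous[OF bounded_bilinear.flip[OF bounded_bilinear_scaleR]
      assms(2) L_infty_absolutely_integrable[OF assms(1)]]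
  by (simp add: scaleR_conv_of_real)

lemma continuous_mult_absolutely_integrable:
  fixes g :: "real \<Rightarrow> complex"
  assumes "continuous_on {0..T} \<psi>" "g absolutely_integrable_on {0..T}"
  shows "(\<lambda>t. of_real (\<psi> t) * g t) absolutely_integrable_on {0..T}"
  using absolutely_integrable_bilinear_continuous[OF bounded_bilinear_scaleR assms]
  by (simp add: scaleR_conv_of_real)

lemma lebesgue_on_integral_eq:
  fixes g :: "real \<Rightarrow> 'a::euclidean_space"
  shows "g absolutely_integrable_on {a..b} \<Longrightarrow> integral\<^sup>L (lebesgue_on {a..b}) g = integral {a..b} g"
  unfolding absolutely_integrable_iff_lebesgue_on by (intro lebesgue_integral_eq_integral) auto

lemma integral_spike_AE:
  fixes g :: "real \<Rightarrow> 'a::euclidean_space"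
  assumes "AE t in lebesgue_on {0..T}. g' t = g t" "g absolutely_integrable_on {0..T}"
  shows "g' absolutely_integrable_on {0..T}" "integral {0..T} g' = integral {0..T} g"
proof -
  obtain N where N: "negligible N" "\<And>t. t \<in> {0..T} \<Longrightarrow> t \<notin> N \<Longrightarrow> g' t = g t"
    using AE_interval_null[OF assms(1)] by metis
  show "g' absolutely_integrable_on {0..T}"
    by (rule absolutely_integrable_spike[OF assms(2) N(1)]) (use N(2) in auto)
  show "integral {0..T} g' = integral {0..T} g"
    by (rule integral_spike[OF N(1)]) (use N(2) in auto)
qed

text \<open>Interchange of sum and integral under majorants \<open>B i\<close> with summable
  integrals; it carries the weak equations of the modes over to their sum.\<close>

lemma termwise_integral_zero:
  fixes G :: "nat \<Rightarrow> real \<Rightarrow> complex" and B :: "nat \<Rightarrow> real \<Rightarrow> real"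
  assumes G: "\<And>i. G i absolutely_integrable_on {0..T}" "\<And>i. integral {0..T} (G i) = 0"
    and B: "\<And>i. B i absolutely_integrable_on {0..T}" "summable (\<lambda>i. integral {0..T} (B i))"
    and bound: "AE t in lebesgue_on {0..T}. summable (\<lambda>i. B i t) \<and> (\<forall>i. cmod (G i t) \<le> B i t)"
    and S: "AE t in lebesgue_on {0..T}. (\<lambda>i. G i t) sums S t" "S absolutely_integrable_on {0..T}"
  shows "integral\<^sup>L (lebesgue_on {0..T}) S = 0"
proof -
  let ?M = "lebesgue_on {0..T}"
  have Gi: "integrable ?M (G i)" and Bi: "integrable ?M (B i)" for i
    using G(1) B(1) by (simp_all add: absolutely_integrable_iff_lebesgue_on)
  have 1: "AE t in ?M. summable (\<lambda>i. norm (G i t))"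
    using bound by eventually_elim (auto intro: summable_comparison_test'[of _ 0])
  have 2: "summable (\<lambda>i. LINT t|?M. norm (G i t))"
  proof (rule summable_comparison_test'[OF B(2), of 0])
    fix i
    have "(LINT t|?M. norm (G i t)) \<le> (LINT t|?M. B i t)"
    proof (intro integral_mono_AE integrable_norm Gi Bi)
      show "AE t in ?M. norm (G i t) \<le> B i t" using bound by eventually_elim auto
    qed
    then show "norm (LINT t|?M. norm (G i t)) \<le> integral {0..T} (B i)"
      by (simp add: lebesgue_on_integral_eq[OF B(1)] integral_nonneg_AE)
  qed
  have "integral\<^sup>L ?M S = (LINT t|?M. (\<Sum>i. G i t))"
  proof (rule integral_cong_AE)
    show "S \<in> borel_measurable ?M"
      using S(2) by (simp add: absolutely_integrable_iff_lebesgue_on borel_measurable_integrable)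
    show "(\<lambda>t. \<Sum>i. G i t) \<in> borel_measurable ?M"
      using integrable_suminf[OF Gi 1 2] by (rule borel_measurable_integrable)
    show "AE t in ?M. S t = (\<Sum>i. G i t)"
      using S(1) by eventually_elim (simp add: sums_iff)
  qed
  also have "\<dots> = (\<Sum>i. integral\<^sup>L ?M (G i))" by (rule integral_suminf[OF Gi 1 2])
  also have "\<dots> = 0" by (simp add: lebesgue_on_integral_eq[OF G(1)] G(2))
  finally show ?thesis .
qed

section \<open>The forcing term in Fourier coefficients\<close>

context confining_operator
begin

text \<open>Evaluation at a smooth vector is continuous on \<open>H^s\<close>, so it maps the
  approximating simple functions to simple functions that converge almost everywhere: this gives
  measurability. Integrability comes from the pairing bound.\<close>

lemma L2_Hs_pairing_integrable:
  assumes f: "L2_Hs h V T s f" and \<phi>: "\<phi> \<in> H_inf h V"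
  shows "(\<lambda>t. f t \<phi>) absolutely_integrable_on {0..T}"
    "(\<lambda>t. (cmod (f t \<phi>))\<^sup>2) absolutely_integrable_on {0..T}"
proof -
  let ?M = "lebesgue_on {0..T}"
  obtain \<sigma> where simple: "\<And>i. simple_function ?M (\<sigma> i)" and \<sigma>: "\<And>i. \<sigma> i ` {0..T} \<subseteq> Hs h V s"
    and lim: "AE t in ?M. (\<lambda>i. Hs_norm h V s (\<lambda>\<phi>. \<sigma> i t \<phi> - f t \<phi>)) \<longlonglongrightarrow> 0"
    and mem: "AE t in ?M. f t \<in> Hs h V s"
    and sq: "integrable ?M (\<lambda>t. (Hs_norm h V s (f t))\<^sup>2)"
    using f unfolding L2_Hs_def by blast
  define C where "C = sqrt (\<Sum>\<xi>. (1 + eigval h V \<xi>) powr (- s) * (cmod (D.coef \<phi> \<xi>))\<^sup>2)"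
  have "summable (\<lambda>\<xi>. (1 + eigval h V \<xi>) powr (- s) * (cmod (D.coef \<phi> \<xi>))\<^sup>2)"
    using D.rapid_imp_weighted_summable[OF D.H_inf_rapid[OF \<phi>], of "- s"] by (simp add: D.weighted_summable_def)
  then have C0: "0 \<le> C" unfolding C_def by (simp add: suminf_nonneg)
  have ae: "AE t in ?M. (\<lambda>i. \<sigma> i t \<phi>) \<longlonglongrightarrow> f t \<phi> \<and> cmod (f t \<phi>) \<le> C * Hs_norm h V s (f t)"
    using lim mem AE_lebesgue_on_mem
  proof eventually_elim
    fix t assume l: "(\<lambda>i. Hs_norm h V s (\<lambda>\<phi>. \<sigma> i t \<phi> - f t \<phi>)) \<longlonglongrightarrow> 0" and ft: "f t \<in> Hs h V s" and t: "t \<in> {0..T}"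
    have "\<sigma> i t \<in> Hs h V s" for i using \<sigma>[of i] t by blast
    then show "(\<lambda>i. \<sigma> i t \<phi>) \<longlonglongrightarrow> f t \<phi> \<and> cmod (f t \<phi>) \<le> C * Hs_norm h V s (f t)"
      using Hs_tendsto_pairing[OF \<phi> _ ft l] Hs_pairing_bound[OF ft \<phi>] by (auto simp: C_def)
  qed
  obtain N where N: "N \<in> sets ?M" "negligible N"
    and NP: "\<And>t. t \<in> {0..T} \<Longrightarrow> t \<notin> N \<Longrightarrow> (\<lambda>i. \<sigma> i t \<phi>) \<longlonglongrightarrow> f t \<phi> \<and> cmod (f t \<phi>) \<le> C * Hs_norm h V s (f t)"
    by (rule AE_interval_null[OF ae], rule that)
  note Nl = conjunct1[OF NP] and Nb = conjunct2[OF NP]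
  \<comment> \<open>Convergence and bound fail on a null set at most; setting the function to 0
    there makes them hold everywhere, and the change is undone at the end.\<close>
  define g where "g t = (if t \<in> N then 0 else f t \<phi>)" for t
  have gm: "g \<in> borel_measurable ?M"
  proof (rule borel_measurable_LIMSEQ_metric)
    fix i
    have "(\<lambda>t. \<sigma> i t \<phi>) \<in> borel_measurable ?M"
      by (intro borel_measurable_simple_function simple_function_compose1[OF simple[of i], of "\<lambda>w. w \<phi>"])
    then show "(\<lambda>t. if t \<in> N then 0 else \<sigma> i t \<phi>) \<in> borel_measurable ?M"
      using N(1) by (intro measurable_If_set) (auto simp: sets.Int_space_eq2)
  next
    show "(\<lambda>i. if t \<in> N then 0 else \<sigma> i t \<phi>) \<longlonglongrightarrow> g t" if "t \<in> space ?M" for t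
      using Nl[of t] that by (auto simp: g_def)
  qed
  have sqi: "(\<lambda>t. (Hs_norm h V s (f t))\<^sup>2) absolutely_integrable_on {0..T}"
    using sq by (simp add: absolutely_integrable_iff_lebesgue_on)
  have gb: "cmod (g t) \<le> C * Hs_norm h V s (f t)" if "t \<in> {0..T}" for t
    using Nb[OF that] C0 by (auto simp: g_def)
  have g1: "g absolutely_integrable_on {0..T}"
  proof (rule measurable_bounded_by_integrable_imp_absolutely_integrable[OF gm])
    have "(\<lambda>t. 1 :: real) absolutely_integrable_on {0..T}" by (intro continuous_absolutely_integrable continuous_intros)
    then have "(\<lambda>t. C * (1 + (Hs_norm h V s (f t))\<^sup>2)) absolutely_integrable_on {0..T}"
      by (intro set_integrable_mult_right set_integral_add(1) sqi) 
    then show "(\<lambda>t. C * (1 + (Hs_norm h V s (f t))\<^sup>2)) integrable_on {0..T}"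
      by (rule set_lebesgue_integral_eq_integral(1))
    fix t assume t: "t \<in> {0..T}"
    let ?x = "Hs_norm h V s (f t)"
    \<comment> \<open>The norm is dominated by 1 plus its square, the square being what is known to
      be integrable.\<close>
    have "2 * ?x \<le> ?x\<^sup>2 + 1" using sum_squares_bound[of ?x 1] by simp
    then have "?x \<le> 1 + ?x\<^sup>2" using Hs_norm_nonneg[of s "f t"] by linarith
    then have "C * ?x \<le> C * (1 + ?x\<^sup>2)" by (rule mult_left_mono[OF _ C0])
    then show "cmod (g t) \<le> C * (1 + ?x\<^sup>2)" using gb[OF t] by linarith
  qed simp
  have g2: "(\<lambda>t. (cmod (g t))\<^sup>2) absolutely_integrable_on {0..T}"
  proof (rule measurable_bounded_by_integrable_imp_absolutely_integrable)
    show "(\<lambda>t. (cmod (g t))\<^sup>2) \<in> borel_measurable ?M" using gm by measurable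
    show "(\<lambda>t. C\<^sup>2 * (Hs_norm h V s (f t))\<^sup>2) integrable_on {0..T}"
      by (intro set_lebesgue_integral_eq_integral(1) set_integrable_mult_right sqi)
    show "norm ((cmod (g t))\<^sup>2) \<le> C\<^sup>2 * (Hs_norm h V s (f t))\<^sup>2" if "t \<in> {0..T}" for t
      using power_mono[OF gb[OF that], of 2] by (simp add: power_mult_distrib)
  qed simp
  show "(\<lambda>t. f t \<phi>) absolutely_integrable_on {0..T}"
    by (rule absolutely_integrable_spike[OF g1 N(2)]) (simp add: g_def)
  show "(\<lambda>t. (cmod (f t \<phi>))\<^sup>2) absolutely_integrable_on {0..T}"
    by (rule absolutely_integrable_spike[OF g2 N(2)]) (simp add: g_def)
qed

text \<open>Under the integral a finite partial sum is at most the squared norm of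
  \<open>f t\<close> for almost every t. The terms are nonnegative, so these bounds give both the
  summability and the estimate.\<close>

lemma L2_Hs_norm_sums:
  assumes f: "L2_Hs h V T s f"
  shows "summable (\<lambda>\<xi>. (1 + eigval h V \<xi>) powr s * integral {0..T} (\<lambda>t. (cmod (hat (f t) \<xi>))\<^sup>2))"
    "(\<Sum>\<xi>. (1 + eigval h V \<xi>) powr s * integral {0..T} (\<lambda>t. (cmod (hat (f t) \<xi>))\<^sup>2)) \<le> (L2_Hs_norm h V T s f)\<^sup>2"
proof -
  let ?M = "lebesgue_on {0..T}"
  let ?c = "\<lambda>\<xi>. (1 + eigval h V \<xi>) powr s * integral {0..T} (\<lambda>t. (cmod (hat (f t) \<xi>))\<^sup>2)"
  have mem: "AE t in ?M. f t \<in> Hs h V s" and sq: "integrable ?M (\<lambda>t. (Hs_norm h V s (f t))\<^sup>2)"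
    using f unfolding L2_Hs_def by auto
  have i: "(\<lambda>t. (cmod (hat (f t) \<xi>))\<^sup>2) absolutely_integrable_on {0..T}" for \<xi>
    unfolding hat_def by (rule L2_Hs_pairing_integrable(2)[OF f D.H_inf_b])
  then have i': "integrable ?M (\<lambda>t. (cmod (hat (f t) \<xi>))\<^sup>2)" for \<xi>
    by (simp add: absolutely_integrable_iff_lebesgue_on)
  have nn: "0 \<le> ?c \<xi>" for \<xi>
    by (intro mult_nonneg_nonneg Henstock_Kurzweil_Integration.integral_nonneg set_lebesgue_integral_eq_integral(1)[OF i]) auto
  have le: "(\<Sum>\<xi><N. ?c \<xi>) \<le> (L2_Hs_norm h V T s f)\<^sup>2" for N
  proof -
    have "(\<Sum>\<xi><N. ?c \<xi>) = (LINT t|?M. (\<Sum>\<xi><N. (1 + eigval h V \<xi>) powr s * (cmod (hat (f t) \<xi>))\<^sup>2))"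
      using i' by (simp add: lebesgue_on_integral_eq[OF i, symmetric])
    also have "\<dots> \<le> (LINT t|?M. (Hs_norm h V s (f t))\<^sup>2)"
    proof (rule integral_mono_AE[OF _ sq])
      show "AE t in ?M. (\<Sum>\<xi><N. (1 + eigval h V \<xi>) powr s * (cmod (hat (f t) \<xi>))\<^sup>2) \<le> (Hs_norm h V s (f t))\<^sup>2"
        using mem
      proof eventually_elim
        fix t assume "f t \<in> Hs h V s"
        note s = Hs_norm_sums[OF this]
        have "(\<Sum>\<xi><N. (1 + eigval h V \<xi>) powr s * (cmod (hat (f t) \<xi>))\<^sup>2) \<le> (\<Sum>\<xi>. (1 + eigval h V \<xi>) powr s * (cmod (hat (f t) \<xi>))\<^sup>2)"
          by (rule sum_le_suminf[OF sums_summable[OF s]]) auto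
        then show "(\<Sum>\<xi><N. (1 + eigval h V \<xi>) powr s * (cmod (hat (f t) \<xi>))\<^sup>2) \<le> (Hs_norm h V s (f t))\<^sup>2"
          using s by (simp add: sums_iff)
      qed
    qed (use i' in auto)
    also have "\<dots> = (L2_Hs_norm h V T s f)\<^sup>2" by (simp add: L2_Hs_norm_def integral_nonneg_AE)
    finally show ?thesis .
  qed
  show s: "summable ?c"
    by (rule summableI_nonneg_bounded[OF nn le])
  show "(\<Sum>\<xi>. ?c \<xi>) \<le> (L2_Hs_norm h V T s f)\<^sup>2"
    by (rule suminf_le_const[OF s le])
qed

end

subsection \<open>The wave equation\<close>

lemma C0_Hs_cong: "(\<And>t. t \<in> {0..T} \<Longrightarrow> u t = w t) \<Longrightarrow> C0_Hs h V T s u \<longleftrightarrow> C0_Hs h V T s w"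
proof -
  have *: "C0_Hs h V T s w" if eq: "\<And>t. t \<in> {0..T} \<Longrightarrow> u t = w t" and u: "C0_Hs h V T s u" for u w
    unfolding C0_Hs_def
  proof (intro ballI conjI)
    fix t assume t: "t \<in> {0..T}"
    have "u t \<in> Hs h V s" using u t by (auto simp: C0_Hs_def)
    then show "w t \<in> Hs h V s" unfolding eq[OF t] .
    have "\<forall>\<^sub>F \<tau> in at t within {0..T}. Hs_norm h V s (\<lambda>\<phi>. u \<tau> \<phi> - u t \<phi>) = Hs_norm h V s (\<lambda>\<phi>. w \<tau> \<phi> - w t \<phi>)"
      using eventually_at_within_mem[of "{0..T}" t] by eventually_elim (simp add: eq eq[OF t])
    then show "((\<lambda>\<tau>. Hs_norm h V s (\<lambda>\<phi>. w \<tau> \<phi> - w t \<phi>)) \<longlongrightarrow> 0) (at t within {0..T})"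
      using u t by (intro Lim_transform_eventually[OF _ \<open>eventually _ _\<close>]) (auto simp: C0_Hs_def)
  qed
  show "(\<And>t. t \<in> {0..T} \<Longrightarrow> u t = w t) \<Longrightarrow> C0_Hs h V T s u \<longleftrightarrow> C0_Hs h V T s w"
    using *[of u w] *[of w u] by metis
qed

section \<open>Energy estimate, uniqueness and existence\<close>

locale wave_problem = confining_operator h V
  for h :: real and V :: "real ^ 'n::finite \<Rightarrow> real" +
  fixes T s a0 :: real and a q :: "real \<Rightarrow> real" and f :: "real \<Rightarrow> 'n distr" and u0 u1 :: "'n distr"
  assumes T_pos: "0 < T" and f_L2: "L2_Hs h V T s f" and a_diff: "L_infty_diff 1 T a"
    and a_inf: "(INF t\<in>{0..T}. a t) = a0" and a0_pos: "0 < a0" and q_bounded: "L_infty T q"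
    and u0_Hs: "u0 \<in> Hs h V (1 + s)" and u1_Hs: "u1 \<in> Hs h V s"
begin

text \<open>The constant C_T of the estimate.\<close>

definition wave_const :: real where
  "wave_const = inverse (min a0 1) * (1 + L_infty_norm T a) *
     exp (inverse (min a0 1) * (1 + L_infty_norm T (time_deriv T a) + L_infty_norm T q + 2 * L_infty_norm T a) * T)"

lemma a_L_infty: "L_infty T a" and a'_L_infty: "L_infty T (time_deriv T a)"
  and a_differentiable: "t \<in> {0..T} \<Longrightarrow> a differentiable (at t within {0..T})"
  using a_diff unfolding L_infty_diff_def by (auto simp: le_Suc_eq)

lemma a_primitive: "primitive T (time_deriv T a) a"
proof (rule primitive_deriv[OF _ L_infty_absolutely_integrable[OF a'_L_infty]])
  show "(a has_vector_derivative time_deriv T a t) (at t within {0..T})" if "t \<in> {0..T}" for t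
    unfolding time_deriv_def using a_differentiable[OF that] by (simp add: vector_derivative_works)
qed

lemma a_continuous: "continuous_on {0..T} a"
  by (rule primitive_continuous[OF a_primitive])

lemma a_bounds:
  assumes "t \<in> {0..T}"
  shows "a0 \<le> a t \<and> a t \<le> L_infty_norm T a"
proof
  have "bdd_below (a ` {0..T})"
    by (rule bounded_imp_bdd_below[OF compact_imp_bounded[OF compact_continuous_image[OF a_continuous compact_Icc]]])
  then show "a0 \<le> a t" unfolding a_inf[symmetric] using assms by (rule cINF_lower)
  have "AE t in lebesgue_on {0..T}. a t \<le> L_infty_norm T a"
    using L_infty_AE_bound[OF a_L_infty] by eventually_elim simp
  then show "a t \<le> L_infty_norm T a" by (rule continuous_AE_le[OF a_continuous T_pos _ assms])
qed

lemma mode_estimate: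
  fixes v v' g F :: "real \<Rightarrow> complex"
  assumes v: "primitive T v' v" and v': "primitive T g v'"
    and g: "AE t in lebesgue_on {0..T}. g t = F t - of_real (a t * l + q t) * v t"
    and F: "(\<lambda>t. (cmod (F t))\<^sup>2) absolutely_integrable_on {0..T}" and l: "0 \<le> l" and t: "t \<in> {0..T}"
  shows "(1 + l) * (cmod (v t))\<^sup>2 + (cmod (v' t))\<^sup>2
    \<le> wave_const * ((1 + l) * (cmod (v 0))\<^sup>2 + (cmod (v' 0))\<^sup>2 + integral {0..T} (\<lambda>t. (cmod (F t))\<^sup>2))"
proof -
  let ?A = "L_infty_norm T a" and ?A' = "L_infty_norm T (time_deriv T a)" and ?Q = "L_infty_norm T q"
  let ?c = "min a0 1"
  note nn = L_infty_norm_nonneg[OF T_pos a_L_infty] L_infty_norm_nonneg[OF T_pos a'_L_infty]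
    L_infty_norm_nonneg[OF T_pos q_bounded]
  have c: "0 < ?c" using a0_pos by simp
  have T0: "0 \<in> {0..T}" using T_pos by simp
  have Fi: "(\<lambda>t. (cmod (F t))\<^sup>2) integrable_on {0..T}" by (rule set_lebesgue_integral_eq_integral(1)[OF F])
  let ?R = "(1 + l) * (cmod (v 0))\<^sup>2 + (cmod (v' 0))\<^sup>2 + integral {0..T} (\<lambda>t. (cmod (F t))\<^sup>2)"
  have "?c * ((1 + l) * (cmod (v t))\<^sup>2 + (cmod (v' t))\<^sup>2)
    \<le> exp (inverse ?c * (1 + ?A' + ?Q + ?A) * t) *
       (a 0 * (1 + l) * (cmod (v 0))\<^sup>2 + (cmod (v' 0))\<^sup>2 + integral {0..t} (\<lambda>t. (cmod (F t))\<^sup>2))"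
    by (rule mode_energy_estimate[OF a_primitive a0_pos a_bounds L_infty_AE_bound[OF a'_L_infty]
          L_infty_AE_bound[OF q_bounded] v v' g F l nn(2,3) t])
  \<comment> \<open>The factor 1 + A covers a(0) \<le> A in front of the first initial term and the
    coefficient 1 of the other two terms. In the exponent A is enlarged to 2 A and t to T.\<close>
  also have "\<dots> \<le> exp (inverse ?c * (1 + ?A' + ?Q + 2 * ?A) * T) * ((1 + ?A) * ?R)"
  proof (rule mult_mono)
    have "inverse ?c * (1 + ?A' + ?Q + ?A) * t \<le> inverse ?c * (1 + ?A' + ?Q + 2 * ?A) * T"
      using t c nn by (intro mult_mono mult_left_mono) auto
    then show "exp (inverse ?c * (1 + ?A' + ?Q + ?A) * t) \<le> exp (inverse ?c * (1 + ?A' + ?Q + 2 * ?A) * T)" by simp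
    have sub: "{0..t} \<subseteq> {0..T}" using t by auto
    have i0: "0 \<le> integral {0..T} (\<lambda>t. (cmod (F t))\<^sup>2)"
      by (rule Henstock_Kurzweil_Integration.integral_nonneg[OF Fi]) simp
    have "integral {0..t} (\<lambda>t. (cmod (F t))\<^sup>2) \<le> integral {0..T} (\<lambda>t. (cmod (F t))\<^sup>2)"
      by (rule integral_subset_le[OF sub integrable_on_subinterval[OF Fi sub] Fi]) simp
    also have "\<dots> \<le> (1 + ?A) * integral {0..T} (\<lambda>t. (cmod (F t))\<^sup>2)"
      using mult_right_mono[of 1 "1 + ?A", OF _ i0] nn(1) by simp
    finally have 1: "integral {0..t} (\<lambda>t. (cmod (F t))\<^sup>2) \<le> (1 + ?A) * integral {0..T} (\<lambda>t. (cmod (F t))\<^sup>2)" .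
    have 2: "a 0 * ((1 + l) * (cmod (v 0))\<^sup>2) \<le> (1 + ?A) * ((1 + l) * (cmod (v 0))\<^sup>2)"
      using a_bounds[OF T0] l by (intro mult_right_mono) auto
    have 3: "1 * (cmod (v' 0))\<^sup>2 \<le> (1 + ?A) * (cmod (v' 0))\<^sup>2"
      using nn(1) by (intro mult_right_mono) auto
    show "a 0 * (1 + l) * (cmod (v 0))\<^sup>2 + (cmod (v' 0))\<^sup>2 + integral {0..t} (\<lambda>t. (cmod (F t))\<^sup>2) \<le> (1 + ?A) * ?R"
      using add_mono[OF add_mono[OF 2 3] 1] by (simp only: distrib_left[of "1 + ?A"] mult.assoc[of "a 0"] mult_1_left)
    show "0 \<le> a 0 * (1 + l) * (cmod (v 0))\<^sup>2 + (cmod (v' 0))\<^sup>2 + integral {0..t} (\<lambda>t. (cmod (F t))\<^sup>2)"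
      using a_bounds[OF T0] a0_pos l
      by (intro add_nonneg_nonneg mult_nonneg_nonneg Henstock_Kurzweil_Integration.integral_nonneg
          integrable_on_subinterval[OF Fi sub]) auto
  qed simp
  finally have le: "inverse ?c * (?c * ((1 + l) * (cmod (v t))\<^sup>2 + (cmod (v' t))\<^sup>2))
      \<le> inverse ?c * (exp (inverse ?c * (1 + ?A' + ?Q + 2 * ?A) * T) * ((1 + ?A) * ?R))"
    using c by (intro mult_left_mono) auto
  have cancel: "inverse ?c * (?c * x) = x" for x using c by (simp add: mult.assoc[symmetric])
  show ?thesis using le[unfolded cancel] unfolding wave_const_def by (simp only: mult_ac)
qed

lemma wave_const_nonneg: "0 \<le> wave_const"
  unfolding wave_const_def using a0_pos L_infty_norm_nonneg[OF T_pos a_L_infty] by simp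

text \<open>Independent of t, so it is both the termwise energy bound for any solution and the
  dominating series in the construction of one.\<close>

definition mode_bound :: "nat \<Rightarrow> real" where
  "mode_bound \<xi> = wave_const * ((1 + eigval h V \<xi>) powr (1 + s) * (cmod (hat u0 \<xi>))\<^sup>2
     + (1 + eigval h V \<xi>) powr s * (cmod (hat u1 \<xi>))\<^sup>2
     + (1 + eigval h V \<xi>) powr s * integral {0..T} (\<lambda>t. (cmod (hat (f t) \<xi>))\<^sup>2))"

lemma mode_bound_sum:
  "summable mode_bound"
  "suminf mode_bound \<le> wave_const * ((Hs_norm h V (1 + s) u0)\<^sup>2 + (Hs_norm h V s u1)\<^sup>2 + (L2_Hs_norm h V T s f)\<^sup>2)"
proof -
  have "mode_bound sums (wave_const * ((Hs_norm h V (1 + s) u0)\<^sup>2 + (Hs_norm h V s u1)\<^sup>2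
      + (\<Sum>\<xi>. (1 + eigval h V \<xi>) powr s * integral {0..T} (\<lambda>t. (cmod (hat (f t) \<xi>))\<^sup>2))))"
    unfolding mode_bound_def[abs_def]
    by (intro sums_mult sums_add Hs_norm_sums u0_Hs u1_Hs summable_sums L2_Hs_norm_sums(1)[OF f_L2])
  moreover have "wave_const * ((Hs_norm h V (1 + s) u0)\<^sup>2 + (Hs_norm h V s u1)\<^sup>2
      + (\<Sum>\<xi>. (1 + eigval h V \<xi>) powr s * integral {0..T} (\<lambda>t. (cmod (hat (f t) \<xi>))\<^sup>2)))
      \<le> wave_const * ((Hs_norm h V (1 + s) u0)\<^sup>2 + (Hs_norm h V s u1)\<^sup>2 + (L2_Hs_norm h V T s f)\<^sup>2)"
    using L2_Hs_norm_sums(2)[OF f_L2] wave_const_nonneg by (intro mult_left_mono add_left_mono) auto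
  ultimately show "summable mode_bound"
    "suminf mode_bound \<le> wave_const * ((Hs_norm h V (1 + s) u0)\<^sup>2 + (Hs_norm h V s u1)\<^sup>2 + (L2_Hs_norm h V T s f)\<^sup>2)"
    by (auto simp: sums_iff)
qed

lemma hat_forcing_integrable:
  "(\<lambda>t. hat (f t) \<xi>) absolutely_integrable_on {0..T}"
  "(\<lambda>t. (cmod (hat (f t) \<xi>))\<^sup>2) absolutely_integrable_on {0..T}"
  unfolding hat_def by (rule L2_Hs_pairing_integrable[OF f_L2 D.H_inf_b])+

lemma weighted_mode_estimate:
  assumes v: "primitive T v' v" and v': "primitive T g v'"
    and g: "AE t in lebesgue_on {0..T}. g t = hat (f t) \<xi> - of_real (a t * eigval h V \<xi> + q t) * v t"
    and init: "v 0 = hat u0 \<xi>" "v' 0 = hat u1 \<xi>" and t: "t \<in> {0..T}"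
  shows "(1 + eigval h V \<xi>) powr (1 + s) * (cmod (v t))\<^sup>2 + (1 + eigval h V \<xi>) powr s * (cmod (v' t))\<^sup>2 \<le> mode_bound \<xi>"
proof -
  let ?n = "1 + eigval h V \<xi>"
  have n: "0 < ?n" using E.lam_nonneg[of \<xi>] by simp
  have p: "?n powr (1 + s) = ?n powr s * ?n" using n by (simp add: powr_add)
  have "?n powr s * (?n * (cmod (v t))\<^sup>2 + (cmod (v' t))\<^sup>2)
      \<le> ?n powr s * (wave_const * (?n * (cmod (v 0))\<^sup>2 + (cmod (v' 0))\<^sup>2 + integral {0..T} (\<lambda>t. (cmod (hat (f t) \<xi>))\<^sup>2)))"
    by (intro mult_left_mono mode_estimate[OF v v' g hat_forcing_integrable(2) E.lam_nonneg t]) simp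
  then show ?thesis unfolding mode_bound_def p init by (simp add: distrib_left mult_ac)
qed

text \<open>The conjugate eigenvector is itself an eigenvector of H, so testing with it turns the
  distributional equation into a weak scalar equation for one mode, to which
  \<open>weak_second_derivative\<close> applies.\<close>

lemma solution_modes:
  assumes u: "wave_solution h V T s a q f u0 u1 u"
  shows "primitive T (\<lambda>t. hat (Hs_deriv h V T s u t) \<xi>) (\<lambda>t. hat (u t) \<xi>)"
    "primitive T (\<lambda>t. hat (f t) \<xi> - of_real (a t * eigval h V \<xi> + q t) * hat (u t) \<xi>)
       (\<lambda>t. hat (Hs_deriv h V T s u t) \<xi>)"
proof -
  let ?\<phi> = "\<lambda>k. cnj (eigvec h V \<xi> k)"
  let ?l = "eigval h V \<xi>"
  have C1: "C1_Hs h V T s u" and we: "wave_equation h V T a q f u" and C0: "C0_Hs h V T s u"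
    using u by (auto simp: wave_solution_def C1_Hs_def)
  note p = C1_Hs_primitive[OF C1 T_pos D.H_inf_b[of \<xi>]]
  show p1: "primitive T (\<lambda>t. hat (Hs_deriv h V T s u t) \<xi>) (\<lambda>t. hat (u t) \<xi>)"
    unfolding hat_def by (rule p(1))
  have cu: "continuous_on {0..T} (\<lambda>t. u t ?\<phi>)" by (rule primitive_continuous[OF p(1)])
  have au: "(\<lambda>t. of_real (a t * ?l + q t) * u t ?\<phi>) absolutely_integrable_on {0..T}"
  proof -
    have "(\<lambda>t. of_real (a t) * (of_real ?l * u t ?\<phi>) + of_real (q t) * u t ?\<phi>) absolutely_integrable_on {0..T}"
      by (intro set_integral_add L_infty_mult_continuous a_L_infty q_bounded continuous_intros cu)
    then show ?thesis by (simp add: algebra_simps)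
  qed
  note fi = L2_Hs_pairing_integrable(1)[OF f_L2 D.H_inf_b[of \<xi>]]
  have gi: "(\<lambda>t. f t ?\<phi> - of_real (a t * ?l + q t) * u t ?\<phi>) absolutely_integrable_on {0..T}"
    by (rule set_integral_diff(1)[OF fi au])
  have Hu: "H_distr h V (u t) ?\<phi> = of_real ?l * u t ?\<phi>" if "t \<in> {0..T}" for t
  proof -
    have "u t \<in> H_minus_inf h V" using C0 that by (auto simp: C0_Hs_def intro: Hs_H_minus_inf)
    then show ?thesis using D.H_inf_b[of \<xi>] by (simp add: H_distr_def D.b_eigen H_minus_inf_def)
  qed
  have "primitive T (\<lambda>t. f t ?\<phi> - of_real (a t * ?l + q t) * u t ?\<phi>) (\<lambda>t. Hs_deriv h V T s u t ?\<phi>)"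
  proof (rule weak_second_derivative[OF T_pos p gi])
    fix \<psi> assume \<psi>: "test_function T \<psi>"
    note c\<psi> = test_function_continuous[OF \<psi>, of "{0..T}"]
      and c\<psi>'' = test_function_continuous[OF test_function_deriv[OF test_function_deriv[OF \<psi>]], of "{0..T}"]
    have 1: "(\<lambda>t. of_real (deriv (deriv \<psi>) t) * u t ?\<phi>) absolutely_integrable_on {0..T}"
      by (intro continuous_absolutely_integrable continuous_intros cu c\<psi>'')
    have 2: "(\<lambda>t. of_real (\<psi> t) * (of_real (a t * ?l + q t) * u t ?\<phi>)) absolutely_integrable_on {0..T}"
      by (rule continuous_mult_absolutely_integrable[OF c\<psi> au])
    have 3: "(\<lambda>t. of_real (\<psi> t) * f t ?\<phi>) absolutely_integrable_on {0..T}"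
      by (rule continuous_mult_absolutely_integrable[OF c\<psi> fi])
    note i1 = set_lebesgue_integral_eq_integral(1)[OF 1] and i2 = set_lebesgue_integral_eq_integral(1)[OF 2]
      and i3 = set_lebesgue_integral_eq_integral(1)[OF 3]
    have "integral {0..T} (\<lambda>t. of_real (deriv (deriv \<psi>) t) * u t ?\<phi> + of_real (\<psi> t) * (of_real (a t * ?l + q t) * u t ?\<phi>))
        = (LINT t|lebesgue_on {0..T}. of_real ((deriv ^^ 2) \<psi> t) * u t ?\<phi>
            + of_real (\<psi> t) * (of_real (a t) * H_distr h V (u t) ?\<phi> + of_real (q t) * u t ?\<phi>))"
      unfolding lebesgue_on_integral_eq[OF set_integral_add(1)[OF 1 2], symmetric]
      by (rule Bochner_Integration.integral_cong) (auto simp: Hu numeral_2_eq_2 algebra_simps)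
    also have "\<dots> = (LINT t|lebesgue_on {0..T}. of_real (\<psi> t) * f t ?\<phi>)"
      using we D.H_inf_b[of \<xi>] \<psi> unfolding wave_equation_def by blast
    also have "\<dots> = integral {0..T} (\<lambda>t. of_real (\<psi> t) * f t ?\<phi>)" by (rule lebesgue_on_integral_eq[OF 3])
    finally have "integral {0..T} (\<lambda>t. of_real (deriv (deriv \<psi>) t) * u t ?\<phi>)
        = integral {0..T} (\<lambda>t. of_real (\<psi> t) * f t ?\<phi>) - integral {0..T} (\<lambda>t. of_real (\<psi> t) * (of_real (a t * ?l + q t) * u t ?\<phi>))"
      unfolding Henstock_Kurzweil_Integration.integral_add[OF i1 i2] by (simp add: algebra_simps)
    also have "\<dots> = integral {0..T} (\<lambda>t. of_real (\<psi> t) * f t ?\<phi> - of_real (\<psi> t) * (of_real (a t * ?l + q t) * u t ?\<phi>))"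
      by (rule Henstock_Kurzweil_Integration.integral_diff[OF i3 i2, symmetric])
    finally show "integral {0..T} (\<lambda>t. deriv (deriv \<psi>) t *\<^sub>R u t ?\<phi>)
        = integral {0..T} (\<lambda>t. \<psi> t *\<^sub>R (f t ?\<phi> - of_real (a t * ?l + q t) * u t ?\<phi>))"
      by (simp add: scaleR_conv_of_real right_diff_distrib)
  qed
  then show "primitive T (\<lambda>t. hat (f t) \<xi> - of_real (a t * ?l + q t) * hat (u t) \<xi>) (\<lambda>t. hat (Hs_deriv h V T s u t) \<xi>)"
    unfolding hat_def .
qed

lemma solution_energy:
  assumes u: "wave_solution h V T s a q f u0 u1 u" and t: "t \<in> {0..T}"
  shows "(Hs_norm h V (1 + s) (u t))\<^sup>2 + (Hs_norm h V s (Hs_deriv h V T s u t))\<^sup>2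
    \<le> wave_const * ((Hs_norm h V (1 + s) u0)\<^sup>2 + (Hs_norm h V s u1)\<^sup>2 + (L2_Hs_norm h V T s f)\<^sup>2)"
proof -
  have ut: "u t \<in> Hs h V (1 + s)" and u't: "Hs_deriv h V T s u t \<in> Hs h V s"
    and init: "u 0 = u0" "Hs_deriv h V T s u 0 = u1"
    using u t by (auto simp: wave_solution_def C1_Hs_def C0_Hs_def)
  have "(Hs_norm h V (1 + s) (u t))\<^sup>2 + (Hs_norm h V s (Hs_deriv h V T s u t))\<^sup>2 \<le> suminf mode_bound"
  proof (rule sums_le)
    show "(\<lambda>\<xi>. (1 + eigval h V \<xi>) powr (1 + s) * (cmod (hat (u t) \<xi>))\<^sup>2
        + (1 + eigval h V \<xi>) powr s * (cmod (hat (Hs_deriv h V T s u t) \<xi>))\<^sup>2)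
        sums ((Hs_norm h V (1 + s) (u t))\<^sup>2 + (Hs_norm h V s (Hs_deriv h V T s u t))\<^sup>2)"
      by (intro sums_add Hs_norm_sums ut u't)
    show "mode_bound sums suminf mode_bound" by (rule summable_sums[OF mode_bound_sum(1)])
    show "(1 + eigval h V \<xi>) powr (1 + s) * (cmod (hat (u t) \<xi>))\<^sup>2
        + (1 + eigval h V \<xi>) powr s * (cmod (hat (Hs_deriv h V T s u t) \<xi>))\<^sup>2 \<le> mode_bound \<xi>" for \<xi>
      by (rule weighted_mode_estimate[OF solution_modes[OF u]]) (use t init in auto)
  qed
  then show ?thesis using mode_bound_sum(2) by linarith
qed

text \<open>The difference is taken in each mode separately, where it solves the equation with zero
  forcing and zero initial data, so that the modal estimate makes it vanish.\<close>

lemma solution_unique: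
  assumes u: "wave_solution h V T s a q f u0 u1 u" and w: "wave_solution h V T s a q f u0 u1 w"
    and t: "t \<in> {0..T}"
  shows "u t = w t"
proof (rule Hs_eqI)
  show "u t \<in> Hs h V (1 + s)" "w t \<in> Hs h V (1 + s)"
    using u w t by (auto simp: wave_solution_def C0_Hs_def)
  fix \<xi>
  let ?v = "\<lambda>t. hat (u t) \<xi> - hat (w t) \<xi>"
  let ?v' = "\<lambda>t. hat (Hs_deriv h V T s u t) \<xi> - hat (Hs_deriv h V T s w t) \<xi>"
  have v: "primitive T ?v' ?v"
    by (rule primitive_diff_fun[OF solution_modes(1)[OF u] solution_modes(1)[OF w]])
  have v': "primitive T (\<lambda>t. - of_real (a t * eigval h V \<xi> + q t) * ?v t) ?v'"
    by (rule primitive_cong_integrand[OF primitive_diff_fun[OF solution_modes(2)[OF u] solution_modes(2)[OF w]]])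
       (simp add: algebra_simps)
  have "(1 + eigval h V \<xi>) * (cmod (?v t))\<^sup>2 + (cmod (?v' t))\<^sup>2
      \<le> wave_const * ((1 + eigval h V \<xi>) * (cmod (?v 0))\<^sup>2 + (cmod (?v' 0))\<^sup>2 + integral {0..T} (\<lambda>t. (cmod 0)\<^sup>2))"
  proof (rule mode_estimate[OF v v' _ _ E.lam_nonneg t])
    show "AE t in lebesgue_on {0..T}. - of_real (a t * eigval h V \<xi> + q t) * ?v t
        = 0 - of_real (a t * eigval h V \<xi> + q t) * ?v t"
      by (rule AE_I2) (simp only: diff_0 mult_minus_left)
  qed (auto intro: continuous_absolutely_integrable)
  moreover have "u 0 = w 0" "Hs_deriv h V T s u 0 = Hs_deriv h V T s w 0"
    using u w by (auto simp: wave_solution_def)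
  ultimately have "(1 + eigval h V \<xi>) * (cmod (?v t))\<^sup>2 + (cmod (?v' t))\<^sup>2 \<le> 0" by simp
  moreover have "1 * (cmod (?v t))\<^sup>2 \<le> (1 + eigval h V \<xi>) * (cmod (?v t))\<^sup>2"
    using E.lam_nonneg[of \<xi>] by (intro mult_right_mono) auto
  ultimately have "(cmod (?v t))\<^sup>2 \<le> 0" using zero_le_power2[of "cmod (?v' t)"] by linarith
  then show "hat (u t) \<xi> = hat (w t) \<xi>" by simp
qed

text \<open>The weak equation is the sum of the modal ones, multiplied by the coefficients of the
  smooth vector. The difficulty is the interchange with the time integral: y carries only the weight
  s while H costs a factor 1 + \<lambda>, and the rapid decay of the coefficients has to make up for
  it.\<close>

lemma synthesized_wave_equation:
  fixes y y' :: "nat \<Rightarrow> real \<Rightarrow> complex"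
  defines "u \<equiv> \<lambda>t. D.distr_of (\<lambda>\<xi>. y \<xi> t)"
  assumes p: "\<And>\<xi>. primitive T (y' \<xi>) (y \<xi>)" and p': "\<And>\<xi>. primitive T (g \<xi>) (y' \<xi>)"
    and g: "\<And>\<xi>. AE t in lebesgue_on {0..T}. g \<xi> t = hat (f t) \<xi> - of_real (a t * eigval h V \<xi> + q t) * y \<xi> t"
    and M: "summable M" and bound: "\<And>\<xi> t. t \<in> {0..T} \<Longrightarrow> (1 + eigval h V \<xi>) powr s * (cmod (y \<xi> t))\<^sup>2 \<le> M \<xi>"
  shows "wave_equation h V T a q f u"
  unfolding wave_equation_def
proof (intro ballI allI impI)
  fix \<phi> :: "'n gridfun" and \<psi> assume \<phi>: "\<phi> \<in> H_inf h V" and \<psi>: "test_function T \<psi>"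
  let ?M = "lebesgue_on {0..T}"
  let ?n = "\<lambda>\<xi>. 1 + eigval h V \<xi>"
  let ?l = "eigval h V"
  have T0: "0 \<le> T" using T_pos by simp
  note \<psi>' = test_function_deriv[OF \<psi>]
  note \<psi>'' = test_function_deriv[OF \<psi>']
  note c\<psi> = test_function_continuous[OF \<psi>, of "{0..T}"] and c\<psi>'' = test_function_continuous[OF \<psi>'', of "{0..T}"]
  have cy: "continuous_on {0..T} (y \<xi>)" for \<xi> by (rule primitive_continuous[OF p])
  have ws: "E.weighted_summable s (\<lambda>\<xi>. y \<xi> t)" if "t \<in> {0..T}" for t
    by (rule weighted_summable_bounded[OF M bound[OF that]])
  have uC: "C0_Hs h V T s u" unfolding u_def by (rule C0_Hs_distr_of[OF M cy bound])
  have H\<phi>: "schroedinger h V \<phi> \<in> H_inf h V" by (rule D.H_inf_schroedinger[OF \<phi>])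
  have cu: "continuous_on {0..T} (\<lambda>t. u t \<phi>)" and cHu: "continuous_on {0..T} (\<lambda>t. u t (schroedinger h V \<phi>))"
    by (rule C0_Hs_pairing_continuous[OF uC \<phi>], rule C0_Hs_pairing_continuous[OF uC H\<phi>])
  define W where "W t = of_real (deriv (deriv \<psi>) t) * u t \<phi>
     + of_real (\<psi> t) * (of_real (a t) * u t (schroedinger h V \<phi>) + of_real (q t) * u t \<phi>)" for t
  have Wi: "W absolutely_integrable_on {0..T}"
    unfolding W_def[abs_def]
    by (intro set_integral_add continuous_mult_absolutely_integrable c\<psi> L_infty_mult_continuous a_L_infty
        q_bounded cu cHu continuous_absolutely_integrable continuous_intros c\<psi>'')
  note fi = L2_Hs_pairing_integrable(1)[OF f_L2 \<phi>]
  have Ri: "(\<lambda>t. of_real (\<psi> t) * f t \<phi>) absolutely_integrable_on {0..T}"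
    by (rule continuous_mult_absolutely_integrable[OF c\<psi> fi])
  define b where "b \<xi> t = of_real (a t * ?l \<xi> + q t) * y \<xi> t" for \<xi> t
  define G where "G \<xi> t = D.coef \<phi> \<xi> * (of_real (deriv (deriv \<psi>) t) * y \<xi> t + of_real (\<psi> t) * b \<xi> t - of_real (\<psi> t) * hat (f t) \<xi>)" for \<xi> t
  have bi: "b \<xi> absolutely_integrable_on {0..T}" for \<xi>
  proof -
    have "(\<lambda>t. of_real (a t) * (of_real (?l \<xi>) * y \<xi> t) + of_real (q t) * y \<xi> t) absolutely_integrable_on {0..T}"
      by (intro set_integral_add L_infty_mult_continuous a_L_infty q_bounded continuous_intros cy)
    then show ?thesis by (simp add: b_def[abs_def] algebra_simps)
  qed
  have i1: "(\<lambda>t. of_real (deriv (deriv \<psi>) t) * y \<xi> t) absolutely_integrable_on {0..T}" for \<xi>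
    by (intro continuous_absolutely_integrable continuous_intros cy c\<psi>'')
  have i2: "(\<lambda>t. of_real (\<psi> t) * b \<xi> t) absolutely_integrable_on {0..T}"
    and i3: "(\<lambda>t. of_real (\<psi> t) * hat (f t) \<xi>) absolutely_integrable_on {0..T}" for \<xi>
    by (intro continuous_mult_absolutely_integrable c\<psi> bi hat_forcing_integrable)+
  have Gi: "G \<xi> absolutely_integrable_on {0..T}" for \<xi>
    unfolding G_def[abs_def] by (intro set_integrable_mult_right set_integral_diff set_integral_add i1 i2 i3)
  \<comment> \<open>Two integrations by parts move both derivatives from \<psi> to y, where the
    modal equation applies.\<close>
  have G0: "integral {0..T} (G \<xi>) = 0" for \<xi>
  proof -
    have "integral {0..T} (\<lambda>t. of_real (deriv (deriv \<psi>) t) * y \<xi> t) = integral {0..T} (\<lambda>t. of_real (\<psi> t) * g \<xi> t)"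
      using test_function_by_parts(1)[OF \<psi> p' T0, of \<xi>] test_function_by_parts(1)[OF \<psi>' p T0, of \<xi>]
      by (simp add: scaleR_conv_of_real)
    also have "\<dots> = integral {0..T} (\<lambda>t. of_real (\<psi> t) * hat (f t) \<xi> - of_real (\<psi> t) * b \<xi> t)"
    proof (rule integral_spike_AE(2))
      show "AE t in ?M. of_real (\<psi> t) * g \<xi> t = of_real (\<psi> t) * hat (f t) \<xi> - of_real (\<psi> t) * b \<xi> t"
        using g[of \<xi>] by eventually_elim (simp only: b_def right_diff_distrib)
      show "(\<lambda>t. of_real (\<psi> t) * hat (f t) \<xi> - of_real (\<psi> t) * b \<xi> t) absolutely_integrable_on {0..T}"
        by (intro set_integral_diff i2 i3)
    qed
    also have "\<dots> = integral {0..T} (\<lambda>t. of_real (\<psi> t) * hat (f t) \<xi>) - integral {0..T} (\<lambda>t. of_real (\<psi> t) * b \<xi> t)"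
      by (intro Henstock_Kurzweil_Integration.integral_diff set_lebesgue_integral_eq_integral(1) i2 i3)
    finally have "integral {0..T} (\<lambda>t. of_real (deriv (deriv \<psi>) t) * y \<xi> t + of_real (\<psi> t) * b \<xi> t - of_real (\<psi> t) * hat (f t) \<xi>) = 0"
      using set_lebesgue_integral_eq_integral(1)[OF i1] set_lebesgue_integral_eq_integral(1)[OF i2]
        set_lebesgue_integral_eq_integral(1)[OF i3]
      by (simp add: Henstock_Kurzweil_Integration.integral_diff Henstock_Kurzweil_Integration.integral_add
          Henstock_Kurzweil_Integration.integrable_add)
    then show ?thesis unfolding G_def[abs_def] by (simp add: integral_mult_right)
  qed
  have Gsums: "AE t in ?M. (\<lambda>\<xi>. G \<xi> t) sums (W t - of_real (\<psi> t) * f t \<phi>)"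
  proof -
    have "AE t in ?M. f t \<in> Hs h V s" using f_L2 by (simp add: L2_Hs_def)
    then show ?thesis using AE_lebesgue_on_mem
    proof eventually_elim
      fix t assume ft: "f t \<in> Hs h V s" and t: "t \<in> {0..T}"
      have s1: "(\<lambda>\<xi>. D.coef \<phi> \<xi> * y \<xi> t) sums u t \<phi>"
        unfolding u_def by (rule D.distr_of_sums[OF ws[OF t] \<phi>])
      have s2: "(\<lambda>\<xi>. D.coef (schroedinger h V \<phi>) \<xi> * y \<xi> t) sums u t (schroedinger h V \<phi>)"
        unfolding u_def by (rule D.distr_of_sums[OF ws[OF t] H\<phi>])
      have s3: "(\<lambda>\<xi>. D.coef \<phi> \<xi> * hat (f t) \<xi>) sums f t \<phi>"
        unfolding hat_def by (rule D.H_minus_inf_expansion[OF Hs_H_minus_inf[OF ft] \<phi>])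
      have "(\<lambda>\<xi>. of_real (deriv (deriv \<psi>) t) * (D.coef \<phi> \<xi> * y \<xi> t)
          + of_real (\<psi> t) * (of_real (a t) * (D.coef (schroedinger h V \<phi>) \<xi> * y \<xi> t) + of_real (q t) * (D.coef \<phi> \<xi> * y \<xi> t))
          - of_real (\<psi> t) * (D.coef \<phi> \<xi> * hat (f t) \<xi>)) sums (W t - of_real (\<psi> t) * f t \<phi>)"
        unfolding W_def by (intro sums_diff sums_add sums_mult s1 s2 s3)
      moreover have "of_real (deriv (deriv \<psi>) t) * (D.coef \<phi> \<xi> * y \<xi> t)
          + of_real (\<psi> t) * (of_real (a t) * (D.coef (schroedinger h V \<phi>) \<xi> * y \<xi> t) + of_real (q t) * (D.coef \<phi> \<xi> * y \<xi> t))
          - of_real (\<psi> t) * (D.coef \<phi> \<xi> * hat (f t) \<xi>) = G \<xi> t" for \<xi>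
        unfolding G_def b_def D.coef_schroedinger[OF D.H_inf_dom_H[OF \<phi>]] by (simp add: algebra_simps)
      ultimately show "(\<lambda>\<xi>. G \<xi> t) sums (W t - of_real (\<psi> t) * f t \<phi>)" by simp
    qed
  qed
  obtain P where P: "\<And>t. t \<in> {0..T} \<Longrightarrow> \<bar>\<psi> t\<bar> \<le> P" "\<And>t. t \<in> {0..T} \<Longrightarrow> \<bar>deriv (deriv \<psi>) t\<bar> \<le> P"
  proof -
    obtain P1 P2 where "\<And>t. t \<in> {0..T} \<Longrightarrow> \<bar>\<psi> t\<bar> \<le> P1" "\<And>t. t \<in> {0..T} \<Longrightarrow> \<bar>deriv (deriv \<psi>) t\<bar> \<le> P2"
      using compact_imp_bounded[OF compact_continuous_image[OF c\<psi> compact_Icc]]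
        compact_imp_bounded[OF compact_continuous_image[OF c\<psi>'' compact_Icc]]
      unfolding bounded_iff by (metis image_eqI real_norm_def)
    then show ?thesis using that[of "max P1 P2"] by (simp add: le_max_iff_disj)
  qed
  have P0: "0 \<le> P" using P(1)[of 0] T0 by simp
  let ?A = "L_infty_norm T a" and ?Q = "L_infty_norm T q"
  note nn = L_infty_norm_nonneg[OF T_pos a_L_infty] L_infty_norm_nonneg[OF T_pos q_bounded]
  \<comment> \<open>One constant for all three parts of \<open>G\<close>: P for \<psi>'', P (A + Q)
    for the coefficient a \<lambda> + q measured against 1 + \<lambda>, and P for the
    forcing.\<close>
  define C where "C = P * (1 + ?A + ?Q)"
  have C: "0 \<le> C" "P \<le> C" unfolding C_def using P0 nn by (auto simp: mult_le_cancel_left1)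
  define F2 where "F2 \<xi> t = ?n \<xi> powr s * (cmod (hat (f t) \<xi>))\<^sup>2" for \<xi> t
  \<comment> \<open>The exponent comes from n x z = (n^(1 - s/2) x) (n^(s/2) z) with n = 1 +
    \<lambda>, a product bounded by the sum of the two squares. It is used with z = |y| and with z
    the modulus of the forcing coefficient, hence the 2 in \<open>B\<close>.\<close>
  define c2 where "c2 \<xi> = ?n \<xi> powr (2 - s) * (cmod (D.coef \<phi> \<xi>))\<^sup>2" for \<xi>
  define B where "B \<xi> t = C * ((2 * c2 \<xi> + M \<xi>) + F2 \<xi> t)" for \<xi> t
  have F2i: "F2 \<xi> absolutely_integrable_on {0..T}" for \<xi>
    unfolding F2_def[abs_def] by (intro set_integrable_mult_right hat_forcing_integrable)
  have c2s: "summable c2"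
    using D.rapid_imp_weighted_summable[OF D.H_inf_rapid[OF \<phi>], of "2 - s"] unfolding D.weighted_summable_def c2_def[abs_def] .
  have Bi: "B \<xi> absolutely_integrable_on {0..T}" for \<xi>
    unfolding B_def[abs_def] by (intro set_integrable_mult_right set_integral_add F2i continuous_absolutely_integrable continuous_intros)
  have Bint: "integral {0..T} (B \<xi>) = C * (T * (2 * c2 \<xi> + M \<xi>) + ?n \<xi> powr s * integral {0..T} (\<lambda>t. (cmod (hat (f t) \<xi>))\<^sup>2))" for \<xi>
  proof -
    have "integral {0..T} (B \<xi>) = C * integral {0..T} (\<lambda>t. (2 * c2 \<xi> + M \<xi>) + F2 \<xi> t)"
      unfolding B_def[abs_def] by (rule integral_mult_right)
    also have "integral {0..T} (\<lambda>t. (2 * c2 \<xi> + M \<xi>) + F2 \<xi> t) = integral {0..T} (\<lambda>t. 2 * c2 \<xi> + M \<xi>) + integral {0..T} (F2 \<xi>)"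
      by (intro Henstock_Kurzweil_Integration.integral_add set_lebesgue_integral_eq_integral(1)[OF F2i] integrable_const_ivl)
    also have "integral {0..T} (F2 \<xi>) = ?n \<xi> powr s * integral {0..T} (\<lambda>t. (cmod (hat (f t) \<xi>))\<^sup>2)"
      unfolding F2_def[abs_def] by (rule integral_mult_right)
    finally show ?thesis using T0 by simp
  qed
  have Bsum: "summable (\<lambda>\<xi>. integral {0..T} (B \<xi>))"
    unfolding Bint by (intro summable_mult summable_add c2s M L2_Hs_norm_sums(1)[OF f_L2])
  have GB: "AE t in ?M. summable (\<lambda>\<xi>. B \<xi> t) \<and> (\<forall>\<xi>. cmod (G \<xi> t) \<le> B \<xi> t)"
  proof -
    have "AE t in ?M. f t \<in> Hs h V s" using f_L2 by (simp add: L2_Hs_def)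
    then show ?thesis using AE_lebesgue_on_mem L_infty_AE_bound[OF q_bounded]
    proof eventually_elim
      fix t assume ft: "f t \<in> Hs h V s" and t: "t \<in> {0..T}" and qt: "\<bar>q t\<bar> \<le> ?Q"
      have "summable (\<lambda>\<xi>. F2 \<xi> t)" unfolding F2_def by (rule sums_summable[OF Hs_norm_sums[OF ft]])
      then have "summable (\<lambda>\<xi>. B \<xi> t)" unfolding B_def by (intro summable_mult summable_add c2s M)
      moreover have "cmod (G \<xi> t) \<le> B \<xi> t" for \<xi>
      proof -
        let ?x = "cmod (D.coef \<phi> \<xi>)" and ?Y = "cmod (y \<xi> t)" and ?F = "cmod (hat (f t) \<xi>)"
        have n: "1 \<le> ?n \<xi>" using E.lam_nonneg[of \<xi>] by simp
        have "\<bar>a t\<bar> \<le> ?A" using a_bounds[OF t] a0_pos by simp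
        then have "\<bar>a t * ?l \<xi> + q t\<bar> \<le> ?A * ?l \<xi> + ?Q"
          using E.lam_nonneg[of \<xi>] qt by (intro order_trans[OF abs_triangle_ineq] add_mono) (auto simp: abs_mult mult_right_mono)
        also have "\<dots> \<le> (?A + ?Q) * ?n \<xi>"
        proof -
          have "?A * ?l \<xi> \<le> ?A * ?n \<xi>" using nn by (intro mult_left_mono) auto
          moreover have "?Q * 1 \<le> ?Q * ?n \<xi>" using nn n by (intro mult_left_mono) auto
          ultimately show ?thesis by (simp add: distrib_right)
        qed
        finally have ab: "\<bar>a t * ?l \<xi> + q t\<bar> \<le> (?A + ?Q) * ?n \<xi>" .
        have "cmod (of_real (deriv (deriv \<psi>) t) * y \<xi> t + of_real (\<psi> t) * b \<xi> t - of_real (\<psi> t) * hat (f t) \<xi>)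
            \<le> \<bar>deriv (deriv \<psi>) t\<bar> * ?Y + \<bar>\<psi> t\<bar> * (\<bar>a t * ?l \<xi> + q t\<bar> * ?Y) + \<bar>\<psi> t\<bar> * ?F"
          by (intro order_trans[OF norm_triangle_ineq4] order_trans[OF add_right_mono[OF norm_triangle_ineq]])
             (simp only: b_def norm_mult norm_of_real order_refl)
        also have "\<dots> \<le> P * (?n \<xi> * ?Y) + P * ((?A + ?Q) * ?n \<xi> * ?Y) + P * ?F"
          using mult_right_mono[OF n, of ?Y]
          by (intro add_mono mult_mono mult_right_mono[OF ab] P t) (use P0 nn n in auto)
        also have "\<dots> = C * (?n \<xi> * ?Y) + P * ?F" by (simp add: C_def algebra_simps)
        also have "\<dots> \<le> C * (?n \<xi> * ?Y) + C * ?F" using C by (intro add_left_mono mult_right_mono) auto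
        finally have "cmod (G \<xi> t) \<le> ?x * (C * (?n \<xi> * ?Y) + C * ?F)"
          unfolding G_def norm_mult by (rule mult_left_mono) simp
        also have "\<dots> = C * (?n \<xi> * ?x * ?Y + ?x * ?F)" by (simp add: algebra_simps)
        also have "\<dots> \<le> B \<xi> t"
          unfolding B_def
        proof (rule mult_left_mono[OF _ C(1)])
          have n0: "0 < ?n \<xi>" using n by linarith
          let ?r = "?n \<xi> powr (1 - s / 2)" and ?w = "?n \<xi> powr (s / 2)"
          have rw: "?r * ?w = ?n \<xi>" using n0 by (simp add: powr_add[symmetric])
          have r2: "?r\<^sup>2 = ?n \<xi> powr (2 - s)" and w2: "?w\<^sup>2 = ?n \<xi> powr s"
            using n0 by (auto simp: power2_eq_square powr_add[symmetric])
          have prod: "?n \<xi> * ?x * z \<le> c2 \<xi> + ?n \<xi> powr s * z\<^sup>2" if "0 \<le> z" for z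
          proof -
            have "2 * ((?r * ?x) * (?w * z)) \<le> (?r * ?x)\<^sup>2 + (?w * z)\<^sup>2"
              using sum_squares_bound[of "?r * ?x" "?w * z"] by (simp add: mult.assoc)
            moreover have "0 \<le> (?r * ?x) * (?w * z)" using that by simp
            moreover have "(?r * ?x) * (?w * z) = (?r * ?w) * ?x * z" by (simp only: mult_ac)
            moreover have "\<dots> = ?n \<xi> * ?x * z" by (simp only: rw)
            ultimately have "?n \<xi> * ?x * z \<le> (?r * ?x)\<^sup>2 + (?w * z)\<^sup>2" by linarith
            then show ?thesis by (simp add: power_mult_distrib r2 w2 c2_def)
          qed
          have "?n \<xi> * ?x * ?Y \<le> c2 \<xi> + M \<xi>" using prod[of ?Y] bound[OF t, of \<xi>] by simp
          moreover have "?x * ?F \<le> c2 \<xi> + F2 \<xi> t"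
          proof -
            have "1 * (?x * ?F) \<le> ?n \<xi> * (?x * ?F)" using n by (intro mult_right_mono) auto
            then show ?thesis using prod[of ?F] by (simp add: F2_def mult.assoc)
          qed
          ultimately show "?n \<xi> * ?x * ?Y + ?x * ?F \<le> (2 * c2 \<xi> + M \<xi>) + F2 \<xi> t" by linarith
        qed
        finally show ?thesis .
      qed
      ultimately show "summable (\<lambda>\<xi>. B \<xi> t) \<and> (\<forall>\<xi>. cmod (G \<xi> t) \<le> B \<xi> t)" by blast
    qed
  qed
  have "(LINT t|?M. W t - of_real (\<psi> t) * f t \<phi>) = 0"
    by (rule termwise_integral_zero[OF Gi G0 Bi Bsum GB Gsums set_integral_diff(1)[OF Wi Ri]])
  then have "(LINT t|?M. W t) = (LINT t|?M. of_real (\<psi> t) * f t \<phi>)"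
    using Wi Ri by (simp add: absolutely_integrable_iff_lebesgue_on)
  moreover have "H_distr h V (u t) \<phi> = u t (schroedinger h V \<phi>)" for t using \<phi> by (simp add: H_distr_def)
  ultimately show "(LINT t|?M. of_real ((deriv ^^ 2) \<psi> t) * u t \<phi>
          + of_real (\<psi> t) * (of_real (a t) * H_distr h V (u t) \<phi> + of_real (q t) * u t \<phi>))
      = (LINT t|?M. of_real (\<psi> t) * f t \<phi>)"
    by (simp add: W_def numeral_2_eq_2)
qed

lemma solution_exists: "\<exists>u. wave_solution h V T s a q f u0 u1 u"
proof -
  let ?Q = "L_infty_norm T q"
  have T0: "0 \<le> T" and t0: "0 \<in> {0..T}" using T_pos by auto
  \<comment> \<open>The fixed point argument wants a coefficient bounded at every time, so q is
    truncated at its essential bound; this changes it only on a null set.\<close>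
  define qc where "qc t = max (- ?Q) (min ?Q (q t))" for t
  define R where "R \<xi> y y' \<longleftrightarrow> primitive T y' y \<and> y 0 = hat u0 \<xi> \<and> y' 0 = hat u1 \<xi> \<and>
      primitive T (\<lambda>t. hat (f t) \<xi> - of_real (a t * eigval h V \<xi> + qc t) * y t) y'" for \<xi> y y'
  have "\<exists>y y'. R \<xi> y y'" for \<xi>
  proof -
    have m: "(\<lambda>t. a t * eigval h V \<xi> + qc t) \<in> borel_measurable (lebesgue_on {0..T})"
      unfolding qc_def using L_infty_measurable[OF a_L_infty] L_infty_measurable[OF q_bounded] by measurable
    have "\<bar>a t * eigval h V \<xi> + qc t\<bar> \<le> L_infty_norm T a * eigval h V \<xi> + ?Q" if "t \<in> {0..T}" for t
    proof -
      have "\<bar>a t\<bar> \<le> L_infty_norm T a" using a_bounds[OF that] a0_pos by simp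
      moreover have "\<bar>qc t\<bar> \<le> ?Q" unfolding qc_def using L_infty_norm_nonneg[OF T_pos q_bounded] by auto
      ultimately show ?thesis
        using E.lam_nonneg[of \<xi>]
        by (intro order_trans[OF abs_triangle_ineq] add_mono) (auto simp: abs_mult mult_right_mono)
    qed
    then obtain v v' where "primitive T v' v" "v 0 = hat u0 \<xi>" "v' 0 = hat u1 \<xi>"
      "primitive T (\<lambda>t. hat (f t) \<xi> - of_real (a t * eigval h V \<xi> + qc t) * v t) v'"
      by (rule mode_solution_exists[OF T0 m _ hat_forcing_integrable(1)[of \<xi>],
            where ?v0.0="hat u0 \<xi>" and ?v1.0="hat u1 \<xi>"])
    then have "R \<xi> v v'" unfolding R_def by (intro conjI)
    then show ?thesis by blast
  qed
  then obtain y y' where R: "\<And>\<xi>. R \<xi> (y \<xi>) (y' \<xi>)" by metis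
  note Rs = R[unfolded R_def]
  have p: "primitive T (y' \<xi>) (y \<xi>)" for \<xi> using Rs[of \<xi>] by (elim conjE)
  have init: "y \<xi> 0 = hat u0 \<xi>" "y' \<xi> 0 = hat u1 \<xi>" for \<xi> using Rs[of \<xi>] by auto
  have p': "primitive T (\<lambda>t. hat (f t) \<xi> - of_real (a t * eigval h V \<xi> + qc t) * y \<xi> t) (y' \<xi>)" for \<xi>
    using Rs[of \<xi>] by (elim conjE)
  have ae: "AE t in lebesgue_on {0..T}. hat (f t) \<xi> - of_real (a t * eigval h V \<xi> + qc t) * y \<xi> t
      = hat (f t) \<xi> - of_real (a t * eigval h V \<xi> + q t) * y \<xi> t" for \<xi>
    using L_infty_AE_bound[OF q_bounded]
  proof eventually_elim
    fix t assume "\<bar>q t\<bar> \<le> ?Q"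
    then have "qc t = q t" by (auto simp: qc_def)
    then show "hat (f t) \<xi> - of_real (a t * eigval h V \<xi> + qc t) * y \<xi> t
      = hat (f t) \<xi> - of_real (a t * eigval h V \<xi> + q t) * y \<xi> t" by simp
  qed
  have est: "(1 + eigval h V \<xi>) powr (1 + s) * (cmod (y \<xi> t))\<^sup>2 + (1 + eigval h V \<xi>) powr s * (cmod (y' \<xi> t))\<^sup>2 \<le> mode_bound \<xi>"
    if "t \<in> {0..T}" for \<xi> t
    by (rule weighted_mode_estimate[OF p p' ae init that])
  have b1: "(1 + eigval h V \<xi>) powr (1 + s) * (cmod (y \<xi> t))\<^sup>2 \<le> mode_bound \<xi>" if "t \<in> {0..T}" for \<xi> t
    using est[OF that, of \<xi>] by (smt (verit) mult_nonneg_nonneg powr_ge_zero zero_le_power2)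
  have b': "(1 + eigval h V \<xi>) powr s * (cmod (y' \<xi> t))\<^sup>2 \<le> mode_bound \<xi>" if "t \<in> {0..T}" for \<xi> t
    using est[OF that, of \<xi>] by (smt (verit) mult_nonneg_nonneg powr_ge_zero zero_le_power2)
  \<comment> \<open>The eigenvalues are nonnegative, so the weight with exponent s is at most the
    one with 1 + s, and the same majorant shows that u is a curve in \<open>H^s\<close>.\<close>
  have b0: "(1 + eigval h V \<xi>) powr s * (cmod (y \<xi> t))\<^sup>2 \<le> mode_bound \<xi>" if "t \<in> {0..T}" for \<xi> t
  proof -
    have "(1 + eigval h V \<xi>) powr s * (cmod (y \<xi> t))\<^sup>2 \<le> (1 + eigval h V \<xi>) powr (1 + s) * (cmod (y \<xi> t))\<^sup>2"
      using E.lam_nonneg[of \<xi>] by (intro mult_right_mono powr_mono) auto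
    then show ?thesis using b1[OF that, of \<xi>] by linarith
  qed
  define u where "u t = D.distr_of (\<lambda>\<xi>. y \<xi> t)" for t
  define u' where "u' t = D.distr_of (\<lambda>\<xi>. y' \<xi> t)" for t
  note ms = mode_bound_sum(1)
  have cy: "continuous_on {0..T} (y \<xi>)" and cy': "continuous_on {0..T} (y' \<xi>)" for \<xi>
    by (rule primitive_continuous[OF p], rule primitive_continuous[OF p'])
  have C0: "C0_Hs h V T (1 + s) u" "C0_Hs h V T s u" "C0_Hs h V T s u'"
    unfolding u_def[abs_def] u'_def[abs_def]
    by (intro C0_Hs_distr_of[OF ms] cy cy' b1 b0 b'; assumption)+
  have der: "has_Hs_derivative h V T s u (u' t) t" if "t \<in> {0..T}" for t
    unfolding u_def[abs_def] u'_def by (rule has_Hs_derivative_distr_of[OF ms p cy' b0 b' that])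
  have uH: "u \<tau> \<in> Hs h V s" if "\<tau> \<in> {0..T}" for \<tau> using C0(2) that by (simp add: C0_Hs_def)
  have deq: "Hs_deriv h V T s u t = u' t" if "t \<in> {0..T}" for t
    by (rule Hs_deriv_eqI[OF der[OF that] uH that T_pos])
  have "C0_Hs h V T s (Hs_deriv h V T s u)"
    using C0_Hs_cong[of T "Hs_deriv h V T s u" u' h V s, OF deq] C0(3) by blast
  then have "C1_Hs h V T s u"
    unfolding C1_Hs_def using C0(2) der by blast
  moreover have "wave_equation h V T a q f u"
    unfolding u_def[abs_def] by (rule synthesized_wave_equation[OF p p' ae ms b0])
  moreover have "u 0 = u0" "u' 0 = u1"
    unfolding u_def u'_def init using distr_of_hat[OF u0_Hs] distr_of_hat[OF u1_Hs] by auto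
  ultimately have "wave_solution h V T s a q f u0 u1 u"
    unfolding wave_solution_def using C0(1) deq[OF t0] by simp
  then show ?thesis by blast
qed

end

theorem theorem2p1:
  fixes h T s a0 :: real
    and V :: "real ^ 'n::finite \<Rightarrow> real"
    and a q :: "real \<Rightarrow> real"
    and f :: "real \<Rightarrow> 'n distr"
    and u0 u1 :: "'n distr"
  assumes "h > 0"
    and "\<And>k. k \<in> lattice h \<Longrightarrow> 0 \<le> V k"
    and "filterlim V at_top (inf at_infinity (principal (lattice h)))"
    and "T > 0"
    and "L2_Hs h V T s f"
    and "L_infty_diff 1 T a"
    and "(INF t\<in>{0..T}. a t) = a0" and "a0 > 0"
    and "L_infty T q"
    and "u0 \<in> Hs h V (1 + s)" and "u1 \<in> Hs h V s"
  shows "(\<exists>u. wave_solution h V T s a q f u0 u1 u) \<and>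
    (\<forall>u w. wave_solution h V T s a q f u0 u1 u \<longrightarrow> wave_solution h V T s a q f u0 u1 w \<longrightarrow>
       (\<forall>t\<in>{0..T}. u t = w t)) \<and>
    (\<forall>u. wave_solution h V T s a q f u0 u1 u \<longrightarrow>
       (let c0 = min a0 1;
            CT = inverse c0 * (1 + L_infty_norm T a) *
                 exp (inverse c0 * (1 + L_infty_norm T (time_deriv T a) + L_infty_norm T q
                                      + 2 * L_infty_norm T a) * T)
        in \<forall>t\<in>{0..T}.
             (Hs_norm h V (1 + s) (u t))\<^sup>2 + (Hs_norm h V s (Hs_deriv h V T s u t))\<^sup>2
             \<le> CT * ((Hs_norm h V (1 + s) u0)\<^sup>2 + (Hs_norm h V s u1)\<^sup>2
                      + (L2_Hs_norm h V T s f)\<^sup>2)))"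
proof -
  interpret wave_problem h V T s a0 a q f u0 u1
    by unfold_locales (fact assms)+
  show ?thesis
    unfolding Let_def wave_const_def[symmetric]
    using solution_exists solution_unique solution_energy by blast
qed

end
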